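(* Let $G$ be a group that admits a Conradian left-order. Then the following conditions are equivalent: (a) There is an isolated element in $\mathcal{CO}_{\{1\}}(G)$. (b) All the elements of $\mathcal{CO}_{\{1\}}(G)$ are isolated (in $\mathcal{CO}_{\{1\}}(G)$). (c) All the elements of $\mathcal{CO}(G)$ are isolated (in $\mathcal{CO}(G)$). (d) There exists a finite rational series on $G$ starting on $G$ and ending on $\{1\}$, and this series has no abelian jumps. (e) There exists a unique finite rational series on $G$ starting on $G$ and ending on $\{1\}$, and this series has no abelian jumps. (f) $\mathcal{CO}_{\{1\}}(G)$ is finite. (g) $\mathcal{CO}(G)$ is finite. Moreover, under these equivalent conditions, $|\mathcal{CO}(G)|=2^{n+1}-2$ and $|\mathcal{CO}_{\{1\}}(G)|=2^n$, where $n$ is the length of any series as in (d) and (e).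
   Context: A left-preorder on a group $G$ is a binary relation $\preceq$ on $G$ that is total, transitive and reflexive, that is left-invariant ($\alpha_1\preceq\alpha_2$ implies $\alpha\alpha_1\preceq\alpha\alpha_2$), and that is not the trivial relation (the one with $\alpha_1\preceq\alpha_2$ for all $\alpha_1,\alpha_2$). Write $\alpha\prec\beta$ if $\alpha\preceq\beta$ and not $\beta\preceq\alpha$. The set $C=\{\alpha\in G: \alpha\preceq 1\text{ and }1\preceq\alpha\}$ is a proper subgroup of $G$, and $\preceq$ is called a left-preorder on $G$ relative to $C$. Its positive cone is $P=\{\alpha\in G:1\prec\alpha\}$, and $G=P\sqcup P^{-1}\sqcup C$. A left-order is an antisymmetric left-preorder, i.e. a left-preorder relative to $\{1\}$ (in particular, by the non-triviality convention, a group admitting a left-order is non-trivial). A left-preorder is Conradian if for all $\alpha,\beta\in G$ with $1\prec\alpha$ and $1\prec\beta$ there is $n\in\mathbb{N}$ ($0\in\mathbb N$) with $\alpha\prec\beta\alpha^n$. $\mathcal{CO}(G)$ is the set of all Conradian left-preorders on $G$, and $\mathcal{CO}_{\{1\}}(G)$ is the set of those relative to $\{1\}$, i.e. the Conradian left-orders. Topology: each left-preorder is identified with the map $G\to\{\pm1,0\}$ sending $P$ to $1$, $P^{-1}$ to $-1$ and $C$ to $0$. The sets $\mathcal{CO}(G)$ and $\mathcal{CO}_{\{1\}}(G)$ carry the subspace topology from $\{\pm1,0\}^G$ with the product topology ($\{\pm1,0\}$ discrete). A finite rational series on $G$ starting on $G$ and ending on $\{1\}$ is a series of subgroups $\{1\}=G_0\trianglelefteq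 G_1\trianglelefteq\cdots\trianglelefteq G_n=G$ such that each $G_i$ is normal in $G_{i+1}$ and $G_{i+1}/G_i$ is torsion-free abelian of rank $1$ for all $0\le i<n$; its length is $n$. An abelian jump of the series is a subseries $G_i\trianglelefteq G_{i+1}\trianglelefteq G_{i+2}$ ($0\le i\le n-2$) such that $G_i$ is normal in $G_{i+2}$ and $G_{i+2}/G_i$ is abelian. In (e), uniqueness is among all rational series starting on $G$ and ending on $\{1\}$. *)

theory Defs
  imports
    "HOL-Algebra.Coset"
    "HOL-Algebra.FiniteProduct"
    "HOL-Analysis.Product_Topology"
    "HOL-Analysis.Function_Topology"
begin

section \<open>Left-preorders\<close>

definition left_preorder :: "('a, 'b) monoid_scheme \<Rightarrow> 'a rel \<Rightarrow> bool" where
  "left_preorder G r \<longleftrightarrow>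
     preorder_on (carrier G) r \<and> total_on (carrier G) r \<and>
     (\<forall>a\<in>carrier G. \<forall>x\<in>carrier G. \<forall>y\<in>carrier G.
        (x, y) \<in> r \<longrightarrow> (a \<otimes>\<^bsub>G\<^esub> x, a \<otimes>\<^bsub>G\<^esub> y) \<in> r) \<and>
     r \<noteq> carrier G \<times> carrier G"

definition strictly_below :: "'a rel \<Rightarrow> 'a \<Rightarrow> 'a \<Rightarrow> bool" where
  "strictly_below r x y \<longleftrightarrow> (x, y) \<in> r \<and> (y, x) \<notin> r"

definition residue :: "('a, 'b) monoid_scheme \<Rightarrow> 'a rel \<Rightarrow> 'a set" where
  "residue G r = {x \<in> carrier G. (x, \<one>\<^bsub>G\<^esub>) \<in> r \<and> (\<one>\<^bsub>G\<^esub>, x) \<in> r}"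

definition positive_cone :: "('a, 'b) monoid_scheme \<Rightarrow> 'a rel \<Rightarrow> 'a set" where
  "positive_cone G r = {x \<in> carrier G. strictly_below r \<one>\<^bsub>G\<^esub> x}"

definition left_order :: "('a, 'b) monoid_scheme \<Rightarrow> 'a rel \<Rightarrow> bool" where
  "left_order G r \<longleftrightarrow> left_preorder G r \<and> antisym r"

definition Conradian :: "('a, 'b) monoid_scheme \<Rightarrow> 'a rel \<Rightarrow> bool" where
  "Conradian G r \<longleftrightarrow>
     (\<forall>x\<in>carrier G. \<forall>y\<in>carrier G.
        strictly_below r \<one>\<^bsub>G\<^esub> x \<and> strictly_below r \<one>\<^bsub>G\<^esub> y \<longrightarrow>
        (\<exists>n::nat. strictly_below r x (y \<otimes>\<^bsub>G\<^esub> x [^]\<^bsub>G\<^esub> n)))"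

definition CO :: "('a, 'b) monoid_scheme \<Rightarrow> 'a rel set" where
  "CO G = {r. left_preorder G r \<and> Conradian G r}"

definition CO_rel :: "('a, 'b) monoid_scheme \<Rightarrow> 'a set \<Rightarrow> 'a rel set" where
  "CO_rel G C = {r \<in> CO G. residue G r = C}"


section \<open>The topology on sets of left-preorders\<close>

definition sign_map :: "('a, 'b) monoid_scheme \<Rightarrow> 'a rel \<Rightarrow> 'a \<Rightarrow> int" where
  "sign_map G r =
     (\<lambda>x\<in>carrier G. if x \<in> positive_cone G r then 1
                    else if inv\<^bsub>G\<^esub> x \<in> positive_cone G r then - 1 else 0)"

text \<open>Since \<open>sign_map G\<close> is injective on left-preorders (lemma \<open>inj_on_sign_map\<close> below), the
  following is the subspace topology transported along the identification of a left-preorder with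
  its sign map.\<close>

definition sign_topology :: "('a, 'b) monoid_scheme \<Rightarrow> 'a rel set \<Rightarrow> 'a rel topology" where
  "sign_topology G S =
     pullback_topology S (sign_map G)
       (product_topology (\<lambda>_. discrete_topology {- 1, 0, 1}) (carrier G))"

definition isolated_point :: "'a topology \<Rightarrow> 'a \<Rightarrow> bool" where
  "isolated_point X x \<longleftrightarrow> x \<in> topspace X \<and> openin X {x}"


section \<open>Rational series\<close>

text \<open>The family \<open>c\<close> consists of integer exponents: this is linear independence over the integers
  in multiplicative notation.\<close>

definition int_independent :: "('a, 'b) monoid_scheme \<Rightarrow> 'a set \<Rightarrow> bool" where
  "int_independent A S \<longleftrightarrow>
     S \<subseteq> carrier A \<and>
     (\<forall>F c. finite F \<and> F \<subseteq> S \<and> (\<Otimes>\<^bsub>A\<^esub>x\<in>F. x [^]\<^bsub>A\<^esub> (c x :: int)) = \<one>\<^bsub>A\<^esub> \<longrightarrow>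
            (\<forall>x\<in>F. c x = 0))"

definition has_rank :: "('a, 'b) monoid_scheme \<Rightarrow> nat \<Rightarrow> bool" where
  "has_rank A k \<longleftrightarrow>
     (\<exists>S. int_independent A S \<and> finite S \<and> card S = k) \<and>
     (\<forall>S. int_independent A S \<longrightarrow> finite S \<and> card S \<le> k)"

definition torsion_free :: "('a, 'b) monoid_scheme \<Rightarrow> bool" where
  "torsion_free A \<longleftrightarrow>
     (\<forall>x\<in>carrier A. x \<noteq> \<one>\<^bsub>A\<^esub> \<longrightarrow> (\<forall>n::nat. n > 0 \<longrightarrow> x [^]\<^bsub>A\<^esub> n \<noteq> \<one>\<^bsub>A\<^esub>))"

definition subquotient :: "('a, 'b) monoid_scheme \<Rightarrow> 'a set \<Rightarrow> 'a set \<Rightarrow> 'a set monoid" where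
  "subquotient G K H = (G\<lparr>carrier := K\<rparr>) Mod H"

text \<open>A series \<open>G\<^sub>0, \<dots>, G\<^sub>n\<close> is the list of its \<open>n + 1\<close> terms, in increasing order.\<close>

definition rational_series :: "('a, 'b) monoid_scheme \<Rightarrow> 'a set list \<Rightarrow> bool" where
  "rational_series G Hs \<longleftrightarrow>
     Hs \<noteq> [] \<and> hd Hs = {\<one>\<^bsub>G\<^esub>} \<and> last Hs = carrier G \<and>
     (\<forall>H\<in>set Hs. subgroup H G) \<and>
     (\<forall>i. Suc i < length Hs \<longrightarrow>
        Hs ! i \<lhd> G\<lparr>carrier := Hs ! Suc i\<rparr> \<and>
        comm_group (subquotient G (Hs ! Suc i) (Hs ! i)) \<and>
        torsion_free (subquotient G (Hs ! Suc i) (Hs ! i)) \<and>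
        has_rank (subquotient G (Hs ! Suc i) (Hs ! i)) 1)"

definition series_length :: "'a set list \<Rightarrow> nat" where
  "series_length Hs = length Hs - 1"

definition abelian_jump :: "('a, 'b) monoid_scheme \<Rightarrow> 'a set list \<Rightarrow> nat \<Rightarrow> bool" where
  "abelian_jump G Hs i \<longleftrightarrow>
     i + 2 < length Hs \<and>
     Hs ! i \<lhd> G\<lparr>carrier := Hs ! (i + 2)\<rparr> \<and>
     comm_group (subquotient G (Hs ! (i + 2)) (Hs ! i))"

definition no_abelian_jumps :: "('a, 'b) monoid_scheme \<Rightarrow> 'a set list \<Rightarrow> bool" where
  "no_abelian_jumps G Hs \<longleftrightarrow> (\<forall>i. \<not> abelian_jump G Hs i)"


section \<open>Consistency of the conventions\<close>

lemma (in group) left_preorder_iff_one: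
  assumes "left_preorder G r" "x \<in> carrier G" "y \<in> carrier G"
  shows "(x, y) \<in> r \<longleftrightarrow> (\<one>, inv x \<otimes> y) \<in> r"
proof
  assume "(x, y) \<in> r"
  then have "(inv x \<otimes> x, inv x \<otimes> y) \<in> r"
    using assms unfolding left_preorder_def by blast
  then show "(\<one>, inv x \<otimes> y) \<in> r" using assms by simp
next
  assume "(\<one>, inv x \<otimes> y) \<in> r"
  then have "(x \<otimes> \<one>, x \<otimes> (inv x \<otimes> y)) \<in> r"
    using assms unfolding left_preorder_def by (meson inv_closed m_closed one_closed)
  then show "(x, y) \<in> r" using assms by (simp add: m_assoc[symmetric])
qed

lemma (in group) left_preorder_one_iff_sign_map:
  assumes r: "left_preorder G r" and x: "x \<in> carrier G"
  shows "(\<one>, x) \<in> r \<longleftrightarrow> 0 \<le> sign_map G r x"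
proof -
  have inv1: "(\<one>, inv x) \<in> r \<longleftrightarrow> (x, \<one>) \<in> r"
    using left_preorder_iff_one[OF r x one_closed] x by simp
  have inv2: "(inv x, \<one>) \<in> r \<longleftrightarrow> (\<one>, x) \<in> r"
    using left_preorder_iff_one[OF r, of "inv x" \<one>] x by simp
  have "(\<one>, x) \<in> r \<or> (x, \<one>) \<in> r"
    using r x unfolding left_preorder_def preorder_on_def refl_on_def total_on_def
    by (metis one_closed)
  then show ?thesis
    using x inv1 inv2 by (auto simp: sign_map_def positive_cone_def strictly_below_def)
qed

lemma (in group) inj_on_sign_map: "inj_on (sign_map G) {r. left_preorder G r}"
proof (rule inj_onI, clarsimp)
  fix r s assume r: "left_preorder G r" and s: "left_preorder G s"
    and eq: "sign_map G r = sign_map G s"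
  have iff: "(x, y) \<in> r \<longleftrightarrow> (x, y) \<in> s" if "x \<in> carrier G" "y \<in> carrier G" for x y
  proof -
    have c: "inv x \<otimes> y \<in> carrier G" using that by simp
    show ?thesis
      unfolding left_preorder_iff_one[OF r that] left_preorder_iff_one[OF s that]
        left_preorder_one_iff_sign_map[OF r c] left_preorder_one_iff_sign_map[OF s c] eq ..
  qed
  have "r \<subseteq> carrier G \<times> carrier G" "s \<subseteq> carrier G \<times> carrier G"
    using r s unfolding left_preorder_def preorder_on_def by blast+
  with iff show "r = s" by blast
qed

lemma (in group) left_order_iff_residue:
  "left_order G r \<longleftrightarrow> left_preorder G r \<and> residue G r = {\<one>}"
proof (cases "left_preorder G r")
  case True
  then have sub: "r \<subseteq> carrier G \<times> carrier G" and "(\<one>, \<one>) \<in> r"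
    unfolding left_preorder_def preorder_on_def refl_on_def by blast+
  have "antisym r" if res: "residue G r = {\<one>}"
  proof (rule antisymI)
    fix x y assume xy: "(x, y) \<in> r" and yx: "(y, x) \<in> r"
    then have c: "x \<in> carrier G" "y \<in> carrier G" using sub by auto
    have "(inv x \<otimes> y, inv x \<otimes> x) \<in> r"
      using True c yx unfolding left_preorder_def by blast
    then have "inv x \<otimes> y \<in> residue G r"
      using left_preorder_iff_one[OF True c] xy c by (simp add: residue_def)
    then have "inv x \<otimes> y = \<one>" using res by blast
    then have "x \<otimes> (inv x \<otimes> y) = x" using c by simp
    then show "x = y" using c by (simp add: m_assoc[symmetric])
  qed
  moreover have "residue G r = {\<one>}" if "antisym r"
    using that \<open>(\<one>, \<one>) \<in> r\<close> by (auto simp: residue_def dest: antisymD)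
  ultimately show ?thesis using True by (auto simp: left_order_def)
qed (simp add: left_order_def)

end

theory Submission
  imports Defs
begin

text \<open>
  Left-preorders are handled through their positive cones. By Conrad's theorem every positive
  element \<open>a\<close> sits in a jump \<open>conv_core a \<subset> conv_hull a\<close> of convex subgroups whose quotient is Archimedean,
  hence abelian.

  If \<open>N\<close> is the last proper term of a rational series without abelian jumps, then \<open>N\<close> is convex for
  every non-trivial Conradian left-preorder of \<open>G\<close>: otherwise the hull of an element of \<open>N\<close> outside
  the preceding term \<open>M\<close> would be all of \<open>G\<close>, and \<open>G/M\<close> would embed into the product of two
  abelian groups. A cone on \<open>G\<close> is therefore either empty or the lexicographic composition of one of
  the two orders of \<open>G/N\<close> with a cone on \<open>N\<close>, which gives the two counts; and the subgroup below the
  top of any other rational series, being the residue of such a preorder, must be \<open>N\<close>, which gives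
  uniqueness.

  Conversely, let an order be isolated by finitely many positive elements. The order of an abelian
  quotient of convex subgroups can be exchanged freely, so it is isolated too. In a minimal finite set
  generating its positive cone up to roots, two different elements \<open>f, g\<close> would be extremal, and
  neither \<open>f g\<^sup>-\<^sup>1\<close> nor its inverse could be positive; so the quotient has rank one. Hence
  every jump contains one of the finitely many elements and there is no abelian jump.
\<close>

section \<open>Total orders on abelian groups\<close>

text \<open>Right multiplication need not preserve a left-order; this is the obstacle behind
  Conrad's theorem. The exponent 2 in the Conradian condition is a substitute for it: passing from g
  < a^k to g a < a^(k+2) costs one extra factor a, so boundedness by powers of a survives products
  and hulls are subgroups. The trivial preorder is kept among the cones so that the cone on the
  lower term of a step may be arbitrary, even empty. The number of cones then obeys c = 1 + 2 c',
  starting from 1, which gives 2^(n+1) - 1 for length n; dropping the empty cone yields the count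
  2^(n+1) - 2. In the convexity argument rank one is what makes the two kernels meet in M: a
  root-closed subgroup containing M either meets N in M only or contains N. Topology enters only
  through finitely many prescribed signs, which amount to a finite set of elements that have to be
  positive.\<close>

definition total_cone :: "('a, 'b) monoid_scheme \<Rightarrow> 'a set \<Rightarrow> bool" where
  "total_cone G P \<longleftrightarrow>
     P \<subseteq> carrier G \<and> \<one>\<^bsub>G\<^esub> \<notin> P \<and> (\<forall>x\<in>P. \<forall>y\<in>P. x \<otimes>\<^bsub>G\<^esub> y \<in> P) \<and>
     (\<forall>x\<in>carrier G. x \<noteq> \<one>\<^bsub>G\<^esub> \<longrightarrow> x \<in> P \<or> inv\<^bsub>G\<^esub> x \<in> P)"

definition subsemigroup :: "('a, 'b) monoid_scheme \<Rightarrow> 'a set \<Rightarrow> bool" where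
  "subsemigroup G M \<longleftrightarrow> M \<subseteq> carrier G \<and> (\<forall>x\<in>M. \<forall>y\<in>M. x \<otimes>\<^bsub>G\<^esub> y \<in> M)"

text \<open>The empty product is left out: \<open>\<one>\<close> belongs to the span only if a
  nonempty product of elements of \<open>F\<close> is trivial, which is the obstruction to a cone
  containing \<open>F\<close>.\<close>

inductive_set semigroup_span :: "('a, 'b) monoid_scheme \<Rightarrow> 'a set \<Rightarrow> 'a set" for G F where
  incl: "x \<in> F \<Longrightarrow> x \<in> semigroup_span G F"
| mult: "x \<in> semigroup_span G F \<Longrightarrow> y \<in> semigroup_span G F \<Longrightarrow> x \<otimes>\<^bsub>G\<^esub> y \<in> semigroup_span G F"

context group
begin

lemma inv_mult_cancel [simp]:
  assumes "x \<in> carrier G" "y \<in> carrier G"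
  shows "inv x \<otimes> (x \<otimes> y) = y" "x \<otimes> (inv x \<otimes> y) = y"
  using assms by (simp_all add: m_assoc[symmetric])

lemma left_cancel [simp]:
  "c \<in> carrier G \<Longrightarrow> a \<in> carrier G \<Longrightarrow> b \<in> carrier G \<Longrightarrow> c \<otimes> a = c \<otimes> b \<longleftrightarrow> a = b"
  by (simp add: Units_eq)

lemma total_cone_inv: "total_cone G P \<Longrightarrow> x \<in> P \<Longrightarrow> inv x \<notin> P"
  unfolding total_cone_def by (metis r_inv subsetD)

lemma subsemigroup_pow:
  assumes "subsemigroup G M" "x \<in> M" "0 < k"
  shows "x [^] (k::nat) \<in> M"
  using assms(3)
proof (induction k rule: nat_induct_non_zero)
  case 1
  then show ?case using assms by (auto simp: subsemigroup_def)
next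
  case (Suc k)
  then show ?case using assms by (auto simp: subsemigroup_def)
qed

lemma subsemigroup_span: "F \<subseteq> carrier G \<Longrightarrow> subsemigroup G (semigroup_span G F)"
proof -
  assume F: "F \<subseteq> carrier G"
  have "x \<in> semigroup_span G F \<Longrightarrow> x \<in> carrier G" for x
    by (induction rule: semigroup_span.induct) (use F in auto)
  then show ?thesis unfolding subsemigroup_def by (auto intro: semigroup_span.mult)
qed

lemma semigroup_span_least: "F \<subseteq> M \<Longrightarrow> subsemigroup G M \<Longrightarrow> semigroup_span G F \<subseteq> M"
proof
  fix x assume M: "F \<subseteq> M" "subsemigroup G M" and "x \<in> semigroup_span G F"
  from this(3) show "x \<in> M"
    by (induction rule: semigroup_span.induct) (use M in \<open>auto simp: subsemigroup_def\<close>)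
qed

lemma total_cone_subsemigroup: "total_cone G P \<Longrightarrow> subsemigroup G P"
  by (simp add: total_cone_def subsemigroup_def)

end

text \<open>For a subsemigroup \<open>M\<close> of an abelian group this is the semigroup generated
  by \<open>g\<close> and \<open>M\<close>, in normal form. The last condition excludes just the
  empty product.\<close>

definition adjoin :: "('a, 'b) monoid_scheme \<Rightarrow> 'a \<Rightarrow> 'a set \<Rightarrow> 'a set" where
  "adjoin G g M =
     {g [^]\<^bsub>G\<^esub> k \<otimes>\<^bsub>G\<^esub> m |(k::nat) m. m \<in> insert \<one>\<^bsub>G\<^esub> M \<and> (0 < k \<or> m \<in> M)}"

context comm_group
begin

lemma subsemigroup_adjoin:
  assumes M: "subsemigroup G M" and g: "g \<in> carrier G"
  shows "subsemigroup G (adjoin G g M)"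
proof -
  have Mc: "M \<subseteq> carrier G" and Mm: "\<And>x y. x \<in> M \<Longrightarrow> y \<in> M \<Longrightarrow> x \<otimes> y \<in> M"
    using M by (auto simp: subsemigroup_def)
  have "x \<otimes> y \<in> adjoin G g M" if x: "x \<in> adjoin G g M" and y: "y \<in> adjoin G g M" for x y
  proof -
    obtain k m where km: "x = g [^] (k::nat) \<otimes> m" "m \<in> insert \<one> M" "0 < k \<or> m \<in> M"
      using x by (auto simp: adjoin_def)
    obtain l n where ln: "y = g [^] (l::nat) \<otimes> n" "n \<in> insert \<one> M" "0 < l \<or> n \<in> M"
      using y by (auto simp: adjoin_def)
    have mc: "m \<in> carrier G" "n \<in> carrier G" using km ln Mc by auto
    have "x \<otimes> y = (g [^] k \<otimes> g [^] l) \<otimes> (m \<otimes> n)"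
      using km ln mc g by (simp add: m_ac)
    also have "\<dots> = g [^] (k + l) \<otimes> (m \<otimes> n)" using g by (simp add: nat_pow_mult)
    finally have "x \<otimes> y = g [^] (k + l) \<otimes> (m \<otimes> n)" .
    moreover have "m \<otimes> n \<in> insert \<one> M" using km ln Mm mc by auto
    moreover have "0 < k + l \<or> m \<otimes> n \<in> M" using km ln Mm mc by auto
    ultimately show ?thesis unfolding adjoin_def by blast
  qed
  moreover have "adjoin G g M \<subseteq> carrier G" using Mc g by (auto simp: adjoin_def)
  ultimately show ?thesis by (simp add: subsemigroup_def)
qed

lemma adjoin_incl:
  assumes "M \<subseteq> carrier G" "g \<in> carrier G"
  shows "M \<subseteq> adjoin G g M" "g \<in> adjoin G g M"
proof
  fix m assume "m \<in> M"
  then have "m = g [^] (0::nat) \<otimes> m" using assms by auto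
  then show "m \<in> adjoin G g M" using \<open>m \<in> M\<close> unfolding adjoin_def by blast
next
  have "g = g [^] (1::nat) \<otimes> \<one>" using assms by simp
  then show "g \<in> adjoin G g M" unfolding adjoin_def by blast
qed

text \<open>Torsion-freeness rules out that a positive power of \<open>g\<close> alone is trivial,
  so a trivial product must involve an element of \<open>M\<close>, which is then a power of
  \<open>inv g\<close>.\<close>

lemma one_in_adjoin:
  assumes tf: "torsion_free G" and M: "subsemigroup G M" "\<one> \<notin> M" and g: "g \<in> carrier G" "g \<noteq> \<one>"
    and "\<one> \<in> adjoin G g M"
  shows "\<exists>k>0. inv g [^] (k::nat) \<in> M"
proof -
  obtain k m where km: "\<one> = g [^] (k::nat) \<otimes> m" "m \<in> insert \<one> M" "0 < k \<or> m \<in> M"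
    using assms(6) by (auto simp: adjoin_def)
  have mc: "m \<in> carrier G" using km M by (auto simp: subsemigroup_def)
  have "m = inv (g [^] k)"
    using km(1) mc g by (metis inv_equality m_comm nat_pow_closed)
  then have m: "m = inv g [^] k" using g by (simp add: nat_pow_inv)
  have "m \<noteq> \<one>"
  proof
    assume "m = \<one>"
    then have "0 < k" "g [^] k = \<one>" using km M g by auto
    then show False using tf g by (auto simp: torsion_free_def)
  qed
  then have "m \<in> M" using km by auto
  moreover have "k \<noteq> 0" using m \<open>m \<noteq> \<one>\<close> g by (metis nat_pow_0)
  ultimately show ?thesis using m by auto
qed

text \<open>Zorn's lemma gives a maximal subsemigroup avoiding \<open>\<one>\<close>. If it
  contained neither \<open>x\<close> nor \<open>inv x\<close>, adjoining either would create
  \<open>\<one>\<close>, so it would contain positive powers of both; at a common exponent these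
  multiply to \<open>\<one>\<close>.\<close>

lemma total_cone_extension:
  assumes tf: "torsion_free G" and S: "subsemigroup G S" "\<one> \<notin> S"
  shows "\<exists>P. total_cone G P \<and> S \<subseteq> P"
proof -
  define A where "A = {M. S \<subseteq> M \<and> subsemigroup G M \<and> \<one> \<notin> M}"
  have "\<exists>M\<in>A. \<forall>X\<in>A. M \<subseteq> X \<longrightarrow> X = M"
  proof (rule subset_Zorn_nonempty)
    show "A \<noteq> {}" using S by (auto simp: A_def)
  next
    fix \<C> assume ne: "\<C> \<noteq> {}" and ch: "subset.chain A \<C>"
    have sub: "\<C> \<subseteq> A" and tot: "\<And>X Y. X \<in> \<C> \<Longrightarrow> Y \<in> \<C> \<Longrightarrow> X \<subseteq> Y \<or> Y \<subseteq> X"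
      using ch by (auto simp: subset_chain_def)
    have "x \<otimes> y \<in> \<Union>\<C>" if xy: "x \<in> \<Union>\<C>" "y \<in> \<Union>\<C>" for x y
    proof -
      obtain X Y where "X \<in> \<C>" "x \<in> X" "Y \<in> \<C>" "y \<in> Y" using xy by blast
      then obtain Z where "Z \<in> \<C>" "x \<in> Z" "y \<in> Z" using tot by blast
      then have "x \<otimes> y \<in> Z" using sub by (auto simp: A_def subsemigroup_def)
      then show ?thesis using \<open>Z \<in> \<C>\<close> by blast
    qed
    moreover have "\<Union>\<C> \<subseteq> carrier G" "\<one> \<notin> \<Union>\<C>"
      using sub by (auto simp: A_def subsemigroup_def)
    moreover have "S \<subseteq> \<Union>\<C>" using sub ne unfolding A_def by blast
    ultimately show "\<Union>\<C> \<in> A" by (auto simp: A_def subsemigroup_def)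
  qed
  then obtain M where M: "S \<subseteq> M" "subsemigroup G M" "\<one> \<notin> M"
    and max: "\<And>X. S \<subseteq> X \<Longrightarrow> subsemigroup G X \<Longrightarrow> \<one> \<notin> X \<Longrightarrow> M \<subseteq> X \<Longrightarrow> X = M"
    by (auto simp: A_def)
  have Mc: "M \<subseteq> carrier G" using M by (simp add: subsemigroup_def)
  have key: "\<exists>k>0. inv g [^] (k::nat) \<in> M" if g: "g \<in> carrier G" "g \<noteq> \<one>" "g \<notin> M" for g
  proof (rule one_in_adjoin[OF tf M(2,3) g(1,2)], rule ccontr)
    assume "\<one> \<notin> adjoin G g M"
    then have "adjoin G g M = M"
      using max[of "adjoin G g M"] M subsemigroup_adjoin[OF M(2) g(1)] adjoin_incl[OF Mc g(1)]
      by blast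
    then show False using adjoin_incl[OF Mc g(1)] g by blast
  qed
  have "x \<in> M \<or> inv x \<in> M" if x: "x \<in> carrier G" "x \<noteq> \<one>" for x
  proof (rule ccontr)
    assume "\<not> ?thesis"
    then have n: "x \<notin> M" "inv x \<notin> M" by auto
    have "inv x \<noteq> \<one>" using x by (metis inv_inv inv_one)
    obtain k where k: "0 < k" "inv x [^] (k::nat) \<in> M" using key x n by blast
    obtain l where l: "0 < l" "x [^] (l::nat) \<in> M"
      using key[of "inv x"] x n \<open>inv x \<noteq> \<one>\<close> by auto
    have "(inv x [^] k) [^] l \<in> M" "(x [^] l) [^] k \<in> M"
      using subsemigroup_pow M k l by auto
    then have "inv (x [^] (k * l)) \<in> M" "x [^] (k * l) \<in> M"
      using x by (simp_all add: nat_pow_pow nat_pow_inv mult.commute)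
    then have "x [^] (k * l) \<otimes> inv (x [^] (k * l)) \<in> M" using M by (simp add: subsemigroup_def)
    then show False using x M by simp
  qed
  then have "total_cone G M" using M by (auto simp: total_cone_def subsemigroup_def)
  then show ?thesis using M by blast
qed

text \<open>A positive element without a power in the semigroup of \<open>F\<close> could be made negative.\<close>

lemma power_in_span_if_unique:
  assumes tf: "torsion_free G" and P: "total_cone G P" and F: "F \<subseteq> P"
    and uniq: "\<And>Q. total_cone G Q \<Longrightarrow> F \<subseteq> Q \<Longrightarrow> Q = P" and x: "x \<in> P"
  shows "\<exists>k>0. x [^] (k::nat) \<in> semigroup_span G F"
proof -
  have Pc: "P \<subseteq> carrier G" "\<one> \<notin> P" using P by (auto simp: total_cone_def)
  have xc: "x \<in> carrier G" and x1: "inv x \<noteq> \<one>"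
    using x Pc by (auto simp: inv_eq_1_iff)
  let ?S = "semigroup_span G F"
  have S: "subsemigroup G ?S" using F Pc by (intro subsemigroup_span) auto
  have SP: "?S \<subseteq> P" using semigroup_span_least[OF F total_cone_subsemigroup[OF P]] .
  have "\<one> \<in> adjoin G (inv x) ?S"
  proof (rule ccontr)
    assume "\<one> \<notin> adjoin G (inv x) ?S"
    then obtain Q where Q: "total_cone G Q" "adjoin G (inv x) ?S \<subseteq> Q"
      using total_cone_extension[OF tf subsemigroup_adjoin[OF S]] xc by blast
    have "?S \<subseteq> Q" "inv x \<in> Q"
      using Q adjoin_incl[of ?S "inv x"] S xc by (auto simp: subsemigroup_def)
    moreover from this have "Q = P" using uniq Q semigroup_span.incl by (metis subset_iff)
    ultimately show False using total_cone_inv[OF P x] by simp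
  qed
  then have "\<exists>k>0. inv (inv x) [^] (k::nat) \<in> ?S"
    using one_in_adjoin[OF tf S] SP Pc xc x1 by blast
  then show ?thesis using xc by simp
qed

lemma semigroup_span_insert:
  assumes "insert f B \<subseteq> carrier G" "s \<in> semigroup_span G (insert f B)"
  shows "\<exists>j. \<exists>b\<in>insert \<one> (semigroup_span G B). s = f [^] (j::nat) \<otimes> b"
  using assms(2)
proof (induction rule: semigroup_span.induct)
  case (incl x)
  then show ?case
  proof
    assume "x = f"
    then have "x = f [^] (1::nat) \<otimes> \<one>" using assms by simp
    then show ?thesis by blast
  next
    assume "x \<in> B"
    then have "x = f [^] (0::nat) \<otimes> x" "x \<in> semigroup_span G B"
      using assms by (auto intro: semigroup_span.incl)
    then show ?thesis by blast
  qed
next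
  case (mult x y)
  then obtain i a j b where xy: "x = f [^] (i::nat) \<otimes> a" "y = f [^] (j::nat) \<otimes> b"
    and ab: "a \<in> insert \<one> (semigroup_span G B)" "b \<in> insert \<one> (semigroup_span G B)"
    by blast
  have S: "subsemigroup G (semigroup_span G B)" using assms by (intro subsemigroup_span) auto
  have c: "a \<in> carrier G" "b \<in> carrier G" "f \<in> carrier G"
    using ab S assms by (auto simp: subsemigroup_def)
  have "x \<otimes> y = (f [^] i \<otimes> f [^] j) \<otimes> (a \<otimes> b)" using xy c by (simp add: m_ac)
  also have "\<dots> = f [^] (i + j) \<otimes> (a \<otimes> b)" using c by (simp add: nat_pow_mult)
  finally have "x \<otimes> y = f [^] (i + j) \<otimes> (a \<otimes> b)" .
  moreover have "a \<otimes> b \<in> insert \<one> (semigroup_span G B)"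
    using ab c S by (auto simp: subsemigroup_def)
  ultimately show ?case by blast
qed

lemma semigroup_span_singleton:
  assumes "f \<in> carrier G" "s \<in> semigroup_span G {f}"
  shows "\<exists>j>0. s = f [^] (j::nat)"
  using assms(2)
proof (induction rule: semigroup_span.induct)
  case (incl x)
  then have "x = f [^] (1::nat)" using assms by simp
  then show ?case by blast
next
  case (mult x y)
  then show ?case using assms by (metis add_gr_0 nat_pow_mult)
qed

text \<open>In a minimal generating set of the cone up to roots, two distinct elements \<open>f, g\<close> would be
  extremal rays, but then neither \<open>f g\<^sup>-\<^sup>1\<close> nor its inverse can be positive.\<close>

lemma isolated_total_cone:
  assumes tf: "torsion_free G" and P: "total_cone G P" "P \<noteq> {}" and F: "F \<subseteq> P" "finite F"
    and uniq: "\<And>Q. total_cone G Q \<Longrightarrow> F \<subseteq> Q \<Longrightarrow> Q = P"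
  shows "\<exists>f\<in>F. \<forall>x\<in>P. \<exists>k>0. \<exists>l>0. x [^] (k::nat) = f [^] (l::nat)"
proof -
  have Pc: "P \<subseteq> carrier G" "\<one> \<notin> P" and Pm: "\<And>x y. x \<in> P \<Longrightarrow> y \<in> P \<Longrightarrow> x \<otimes> y \<in> P"
    using P by (auto simp: total_cone_def)
  define gen where
    "gen E \<longleftrightarrow> E \<subseteq> F \<and> (\<forall>x\<in>P. \<exists>k>0. x [^] (k::nat) \<in> semigroup_span G E)" for E
  have "gen F" using power_in_span_if_unique[OF tf P(1) F(1) uniq] by (auto simp: gen_def)
  then obtain E where E: "gen E" and min: "\<And>E'. gen E' \<Longrightarrow> card E \<le> card E'"
    using ex_has_least_nat[of gen F card] by blast
  have EP: "E \<subseteq> P" and EF: "E \<subseteq> F" and Efin: "finite E" and Ec: "E \<subseteq> carrier G"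
    using E F Pc by (auto simp: gen_def intro: finite_subset)
  \<comment> \<open>If the k-th power of \<open>f\<close> came from the other generators, so would
    the k-th power of every element of the span, and \<open>E - {f}\<close> would still generate the
    cone up to roots, against minimality of \<open>E\<close>.\<close>
  have extremal: "f [^] (k::nat) \<notin> semigroup_span G (E - {f})" if f: "f \<in> E" and k: "0 < k" for f k
  proof
    let ?S = "semigroup_span G (E - {f})"
    have S: "subsemigroup G ?S" using Ec by (intro subsemigroup_span) auto
    assume fk: "f [^] k \<in> ?S"
    have "s [^] k \<in> ?S" if "s \<in> semigroup_span G E" for s
      using that
    proof (induction rule: semigroup_span.induct)
      case (incl x)
      show ?case
      proof (cases "x = f")
        case False
        then have "x \<in> ?S" using incl by (auto intro: semigroup_span.incl)
        then show ?thesis using subsemigroup_pow[OF S _ k] by simp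
      qed (use fk in simp)
    next
      case (mult x y)
      then have "x \<in> carrier G" "y \<in> carrier G"
        using subsemigroup_span[OF Ec] by (auto simp: subsemigroup_def)
      then show ?case using mult by (auto simp: nat_pow_distrib intro: semigroup_span.mult)
    qed
    then have "\<exists>l>0. x [^] (l::nat) \<in> ?S" if "x \<in> P" for x
    proof -
      obtain l where l: "0 < l" "x [^] (l::nat) \<in> semigroup_span G E"
        using E \<open>x \<in> P\<close> by (auto simp: gen_def)
      then have "(x [^] l) [^] k \<in> ?S" using \<open>\<And>s. s \<in> semigroup_span G E \<Longrightarrow> s [^] k \<in> ?S\<close> by blast
      then have "x [^] (l * k) \<in> ?S" using that Pc by (auto simp: nat_pow_pow)
      then show ?thesis using l k by (metis nat_0_less_mult_iff)
    qed
    then have "gen (E - {f})" using EF by (auto simp: gen_def)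
    then show False using min[of "E - {f}"] f Efin by (metis card_Diff1_less not_le)
  qed
  \<comment> \<open>A power (f g^-1)^k equals f^j b with b from the other generators, so f^k = f^j
    b' with b' = b g^k. If j < k, cancelling gives a power of f among the others, against
    \<open>extremal\<close>; otherwise it writes \<open>\<one>\<close> as a product of positive
    elements.\<close>
  have False if fg: "f \<in> E" "g \<in> E" "f \<noteq> g" "f \<otimes> inv g \<in> P" for f g
  proof -
    let ?B = "E - {f}"
    have S: "subsemigroup G (semigroup_span G ?B)" using Ec by (intro subsemigroup_span) auto
    have SP: "semigroup_span G ?B \<subseteq> P"
      using semigroup_span_least[OF _ total_cone_subsemigroup[OF P(1)]] EP by blast
    have fc: "f \<in> carrier G" "g \<in> carrier G" using fg Ec by auto
    obtain k where k: "0 < k" "(f \<otimes> inv g) [^] (k::nat) \<in> semigroup_span G (insert f ?B)"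
      using E fg by (auto simp: gen_def insert_absorb)
    obtain j b where jb: "(f \<otimes> inv g) [^] k = f [^] (j::nat) \<otimes> b"
      "b \<in> insert \<one> (semigroup_span G ?B)"
      using semigroup_span_insert[OF _ k(2)] Ec fg by blast
    have bc: "b \<in> carrier G" using jb S by (auto simp: subsemigroup_def)
    have gS: "g [^] k \<in> semigroup_span G ?B"
      using fg k by (intro subsemigroup_pow[OF S]) (auto intro: semigroup_span.incl)
    define b' where "b' = b \<otimes> g [^] k"
    have b'S: "b' \<in> semigroup_span G ?B"
      using jb gS S fc by (auto simp: b'_def subsemigroup_def)
    have b'c: "b' \<in> carrier G" using b'S S by (auto simp: subsemigroup_def)
    have "f [^] k \<otimes> inv (g [^] k) = f [^] j \<otimes> b"
      using jb(1) fc by (simp add: nat_pow_distrib nat_pow_inv)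
    then have "f [^] k \<otimes> inv (g [^] k) \<otimes> g [^] k = f [^] j \<otimes> b \<otimes> g [^] k" by simp
    then have eq: "f [^] k = f [^] j \<otimes> b'" using fc bc by (simp add: m_assoc b'_def)
    show False
    proof (cases "j < k")
      case True
      have "f [^] j \<otimes> f [^] (k - j) = f [^] k" using fc True by (simp add: nat_pow_mult)
      then have "f [^] j \<otimes> f [^] (k - j) = f [^] j \<otimes> b'" using eq by simp
      then have "f [^] (k - j) = b'" using fc b'c by simp
      then show False using extremal[OF fg(1), of "k - j"] b'S True by simp
    next
      case False
      have "f [^] k \<otimes> f [^] (j - k) = f [^] j" using fc False by (simp add: nat_pow_mult)
      then have "f [^] k \<otimes> \<one> = f [^] k \<otimes> (f [^] (j - k) \<otimes> b')" using eq fc b'c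
        by (simp add: m_assoc[symmetric])
      then have one: "\<one> = f [^] (j - k) \<otimes> b'" using fc b'c
        by (subst (asm) left_cancel) auto
      have "f [^] (j - k) \<otimes> b' \<in> P"
      proof (cases "j = k")
        case True
        then show ?thesis using b'S SP b'c by auto
      next
        case False
        then have "f [^] (j - k) \<in> P" using fg EP \<open>\<not> j < k\<close>
          by (intro subsemigroup_pow[OF total_cone_subsemigroup[OF P(1)]]) auto
        then show ?thesis using Pm b'S SP by blast
      qed
      then show False using one Pc by simp
    qed
  qed note no_pair = this
  have single: "f = g" if fg: "f \<in> E" "g \<in> E" for f g
  proof (rule ccontr)
    assume ne: "f \<noteq> g"
    have fc: "f \<in> carrier G" "g \<in> carrier G" using fg Ec by auto
    have "f \<otimes> inv g \<noteq> \<one>" using ne fc by (metis inv_equality inv_inv inv_closed)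
    then have "f \<otimes> inv g \<in> P \<or> inv (f \<otimes> inv g) \<in> P"
      using P(1) fc by (simp add: total_cone_def)
    then have "f \<otimes> inv g \<in> P \<or> g \<otimes> inv f \<in> P" using fc by (simp add: inv_mult_group)
    then show False using no_pair fg ne by metis
  qed
  obtain p where "p \<in> P" using P by blast
  then obtain k where "p [^] (k::nat) \<in> semigroup_span G E" using E by (auto simp: gen_def)
  then have "E \<noteq> {}"
    by (induction rule: semigroup_span.induct) auto
  then obtain f where f: "f \<in> E" by blast
  then have Ef: "E = {f}" using single by blast
  have "\<exists>k>0. \<exists>l>0. x [^] (k::nat) = f [^] (l::nat)" if "x \<in> P" for x
  proof -
    have "\<exists>k>0. x [^] (k::nat) \<in> semigroup_span G E" using E that by (simp add: gen_def)
    then obtain k where "0 < k" "x [^] (k::nat) \<in> semigroup_span G {f}" unfolding Ef by blast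
    then show ?thesis using semigroup_span_singleton[of f] f Ec by blast
  qed
  then show ?thesis using f EF by blast
qed

end

section \<open>Archimedean ordered groups are abelian\<close>

text \<open>The order is invariant from the left only, and the second axiom reads x < y^n.
  Invariance from the right is a consequence, see \<open>conj_pos\<close>.\<close>

locale archimedean_group = group G for G (structure) +
  fixes P
  assumes total_cone: "total_cone G P"
    and archimedean: "x \<in> P \<Longrightarrow> y \<in> P \<Longrightarrow> \<exists>n::nat. inv x \<otimes> y [^] n \<in> P"
begin

lemma closed [simp]: "x \<in> P \<Longrightarrow> x \<in> carrier G"
  using total_cone by (auto simp: total_cone_def)

lemma mult: "x \<in> P \<Longrightarrow> y \<in> P \<Longrightarrow> x \<otimes> y \<in> P"
  using total_cone by (auto simp: total_cone_def)

lemma not_one [simp]: "\<one> \<notin> P"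
  using total_cone by (auto simp: total_cone_def)

lemma total: "x \<in> carrier G \<Longrightarrow> x = \<one> \<or> x \<in> P \<or> inv x \<in> P"
  using total_cone by (auto simp: total_cone_def)

text \<open>For positive g choose n with g < x^n. Then (g^-1 x g)^n is the product of the positive
  elements g^-1 x^n and g, so g^-1 x g cannot be negative or trivial. For negative g, conjugating a
  negative result back by the positive inverse of g would make x^-1 positive.\<close>

lemma conj_pos:
  assumes "x \<in> P" "g \<in> carrier G"
  shows "inv g \<otimes> (x \<otimes> g) \<in> P"
proof -
  have pos: "inv g \<otimes> (x \<otimes> g) \<in> P" if x: "x \<in> P" and g: "g \<in> P" for x g
  proof (rule ccontr)
    define z where "z = inv g \<otimes> (x \<otimes> g)"
    assume "inv g \<otimes> (x \<otimes> g) \<notin> P"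
    then have "z \<notin> P" by (simp add: z_def)
    have zc: "z \<in> carrier G" using x g by (simp add: z_def)
    have zn: "inv g \<otimes> (x [^] n \<otimes> g) = z [^] n" for n :: nat
    proof (induction n)
      case (Suc n)
      have "z [^] Suc n = (inv g \<otimes> (x [^] n \<otimes> g)) \<otimes> z" by (simp add: Suc)
      then show ?case using x g by (simp add: z_def m_assoc)
    qed (use g in simp)
    obtain n where "inv g \<otimes> x [^] (n::nat) \<in> P" using archimedean[OF g x] by blast
    then have "inv g \<otimes> x [^] n \<otimes> g \<in> P" using g mult by blast
    then have "z [^] n \<in> P" using zn[of n] x g by (simp add: m_assoc)
    have "z \<noteq> \<one>" using \<open>z [^] n \<in> P\<close> by auto
    then have "inv z \<in> P" using total[OF zc] \<open>z \<notin> P\<close> by blast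
    moreover have "n \<noteq> 0" using \<open>z [^] n \<in> P\<close> by (metis nat_pow_0 not_one)
    ultimately have "inv z [^] n \<in> P"
      using subsemigroup_pow[OF total_cone_subsemigroup[OF total_cone]] by simp
    then have "inv (z [^] n) \<in> P" using zc by (simp add: nat_pow_inv)
    then show False using total_cone_inv[OF total_cone \<open>z [^] n \<in> P\<close>] by simp
  qed
  consider "g = \<one>" | "g \<in> P" | "inv g \<in> P" using total assms by blast
  then show ?thesis
  proof cases
    case 3
    define z where "z = inv g \<otimes> (x \<otimes> g)"
    have zc: "z \<in> carrier G" using assms by (simp add: z_def)
    have x: "x = g \<otimes> (z \<otimes> inv g)" using assms by (simp add: z_def m_assoc)
    have "z \<in> P"
    proof (rule ccontr)
      assume "z \<notin> P"
      moreover have "z \<noteq> \<one>" using assms x by auto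
      ultimately have "inv z \<in> P" using total zc by blast
      then have "g \<otimes> (inv z \<otimes> inv g) \<in> P" using pos[OF _ 3] assms by simp
      then have "x \<otimes> (g \<otimes> (inv z \<otimes> inv g)) \<in> P" using assms mult by blast
      then show False using x zc assms by (simp add: m_assoc)
    qed
    then show ?thesis by (simp add: z_def)
  qed (use assms pos in auto)
qed

abbreviation lt where "lt x y \<equiv> inv x \<otimes> y \<in> P"

lemma lt_trans:
  assumes "lt x y" "lt y z" and [simp]: "x \<in> carrier G" "y \<in> carrier G" "z \<in> carrier G"
  shows "lt x z"
  using mult[OF assms(1,2)] by (simp add: m_assoc)

lemma lt_asym:
  assumes "lt x y" and [simp]: "x \<in> carrier G" "y \<in> carrier G"
  shows "\<not> lt y x"
  using lt_trans[OF assms(1), of x] by auto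

lemma lt_total: "x \<in> carrier G \<Longrightarrow> y \<in> carrier G \<Longrightarrow> lt x y \<or> x = y \<or> lt y x"
  using total[of "inv x \<otimes> y"] by (auto simp: inv_mult_group) (metis inv_equality inv_inv inv_closed)

lemma lt_left: "\<lbrakk>a \<in> carrier G; x \<in> carrier G; y \<in> carrier G\<rbrakk> \<Longrightarrow> lt (a \<otimes> x) (a \<otimes> y) \<longleftrightarrow> lt x y"
  by (simp add: inv_mult_group m_assoc)

lemma lt_right:
  assumes "lt x y" and [simp]: "a \<in> carrier G" "x \<in> carrier G" "y \<in> carrier G"
  shows "lt (x \<otimes> a) (y \<otimes> a)"
  using conj_pos[OF assms(1), of a] by (simp add: inv_mult_group m_assoc)

lemma between_powers:
  assumes a: "a \<in> P" and d: "d \<in> P"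
  shows "\<exists>m::nat. \<not> lt a (d [^] m) \<and> lt a (d [^] Suc m)"
proof -
  define n where "n = (LEAST n::nat. lt a (d [^] n))"
  have n: "lt a (d [^] n)" unfolding n_def using archimedean[OF a d] by (rule LeastI_ex)
  have "n \<noteq> 0"
  proof
    assume "n = 0"
    then have "inv a \<in> P" using n a by simp
    then show False using total_cone_inv[OF total_cone a] by simp
  qed
  then obtain m where m: "n = Suc m" using not0_implies_Suc by blast
  then have "\<not> lt a (d [^] m)" using not_less_Least[of m "\<lambda>n. lt a (d [^] n)"] by (simp add: n_def)
  then show ?thesis using n m by blast
qed

text \<open>If the commutator \<open>c\<close> of \<open>a\<close> and \<open>b\<close> is positive, then a positive \<open>d\<close> with \<open>d\<^sup>2 \<le> c\<close> cannot
  exist, since \<open>a b\<close> and \<open>b a\<close> lie between the same powers of \<open>d\<close> up to a factor less than \<open>d\<^sup>2\<close>.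
  But then \<open>c\<close> is the least positive element, and the group is cyclic.\<close>

lemma commutator_not_pos:
  assumes [simp]: "a \<in> P" "b \<in> P"
  shows "(a \<otimes> b) \<otimes> inv (b \<otimes> a) \<notin> P"
proof
  define c where "c = (a \<otimes> b) \<otimes> inv (b \<otimes> a)"
  assume "(a \<otimes> b) \<otimes> inv (b \<otimes> a) \<in> P"
  then have c [simp]: "c \<in> P" by (simp add: c_def)
  have cba: "c \<otimes> (b \<otimes> a) = a \<otimes> b" by (simp add: c_def m_assoc)
  show False
  proof (cases "\<exists>d\<in>P. \<not> lt c (d \<otimes> d)")
    case True
    then obtain d where d [simp]: "d \<in> P" and dc: "\<not> lt c (d \<otimes> d)" by blast
    obtain m where m: "\<not> lt a (d [^] (m::nat))" "lt a (d [^] Suc m)" using between_powers[of a d] by auto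
    obtain n where n: "\<not> lt b (d [^] (n::nat))" "lt b (d [^] Suc n)" using between_powers[of b d] by auto
    have pow: "d [^] i \<otimes> d [^] j = d [^] (i + j)" for i j :: nat by (simp add: nat_pow_mult)
    \<comment> \<open>From the upper bounds, c b a = a b < d^(m+n+2) = d^2 d^(m+n), which is at most
      c d^(m+n). Cancelling c on the left gives b a < d^(m+n), whereas the lower bounds give d^(n+m)
      at most b a.\<close>
    have "lt (a \<otimes> b) (d [^] Suc m \<otimes> b)" using m lt_right by simp
    moreover have "lt (d [^] Suc m \<otimes> b) (d [^] Suc m \<otimes> d [^] Suc n)"
      using n by (simp add: lt_left del: nat_pow_Suc)
    ultimately have "lt (a \<otimes> b) (d [^] Suc m \<otimes> d [^] Suc n)"
      by (rule lt_trans) (simp_all del: nat_pow_Suc)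
    moreover have "d [^] Suc m \<otimes> d [^] Suc n = d [^] Suc (Suc (m + n))"
      unfolding pow by (rule arg_cong) simp
    then have "d [^] Suc m \<otimes> d [^] Suc n = d \<otimes> d \<otimes> d [^] (m + n)"
      by (simp only: nat_pow_Suc2[OF closed[OF d]] m_assoc closed[OF d] nat_pow_closed)
    ultimately have 1: "lt (c \<otimes> (b \<otimes> a)) (d \<otimes> d \<otimes> d [^] (m + n))" using cba by simp
    have "\<not> lt (c \<otimes> d [^] (m + n)) (d \<otimes> d \<otimes> d [^] (m + n))"
    proof (cases "c = d \<otimes> d")
      case False
      then have "lt (d \<otimes> d) c" using dc lt_total[of c "d \<otimes> d"] by auto
      then have "lt (d \<otimes> d \<otimes> d [^] (m + n)) (c \<otimes> d [^] (m + n))" using lt_right by simp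
      then show ?thesis using lt_asym by simp
    qed simp
    then have "d \<otimes> d \<otimes> d [^] (m + n) = c \<otimes> d [^] (m + n) \<or>
        lt (d \<otimes> d \<otimes> d [^] (m + n)) (c \<otimes> d [^] (m + n))"
      using lt_total[of "c \<otimes> d [^] (m + n)" "d \<otimes> d \<otimes> d [^] (m + n)"] by auto
    then have "lt (c \<otimes> (b \<otimes> a)) (c \<otimes> d [^] (m + n))"
      using 1 lt_trans[OF 1, of "c \<otimes> d [^] (m + n)"] by auto
    then have 2: "lt (b \<otimes> a) (d [^] (m + n))" by (subst (asm) lt_left) auto
    have e: "d [^] (m + n) = d [^] n \<otimes> d [^] m" by (simp add: pow add.commute)
    have a: "d [^] m = a \<or> lt (d [^] m) a" and b: "d [^] n = b \<or> lt (d [^] n) b"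
      using m n lt_total[of a "d [^] m"] lt_total[of b "d [^] n"] by auto
    have 3: "d [^] n \<otimes> d [^] m = b \<otimes> d [^] m \<or> lt (d [^] n \<otimes> d [^] m) (b \<otimes> d [^] m)"
      using b lt_right[of "d [^] n" b "d [^] m"] by auto
    have 4: "b \<otimes> d [^] m = b \<otimes> a \<or> lt (b \<otimes> d [^] m) (b \<otimes> a)"
      using a by (auto simp: lt_left)
    have "d [^] (m + n) = b \<otimes> a \<or> lt (d [^] (m + n)) (b \<otimes> a)"
      using 3 4 e lt_trans[of "d [^] n \<otimes> d [^] m" "b \<otimes> d [^] m" "b \<otimes> a"] by auto
    then show False using 2 lt_asym[of "b \<otimes> a" "d [^] (m + n)"] by auto
  next
    case False
    then have big: "lt c (d \<otimes> d)" if "d \<in> P" for d using that by blast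
    \<comment> \<open>If 1 < e < c, write c = e d. By \<open>big\<close>, e d < e e, hence d < e and
      d d < e d = c, which contradicts \<open>big\<close> for d. With c least, the remainder of p
      after division by powers of c must vanish.\<close>
    have least: "\<not> lt e c" if [simp]: "e \<in> P" for e
    proof
      define d where "d = inv e \<otimes> c"
      assume "lt e c"
      then have [simp]: "d \<in> P" by (simp add: d_def)
      have ed: "e \<otimes> d = c" by (simp add: d_def)
      have "lt (e \<otimes> d) (e \<otimes> e)" using big[of e] ed by simp
      then have "lt d e" by (simp add: lt_left)
      then have "lt (d \<otimes> d) (e \<otimes> d)" using lt_right by simp
      then show False using big[of d] ed lt_asym[of "d \<otimes> d" c] by simp
    qed
    have "\<exists>m::nat. p = c [^] m" if [simp]: "p \<in> P" for p
    proof -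
      obtain m where m: "\<not> lt p (c [^] (m::nat))" "lt p (c [^] Suc m)" using between_powers[of p c] by auto
      have "\<not> lt (c [^] m) p"
      proof
        assume pos: "lt (c [^] m) p"
        have "lt (c [^] m \<otimes> (inv (c [^] m) \<otimes> p)) (c [^] m \<otimes> c)" using m by simp
        then have "lt (inv (c [^] m) \<otimes> p) c" by (subst (asm) lt_left) auto
        then show False using least[OF pos] by simp
      qed
      then show ?thesis using m lt_total[of p "c [^] m"] by auto
    qed
    then obtain m n where "a = c [^] (m::nat)" "b = c [^] (n::nat)" by (metis assms)
    then have "a \<otimes> b = b \<otimes> a" by (simp add: nat_pow_mult add.commute)
    then have "c = \<one>" by (simp add: c_def)
    then show False using c by simp
  qed
qed

lemma commute:
  assumes "a \<in> carrier G" "b \<in> carrier G"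
  shows "a \<otimes> b = b \<otimes> a"
proof -
  have pp: "a \<otimes> b = b \<otimes> a" if [simp]: "a \<in> P" "b \<in> P" for a b
  proof -
    have "(a \<otimes> b) \<otimes> inv (b \<otimes> a) \<notin> P" "inv ((a \<otimes> b) \<otimes> inv (b \<otimes> a)) \<notin> P"
      using commutator_not_pos[of a b] commutator_not_pos[of b a]
      by (auto simp: inv_mult_group m_assoc)
    then have "(a \<otimes> b) \<otimes> inv (b \<otimes> a) = \<one>" using total[of "(a \<otimes> b) \<otimes> inv (b \<otimes> a)"] by simp
    then show ?thesis by (metis inv_equality inv_inv inv_closed m_closed closed that)
  qed
  have inv_comm: "inv x \<otimes> y = y \<otimes> inv x"
    if "x \<otimes> y = y \<otimes> x" and [simp]: "x \<in> carrier G" "y \<in> carrier G" for x y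
  proof -
    have "inv x \<otimes> (x \<otimes> y) \<otimes> inv x = inv x \<otimes> (y \<otimes> x) \<otimes> inv x" using that by simp
    then show ?thesis by (simp add: m_assoc)
  qed
  have "\<exists>a'. (a' = \<one> \<or> a' \<in> P) \<and> (a = a' \<or> a = inv a')" if "a \<in> carrier G" for a
    using total[OF that] that by (metis inv_inv)
  then obtain a' b' where ab: "a' = \<one> \<or> a' \<in> P" "a = a' \<or> a = inv a'" "b' = \<one> \<or> b' \<in> P"
      "b = b' \<or> b = inv b'"
    using assms by metis
  have [simp]: "a' \<in> carrier G" "b' \<in> carrier G" using ab by auto
  have 1: "a' \<otimes> b' = b' \<otimes> a'" using ab pp by auto
  have 2: "a \<otimes> b' = b' \<otimes> a" using ab(2) 1 inv_comm[OF 1] by auto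
  show ?thesis using ab(4) 2 inv_comm[OF 2[symmetric]] assms by auto
qed

end

section \<open>Quotients of subgroups\<close>

text \<open>The element in question is the commutator of x and y. For subgroups this one condition
  also contains the normality of \<open>H\<close> in \<open>K\<close>
  (\<open>normal_if_abelian_over\<close>), and it is stable under intersecting commutator bounds,
  which quotient groups would obscure.\<close>

definition abelian_over :: "('a, 'b) monoid_scheme \<Rightarrow> 'a set \<Rightarrow> 'a set \<Rightarrow> bool" where
  "abelian_over G H K \<longleftrightarrow>
     H \<subseteq> K \<and> (\<forall>x\<in>K. \<forall>y\<in>K. inv\<^bsub>G\<^esub> x \<otimes>\<^bsub>G\<^esub> (inv\<^bsub>G\<^esub> y \<otimes>\<^bsub>G\<^esub> (x \<otimes>\<^bsub>G\<^esub> y)) \<in> H)"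

context group
begin

context
  fixes H K
  assumes K: "subgroup K G" and N: "H \<lhd> G\<lparr>carrier := K\<rparr>"
begin

interpretation KG: group "G\<lparr>carrier := K\<rparr>" by (rule subgroup.subgroup_is_group[OF K is_group])
interpretation N: normal H "G\<lparr>carrier := K\<rparr>" by (rule N)

lemma group_subquotient: "group (subquotient G K H)"
  unfolding subquotient_def by (rule N.factorgroup_is_group)

lemma carrier_subquotient: "carrier (subquotient G K H) = (\<lambda>x. H #> x) ` K"
  by (simp add: subquotient_def carrier_FactGroup r_coset_def)

lemma one_subquotient: "\<one>\<^bsub>subquotient G K H\<^esub> = H"
  by (simp add: subquotient_def)

lemma mult_subquotient:
  "x \<in> K \<Longrightarrow> y \<in> K \<Longrightarrow> (H #> x) \<otimes>\<^bsub>subquotient G K H\<^esub> (H #> y) = H #> (x \<otimes> y)"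
  using N.rcos_sum[of x y] by (simp add: subquotient_def r_coset_def)

lemma inv_subquotient: "x \<in> K \<Longrightarrow> inv\<^bsub>subquotient G K H\<^esub> (H #> x) = H #> inv x"
proof -
  assume x: "x \<in> K"
  interpret Q: group "subquotient G K H" by (rule group_subquotient)
  have xc: "x \<in> carrier G" "inv x \<in> K" using x K by (auto intro: subgroup.mem_carrier subgroup.m_inv_closed)
  have "(H #> inv x) \<otimes>\<^bsub>subquotient G K H\<^esub> (H #> x) = H #> \<one>"
    using mult_subquotient[of "inv x" x] x xc by simp
  also have "\<dots> = \<one>\<^bsub>subquotient G K H\<^esub>"
    using N.subset subgroup.mem_carrier[OF K] by (simp add: one_subquotient coset_mult_one subset_iff)
  finally show ?thesis
    using x xc by (intro Q.inv_equality) (auto simp: carrier_subquotient)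
qed

lemma pow_subquotient:
  "x \<in> K \<Longrightarrow> (H #> x) [^]\<^bsub>subquotient G K H\<^esub> (n::nat) = H #> (x [^] n)"
  using N.FactGroup_pow[of x n] nat_pow_consistent[of x n K]
  by (simp add: subquotient_def r_coset_def)

lemma coset_eq_subquotient:
  assumes "x \<in> K" "y \<in> K"
  shows "H #> x = H #> y \<longleftrightarrow> x \<otimes> inv y \<in> H"
proof -
  have HK: "H \<subseteq> K" using N.subset by simp
  have Hs: "subgroup H G" using N.is_subgroup K incl_subgroup by blast
  have c: "x \<in> carrier G" "y \<in> carrier G" using assms K by (auto intro: subgroup.mem_carrier)
  show ?thesis
  proof
    assume "H #> x = H #> y"
    then have "x \<in> H #> y" using rcos_self[OF c(1) Hs] by simp
    then obtain h where "h \<in> H" "x = h \<otimes> y" by (auto simp: r_coset_def)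
    then show "x \<otimes> inv y \<in> H" using c Hs by (simp add: m_assoc subgroup.mem_carrier)
  next
    assume h: "x \<otimes> inv y \<in> H"
    then have "x = (x \<otimes> inv y) \<otimes> y" using c by (simp add: m_assoc)
    then have "x \<in> H #> y" using h by (auto simp: r_coset_def)
    then show "H #> x = H #> y" using repr_independence[OF _ c(2) Hs] by simp
  qed
qed

lemma coset_eq_one_subquotient: "x \<in> K \<Longrightarrow> H #> x = \<one>\<^bsub>subquotient G K H\<^esub> \<longleftrightarrow> x \<in> H"
proof -
  assume x: "x \<in> K"
  then have c: "x \<in> carrier G" using K by (auto intro: subgroup.mem_carrier)
  have "H #> \<one> = \<one>\<^bsub>subquotient G K H\<^esub>"
    using N.subset subgroup.mem_carrier[OF K] by (simp add: one_subquotient coset_mult_one subset_iff)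
  then show ?thesis
    using coset_eq_subquotient[OF x, of \<one>] c subgroup.one_closed[OF K] by simp
qed

end

text \<open>The conjugate x h x^-1 is the commutator x h x^-1 h^-1 times h.\<close>

lemma normal_if_abelian_over:
  assumes H: "subgroup H G" and K: "subgroup K G" and ab: "abelian_over G H K"
  shows "H \<lhd> G\<lparr>carrier := K\<rparr>"
proof -
  interpret KG: group "G\<lparr>carrier := K\<rparr>" by (rule subgroup.subgroup_is_group[OF K is_group])
  have HK: "H \<subseteq> K" using ab by (simp add: abelian_over_def)
  have "x \<otimes> h \<otimes> inv x \<in> H" if x: "x \<in> K" and h: "h \<in> H" for x h
  proof -
    have c: "x \<in> carrier G" "h \<in> carrier G" "inv x \<in> K" "inv h \<in> K" "h \<in> K"
      using x h H K HK by (auto intro: subgroup.mem_carrier subgroup.m_inv_closed)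
    have "inv (inv x) \<otimes> (inv (inv h) \<otimes> (inv x \<otimes> inv h)) \<in> H"
      using ab c unfolding abelian_over_def by blast
    then have "(x \<otimes> (h \<otimes> (inv x \<otimes> inv h))) \<otimes> h \<in> H"
      using c h H by (simp add: subgroup.m_closed)
    then show ?thesis using c by (simp add: m_assoc)
  qed
  moreover have "inv\<^bsub>G\<lparr>carrier := K\<rparr>\<^esub> x = inv x" if "x \<in> K" for x
    using m_inv_consistent[OF K that] .
  ultimately show ?thesis
    unfolding KG.normal_inv_iff using subgroup_incl[OF H K HK] by simp
qed

lemma abelian_over_iff:
  assumes H: "subgroup H G" and K: "subgroup K G"
  shows "abelian_over G H K \<longleftrightarrow> H \<lhd> G\<lparr>carrier := K\<rparr> \<and> comm_group (subquotient G K H)"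
proof -
  \<comment> \<open>The criterion is that (x y)(y x)^-1 lies in \<open>H\<close>. The double
    inverses present this element as the commutator from \<open>abelian_over\<close> at
    \<open>inv x\<close> and \<open>inv y\<close>.\<close>
  have eq: "(H #> x) \<otimes>\<^bsub>subquotient G K H\<^esub> (H #> y) = (H #> y) \<otimes>\<^bsub>subquotient G K H\<^esub> (H #> x) \<longleftrightarrow>
      inv (inv x) \<otimes> (inv (inv y) \<otimes> (inv x \<otimes> inv y)) \<in> H"
    if N: "H \<lhd> G\<lparr>carrier := K\<rparr>" and x: "x \<in> K" and y: "y \<in> K" for x y
  proof -
    have c: "x \<in> carrier G" "y \<in> carrier G" "x \<otimes> y \<in> K" "y \<otimes> x \<in> K"
      using x y K by (auto intro: subgroup.mem_carrier subgroup.m_closed)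
    show ?thesis
      using coset_eq_subquotient[OF K N c(3,4)] c mult_subquotient[OF K N] x y
      by (simp add: inv_mult_group m_assoc)
  qed
  show ?thesis
  proof
    assume ab: "abelian_over G H K"
    have N: "H \<lhd> G\<lparr>carrier := K\<rparr>" using normal_if_abelian_over[OF H K ab] .
    interpret Q: group "subquotient G K H" by (rule group_subquotient[OF K N])
    have "inv (inv x) \<otimes> (inv (inv y) \<otimes> (inv x \<otimes> inv y)) \<in> H" if "x \<in> K" "y \<in> K" for x y
      using ab that K unfolding abelian_over_def by (blast intro: subgroup.m_inv_closed)
    then have "comm_group (subquotient G K H)"
      using eq[OF N] by (intro Q.group_comm_groupI) (auto simp: carrier_subquotient[OF K N])
    then show "H \<lhd> G\<lparr>carrier := K\<rparr> \<and> comm_group (subquotient G K H)" using N by blast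
  next
    assume a: "H \<lhd> G\<lparr>carrier := K\<rparr> \<and> comm_group (subquotient G K H)"
    then have N: "H \<lhd> G\<lparr>carrier := K\<rparr>" by blast
    interpret Q: comm_group "subquotient G K H" using a by blast
    have HK: "H \<subseteq> K" using normal_imp_subgroup[OF N] subgroup.subset by fastforce
    have "inv x \<otimes> (inv y \<otimes> (x \<otimes> y)) \<in> H" if "x \<in> K" "y \<in> K" for x y
    proof -
      have i: "inv x \<in> K" "inv y \<in> K" and c: "x \<in> carrier G" "y \<in> carrier G"
        using that K by (auto intro: subgroup.m_inv_closed subgroup.mem_carrier)
      have "(H #> inv x) \<otimes>\<^bsub>subquotient G K H\<^esub> (H #> inv y) =
          (H #> inv y) \<otimes>\<^bsub>subquotient G K H\<^esub> (H #> inv x)"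
        using i by (intro Q.m_comm) (auto simp: carrier_subquotient[OF K N])
      then show ?thesis using eq[OF N i] c by simp
    qed
    then show "abelian_over G H K" using HK by (simp add: abelian_over_def)
  qed
qed

end

section \<open>Conradian cones\<close>

text \<open>The positive cone of a Conradian left-preorder on the subgroup \<open>K\<close>, axiomatised so that the
  trivial preorder, with empty cone, is allowed. Here \<open>x \<otimes> y \<in> P \<Longrightarrow> x \<in> P \<or> y \<in> P\<close> says that the
  complement of \<open>P\<close> is closed under multiplication.\<close>

definition conrad_cone :: "('a, 'b) monoid_scheme \<Rightarrow> 'a set \<Rightarrow> 'a set \<Rightarrow> bool" where
  "conrad_cone G K P \<longleftrightarrow>
     P \<subseteq> K \<and> (\<forall>x\<in>P. inv\<^bsub>G\<^esub> x \<notin> P) \<and>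
     (\<forall>x\<in>K. \<forall>y\<in>K. x \<otimes>\<^bsub>G\<^esub> y \<in> P \<longrightarrow> x \<in> P \<or> y \<in> P) \<and>
     (\<forall>x\<in>P. \<forall>y\<in>P. \<exists>n::nat. inv\<^bsub>G\<^esub> x \<otimes>\<^bsub>G\<^esub> (y \<otimes>\<^bsub>G\<^esub> x [^]\<^bsub>G\<^esub> n) \<in> P)"

definition cone_residue :: "('a, 'b) monoid_scheme \<Rightarrow> 'a set \<Rightarrow> 'a set \<Rightarrow> 'a set" where
  "cone_residue G K P = {x \<in> K. x \<notin> P \<and> inv\<^bsub>G\<^esub> x \<notin> P}"

text \<open>Order convexity in terms of the cone: replacing l by its inverse, the last condition
  says that every element of \<open>L\<close> lies below every positive element outside
  \<open>L\<close>. The residue is required to lie in \<open>L\<close> so that \<open>L\<close> can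
  become the residue of a coarser preorder (\<open>cone_coarsen\<close>).\<close>

definition cone_convex :: "('a, 'b) monoid_scheme \<Rightarrow> 'a set \<Rightarrow> 'a set \<Rightarrow> 'a set \<Rightarrow> bool" where
  "cone_convex G K P L \<longleftrightarrow>
     subgroup L G \<and> L \<subseteq> K \<and> cone_residue G K P \<subseteq> L \<and> (\<forall>l\<in>L. \<forall>x\<in>P - L. l \<otimes>\<^bsub>G\<^esub> x \<in> P)"

locale cone = group G for G (structure) +
  fixes K P
  assumes K: "subgroup K G" and conrad_cone: "conrad_cone G K P"
begin

lemma closed [simp]:
  "x \<in> K \<Longrightarrow> x \<in> carrier G" "x \<in> K \<Longrightarrow> y \<in> K \<Longrightarrow> x \<otimes> y \<in> K" "x \<in> K \<Longrightarrow> inv x \<in> K" "\<one> \<in> K"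
  by (simp_all add: subgroup.mem_carrier[OF K] subgroup.m_closed[OF K]
      subgroup.m_inv_closed[OF K] subgroup.one_closed[OF K])

lemma pow_closed [simp]: "x \<in> K \<Longrightarrow> x [^] (n::nat) \<in> K"
  by (induction n) auto

lemma pos_closed [simp]: "x \<in> P \<Longrightarrow> x \<in> K"
  using conrad_cone by (auto simp: conrad_cone_def)

lemma pos_inv: "x \<in> P \<Longrightarrow> inv x \<notin> P"
  using conrad_cone by (auto simp: conrad_cone_def)

lemma pos_split: "x \<otimes> y \<in> P \<Longrightarrow> x \<in> K \<Longrightarrow> y \<in> K \<Longrightarrow> x \<in> P \<or> y \<in> P"
  using conrad_cone by (auto simp: conrad_cone_def)

lemma conrad: "x \<in> P \<Longrightarrow> y \<in> P \<Longrightarrow> \<exists>n::nat. inv x \<otimes> (y \<otimes> x [^] n) \<in> P"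
  using conrad_cone by (auto simp: conrad_cone_def)

lemma one_not_pos [simp]: "\<one> \<notin> P"
  using pos_inv[of \<one>] by auto

text \<open>Since y = x^-1 (x y), the splitting rule makes x^-1 or x y positive, and x^-1 is
  not.\<close>

lemma pos_mult: assumes "x \<in> P" "y \<in> P" shows "x \<otimes> y \<in> P"
proof (rule ccontr)
  assume n: "x \<otimes> y \<notin> P"
  have "inv x \<otimes> (x \<otimes> y) \<in> P" using assms by simp
  then show False using n pos_split[of "inv x" "x \<otimes> y"] pos_inv[OF assms(1)] assms by auto
qed

lemma pos_pow: "x \<in> P \<Longrightarrow> 0 < n \<Longrightarrow> x [^] (n::nat) \<in> P"
  by (rule subsemigroup_pow[of P]) (auto simp: subsemigroup_def pos_mult)

abbreviation R where "R \<equiv> cone_residue G K P"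

lemma in_residue: "x \<in> R \<longleftrightarrow> x \<in> K \<and> x \<notin> P \<and> inv x \<notin> P"
  by (auto simp: cone_residue_def)

lemma subgroup_residue: "subgroup R G"
proof (rule subgroupI)
  show "R \<noteq> {}" using in_residue[of \<one>] by auto
  show "x \<otimes> y \<in> R" if "x \<in> R" "y \<in> R" for x y
    using that pos_split[of x y] pos_split[of "inv y" "inv x"]
    by (auto simp: in_residue inv_mult_group)
qed (auto simp: in_residue)

lemma residue_mult_pos:
  assumes "l \<in> R" "x \<in> P"
  shows "l \<otimes> x \<in> P" "x \<otimes> l \<in> P"
proof -
  have l: "l \<in> K" "l \<notin> P" "inv l \<notin> P" using assms by (auto simp: in_residue)
  have "inv l \<otimes> (l \<otimes> x) \<in> P" "(x \<otimes> l) \<otimes> inv l \<in> P" using assms l by (auto simp: m_assoc)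
  then show "l \<otimes> x \<in> P" "x \<otimes> l \<in> P"
    using pos_split[of "inv l" "l \<otimes> x"] pos_split[of "x \<otimes> l" "inv l"] l assms by auto
qed

lemma convex_residue: "cone_convex G K P R"
  using subgroup_residue residue_mult_pos by (auto simp: cone_convex_def in_residue)

lemma cone_restrict:
  assumes "L \<subseteq> K" "subgroup L G"
  shows "conrad_cone G L (P \<inter> L)" "cone_residue G L (P \<inter> L) = R \<inter> L"
proof -
  note L = subgroup.m_closed[OF assms(2)] subgroup.m_inv_closed[OF assms(2)]
  have Lp: "x [^] (n::nat) \<in> L" if "x \<in> L" for x n
    using that by (induction n) (auto simp: subgroup.one_closed[OF assms(2)] L)
  have "\<exists>n::nat. inv x \<otimes> (y \<otimes> x [^] n) \<in> P \<inter> L" if xy: "x \<in> P \<inter> L" "y \<in> P \<inter> L" for x y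
  proof -
    obtain n where "inv x \<otimes> (y \<otimes> x [^] (n::nat)) \<in> P" using conrad[of x y] xy by auto
    moreover have "inv x \<otimes> (y \<otimes> x [^] n) \<in> L" using that by (simp add: L Lp)
    ultimately show ?thesis by blast
  qed
  moreover have "x \<in> P \<inter> L \<or> y \<in> P \<inter> L" if "x \<in> L" "y \<in> L" "x \<otimes> y \<in> P \<inter> L" for x y
    using that assms(1) pos_split[of x y] by blast
  ultimately show "conrad_cone G L (P \<inter> L)"
    unfolding conrad_cone_def using pos_inv by blast
  show "cone_residue G L (P \<inter> L) = R \<inter> L"
    using assms(1) L by (auto simp: cone_residue_def)
qed

end

section \<open>Convex subgroups of a Conradian cone\<close>

locale convex_cone = cone +
  fixes L
  assumes L: "cone_convex G K P L"
begin

lemma convex_subgroup: "subgroup L G"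
  using L by (simp add: cone_convex_def)

lemma convex_closed [simp]:
  "x \<in> L \<Longrightarrow> x \<in> K" "x \<in> L \<Longrightarrow> y \<in> L \<Longrightarrow> x \<otimes> y \<in> L" "x \<in> L \<Longrightarrow> inv x \<in> L" "\<one> \<in> L"
  using L subgroup.m_closed[OF convex_subgroup] subgroup.m_inv_closed[OF convex_subgroup]
    subgroup.one_closed[OF convex_subgroup]
  by (auto simp: cone_convex_def)

lemma convex_pow_closed [simp]: "x \<in> L \<Longrightarrow> x [^] (n::nat) \<in> L"
  by (induction n) auto

lemma convex_cases: "x \<in> K \<Longrightarrow> x \<in> L \<or> x \<in> P - L \<or> inv x \<in> P - L"
  using L convex_closed(3)[of "inv x"] by (auto simp: cone_convex_def in_residue)

text \<open>Only left multiplication is part of convexity. On the right, x l lies outside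
  \<open>L\<close>; if it were negative, then l (x l)^-1 = x^-1 would be positive by the left
  version.\<close>

lemma convex_mult_pos:
  assumes "l \<in> L" "x \<in> P - L"
  shows "l \<otimes> x \<in> P - L" "x \<otimes> l \<in> P - L"
proof -
  have left: "l \<otimes> x \<in> P - L" if "l \<in> L" "x \<in> P - L" for l x
  proof -
    have "inv l \<otimes> (l \<otimes> x) = x" using that by simp
    then have "l \<otimes> x \<notin> L" using that convex_closed(2)[of "inv l" "l \<otimes> x"] by auto
    then show ?thesis using that L by (auto simp: cone_convex_def)
  qed
  show "l \<otimes> x \<in> P - L" using left assms by blast
  have xl: "x \<otimes> l \<in> K" "x \<otimes> l \<otimes> inv l = x" using assms by (auto simp: m_assoc)
  then have nL: "x \<otimes> l \<notin> L" using assms convex_closed(2)[of "x \<otimes> l" "inv l"] by auto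
  have "inv (x \<otimes> l) \<notin> P - L"
  proof
    assume "inv (x \<otimes> l) \<in> P - L"
    then have "l \<otimes> inv (x \<otimes> l) \<in> P" using left assms by blast
    then show False using assms pos_inv by (simp add: inv_mult_group)
  qed
  then show "x \<otimes> l \<in> P - L" using nL convex_cases[OF xl(1)] by blast
qed

lemma above_convex_mult:
  assumes "x \<in> P - L" "y \<in> P - L"
  shows "x \<otimes> y \<in> P - L"
proof -
  have "x \<otimes> y \<notin> L"
  proof
    assume "x \<otimes> y \<in> L"
    then have "inv (x \<otimes> y) \<otimes> x \<in> P" using convex_mult_pos(1)[of "inv (x \<otimes> y)" x] assms by auto
    then have "inv y \<in> P" using assms by (simp add: inv_mult_group m_assoc)
    then show False using assms pos_inv by blast
  qed
  then show ?thesis using assms pos_mult by auto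
qed

lemma above_convex_pow: "x \<in> P - L \<Longrightarrow> 0 < n \<Longrightarrow> x [^] (n::nat) \<in> P - L"
  by (rule subsemigroup_pow[of "P - L"]) (use above_convex_mult in \<open>auto simp: subsemigroup_def\<close>)

text \<open>Positive elements outside \<open>L\<close> are closed under products, so powers never
  fall back into \<open>L\<close>. This is the source of torsion-freeness of quotients of convex
  subgroups, and of the root condition in \<open>rational_step_subset\<close>.\<close>

lemma convex_root:
  assumes "x \<in> K" "0 < n" "x [^] (n::nat) \<in> L"
  shows "x \<in> L"
proof (rule ccontr)
  assume "x \<notin> L"
  then consider "x \<in> P - L" | "inv x \<in> P - L" using convex_cases assms by blast
  then show False
  proof cases
    case 2
    then have "inv (x [^] n) \<in> P - L" using above_convex_pow[of "inv x" n] assms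
      by (simp add: nat_pow_inv)
    then show False using assms convex_closed(3) by blast
  qed (use above_convex_pow assms in blast)
qed

text \<open>This is the preorder in which \<open>L\<close> becomes neutral. A Conradian witness that
  falls into \<open>L\<close> is repaired by one more factor x, because an element of
  \<open>L\<close> times x is positive outside \<open>L\<close>.\<close>

lemma cone_coarsen: "conrad_cone G K (P - L)" "cone_residue G K (P - L) = L"
proof -
  have "\<exists>n::nat. inv x \<otimes> (y \<otimes> x [^] n) \<in> P - L" if x: "x \<in> P - L" and y: "y \<in> P - L" for x y
  proof -
    obtain n where n: "inv x \<otimes> (y \<otimes> x [^] (n::nat)) \<in> P" using conrad[of x y] x y by auto
    show ?thesis
    proof (cases "inv x \<otimes> (y \<otimes> x [^] n) \<in> L")
      case True
      then have "inv x \<otimes> (y \<otimes> x [^] n) \<otimes> x \<in> P - L" using convex_mult_pos(1)[of _ x] x by auto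
      then have "inv x \<otimes> (y \<otimes> x [^] Suc n) \<in> P - L" using x y by (simp add: m_assoc)
      then show ?thesis by blast
    qed (use n in blast)
  qed
  moreover have "x \<in> P - L \<or> y \<in> P - L"
    if xy: "x \<otimes> y \<in> P - L" and [simp]: "x \<in> K" "y \<in> K" for x y
  proof (rule ccontr)
    assume n: "\<not> ?thesis"
    have "inv (x \<otimes> y) = inv y \<otimes> inv x" by (simp add: inv_mult_group)
    then have "inv y \<otimes> inv x \<notin> P" using xy pos_inv[of "x \<otimes> y"] by auto
    then show False
      using n convex_cases[of x] convex_cases[of y] xy convex_closed(2)[of x y]
        convex_mult_pos(1)[of "inv y" "inv x"] convex_mult_pos(2)[of "inv x" "inv y"]
        above_convex_mult[of "inv y" "inv x"]
      by auto
  qed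
  ultimately show "conrad_cone G K (P - L)"
    unfolding conrad_cone_def using pos_inv by (auto simp del: nat_pow_Suc)
  show "cone_residue G K (P - L) = L"
    unfolding cone_residue_def using convex_cases convex_closed by blast
qed

end

section \<open>Lexicographic composition of cones\<close>

lemma (in group) coneI: "subgroup K G \<Longrightarrow> conrad_cone G K P \<Longrightarrow> cone G K P"
  by (intro cone.intro cone_axioms.intro is_group)

text \<open>The inverse of splitting a cone into its coarsening \<open>A\<close> and its restriction
  \<open>B\<close>; the last two equations recover both parts. The Conradian condition is delicate
  only in mixed cases: exponent 0 serves for x in \<open>L\<close> and y in \<open>A\<close>; for x
  in \<open>A\<close> and y in \<open>L\<close>, y is replaced by y x, which is in \<open>A\<close>,
  at the price of one more factor x.\<close>

lemma (in group) cone_lex: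
  assumes K: "subgroup K G" and L: "subgroup L G"
    and A: "conrad_cone G K A" "cone_residue G K A = L" and B: "conrad_cone G L B"
  shows "conrad_cone G K (A \<union> B)" "cone_residue G K (A \<union> B) = cone_residue G L B"
    "cone_convex G K (A \<union> B) L" "(A \<union> B) \<inter> L = B" "(A \<union> B) - L = A"
proof -
  interpret A: cone G K A by (rule coneI[OF K A(1)])
  interpret A: convex_cone G K A L
    using A.convex_residue unfolding A(2)
    by (intro convex_cone.intro convex_cone_axioms.intro A.cone_axioms)
  interpret B: cone G L B by (rule coneI[OF L B])
  note Lc = A.convex_mult_pos A.convex_cases A.above_convex_mult
  have LK: "L \<subseteq> K" and AL: "A \<inter> L = {}" using A by (auto simp: cone_residue_def)
  have BL: "B \<subseteq> L" by auto
  show sets: "(A \<union> B) \<inter> L = B" "(A \<union> B) - L = A" using AL BL by auto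
  have inv: "inv x \<notin> A \<union> B" if "x \<in> A \<union> B" for x
  proof
    assume ix: "inv x \<in> A \<union> B"
    show False
    proof (cases "x \<in> L")
      case True
      then have "inv x \<in> L" by simp
      then show False using True that ix AL B.pos_inv by blast
    next
      case False
      then have "x \<in> A" using that BL by blast
      then have "inv x \<in> B" using ix A.pos_inv by blast
      then have "inv (inv x) \<in> L" by simp
      then show False using False \<open>x \<in> A\<close> by simp
    qed
  qed
  have split: "x \<in> A \<union> B \<or> y \<in> A \<union> B"
    if xy: "x \<otimes> y \<in> A \<union> B" and [simp]: "x \<in> K" "y \<in> K" for x y
  proof (rule ccontr)
    assume n: "\<not> ?thesis"
    then have "x \<otimes> y \<in> B" using xy A.pos_split[of x y] by auto
    then have xyL: "x \<otimes> y \<in> L" by simp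
    have "x \<in> L \<or> inv x \<in> A" "y \<in> L \<or> inv y \<in> A" using Lc(3)[of x] Lc(3)[of y] n by auto
    moreover have "y \<in> L" if "x \<in> L"
    proof -
      have "inv x \<otimes> (x \<otimes> y) \<in> L" by (rule B.closed(2)[OF B.closed(3)[OF that] xyL])
      then show ?thesis by simp
    qed
    moreover have "x \<in> L" if "y \<in> L"
    proof -
      have "(x \<otimes> y) \<otimes> inv y \<in> L" by (rule B.closed(2)[OF xyL B.closed(3)[OF that]])
      then show ?thesis by (simp add: m_assoc)
    qed
    moreover have "\<not> (inv x \<in> A \<and> inv y \<in> A)"
    proof
      assume "inv x \<in> A \<and> inv y \<in> A"
      then have "inv (x \<otimes> y) \<in> A" using A.pos_mult[of "inv y" "inv x"] by (simp add: inv_mult_group)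
      moreover have "inv (x \<otimes> y) \<in> L" using xyL by simp
      ultimately show False using AL by blast
    qed
    ultimately have "x \<in> L" "y \<in> L" by blast+
    then show False using n B.pos_split[of x y] \<open>x \<otimes> y \<in> B\<close> by auto
  qed
  have conr: "\<exists>n::nat. inv x \<otimes> (y \<otimes> x [^] n) \<in> A \<union> B" if x: "x \<in> A \<union> B" and y: "y \<in> A \<union> B" for x y
  proof -
    consider "x \<in> A" "y \<in> A" | "x \<in> B" "y \<in> B" | "x \<in> L" "y \<in> A" | "x \<in> A" "y \<in> L"
      using x y BL by blast
    then show ?thesis
    proof cases
      case 3
      then have "inv x \<otimes> y \<in> A" using Lc(1)[of "inv x" y] AL by auto
      then have "inv x \<otimes> (y \<otimes> x [^] (0::nat)) \<in> A" using 3 by simp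
      then show ?thesis by blast
    next
      case 4
      then have "y \<otimes> x \<in> A" using Lc(1)[of y x] AL by auto
      then obtain n where "inv x \<otimes> ((y \<otimes> x) \<otimes> x [^] (n::nat)) \<in> A" using A.conrad[of x "y \<otimes> x"] 4 by auto
      then have "inv x \<otimes> (y \<otimes> x [^] Suc n) \<in> A"
        using 4 nat_pow_Suc2[of x n] by (simp add: m_assoc)
      then show ?thesis by blast
    next
      case 1
      then show ?thesis using A.conrad[of x y] by auto
    next
      case 2
      then show ?thesis using B.conrad[of x y] by auto
    qed
  qed
  show AB: "conrad_cone G K (A \<union> B)"
    unfolding conrad_cone_def using inv split conr LK BL by auto
  show res: "cone_residue G K (A \<union> B) = cone_residue G L B"
  proof
    show "cone_residue G K (A \<union> B) \<subseteq> cone_residue G L B"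
      using Lc(3) by (auto simp: cone_residue_def)
    show "cone_residue G L B \<subseteq> cone_residue G K (A \<union> B)"
      using AL LK B.closed(3) by (auto simp: cone_residue_def)
  qed
  have "l \<otimes> x \<in> A \<union> B" if "l \<in> L" "x \<in> (A \<union> B) - L" for l x
    using that Lc(1) BL by blast
  then show "cone_convex G K (A \<union> B) L"
    unfolding cone_convex_def res using L LK by (auto simp: cone_residue_def)
qed

section \<open>Convex jumps\<close>

context cone
begin

abbreviation lt where "lt x y \<equiv> inv x \<otimes> y \<in> P"

lemma lt_left: "a \<in> K \<Longrightarrow> x \<in> K \<Longrightarrow> y \<in> K \<Longrightarrow> lt (a \<otimes> x) (a \<otimes> y) \<longleftrightarrow> lt x y"
  by (simp add: inv_mult_group m_assoc)

lemma lt_neg_trans: "lt x z \<Longrightarrow> x \<in> K \<Longrightarrow> y \<in> K \<Longrightarrow> z \<in> K \<Longrightarrow> lt x y \<or> lt y z"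
  using pos_split[of "inv x \<otimes> y" "inv y \<otimes> z"] by (simp add: m_assoc)

lemma lt_trans: "lt x y \<Longrightarrow> lt y z \<Longrightarrow> x \<in> K \<Longrightarrow> y \<in> K \<Longrightarrow> z \<in> K \<Longrightarrow> lt x z"
  using pos_mult[of "inv x \<otimes> y" "inv y \<otimes> z"] by (simp add: m_assoc)

lemma lt_asym: "lt x y \<Longrightarrow> x \<in> K \<Longrightarrow> y \<in> K \<Longrightarrow> \<not> lt y x"
  using pos_inv[of "inv x \<otimes> y"] by (simp add: inv_mult_group)

lemma lt_mult_pos: "x \<in> K \<Longrightarrow> p \<in> P \<Longrightarrow> lt x (x \<otimes> p)"
  by simp

text \<open>The exponent in the Conradian condition can always be taken to be \<open>2\<close>: if
  \<open>b a\<^sup>2 \<le> a\<close>, then \<open>h = b a\<close> satisfies \<open>h\<^sup>n a \<le> a\<close> for all \<open>n\<close>, hence \<open>b h\<^sup>n < b h\<^sup>n a \<le> h\<close>.\<close>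

lemma conrad_two:
  assumes a: "a \<in> P" and b: "b \<in> P"
  shows "lt a (b \<otimes> (a \<otimes> a))"
proof (rule ccontr)
  define h where "h = b \<otimes> a"
  have hP: "h \<in> P" using a b pos_mult by (simp add: h_def)
  assume "\<not> lt a (b \<otimes> (a \<otimes> a))"
  then have base: "\<not> lt a (h \<otimes> a)" using a b by (simp add: h_def m_assoc)
  have "\<not> lt a (h [^] n \<otimes> a)" for n :: nat
  proof (induction n)
    case 0
    then show ?case using a by simp
  next
    case (Suc n)
    have "h [^] Suc n \<otimes> a = h \<otimes> (h [^] n \<otimes> a)"
      using hP a nat_pow_Suc2[of h n] by (simp add: m_assoc)
    moreover have "\<not> lt (h \<otimes> a) (h \<otimes> (h [^] n \<otimes> a))"
      using Suc hP a lt_left[of h a "h [^] n \<otimes> a"] by simp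
    ultimately show ?case
      using base lt_neg_trans[of a "h \<otimes> (h [^] n \<otimes> a)" "h \<otimes> a"] hP a by auto
  qed note small = this
  obtain n where n: "inv h \<otimes> (b \<otimes> h [^] (n::nat)) \<in> P" using conrad[OF hP b] by blast
  have "lt (b \<otimes> h [^] n) (b \<otimes> h [^] n \<otimes> a)" using lt_mult_pos[of "b \<otimes> h [^] n" a] hP a b by simp
  then have "lt h (b \<otimes> h [^] n \<otimes> a)"
    using lt_trans[of h "b \<otimes> h [^] n" "b \<otimes> h [^] n \<otimes> a"] n hP a b by auto
  then have "lt (b \<otimes> a) (b \<otimes> (h [^] n \<otimes> a))" using hP a b by (simp add: h_def m_assoc)
  then have "lt a (h [^] n \<otimes> a)" using lt_left[of b a "h [^] n \<otimes> a"] hP a b by simp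
  then show False using small by blast
qed

text \<open>\<open>conrad_two\<close> for a and the positive element g^-1 a^k, multiplied by g from
  the left. The increment 2 is the exponent from there; it compensates for the missing right
  invariance.\<close>

lemma below_pow_step:
  assumes a: "a \<in> P" and g: "g \<in> K" "lt g (a [^] (k::nat))"
  shows "lt (g \<otimes> a) (a [^] (k + 2))"
proof -
  have "lt a ((inv g \<otimes> a [^] k) \<otimes> (a \<otimes> a))" using conrad_two[OF a] g by blast
  then have "lt (g \<otimes> a) (g \<otimes> ((inv g \<otimes> a [^] k) \<otimes> (a \<otimes> a)))" using a g by (subst lt_left) auto
  moreover have "g \<otimes> ((inv g \<otimes> a [^] k) \<otimes> (a \<otimes> a)) = a [^] (k + 2)"
    using a g by (simp add: m_assoc numeral_2_eq_2)
  ultimately show ?thesis by simp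
qed

lemma below_pow_steps:
  assumes a: "a \<in> P" and g: "g \<in> K" "lt g (a [^] (k::nat))"
  shows "lt (g \<otimes> a [^] m) (a [^] (k + 2 * m))"
proof (induction m)
  case 0
  then show ?case using a g by simp
next
  case (Suc m)
  have "lt (g \<otimes> a [^] m \<otimes> a) (a [^] (k + 2 * m + 2))"
    using below_pow_step[OF a _ Suc] a g by simp
  then show ?case using a g by (simp add: m_assoc del: One_nat_def)
qed

text \<open>Left invariance gives g h < g a^m, and each of the m factors a then raises the bound by
  2.\<close>

lemma below_pow_mult:
  assumes a: "a \<in> P" and g: "g \<in> K" "lt g (a [^] (k::nat))" and h: "h \<in> K" "lt h (a [^] (m::nat))"
  shows "lt (g \<otimes> h) (a [^] (k + 2 * m))"
proof -
  have "lt (g \<otimes> h) (g \<otimes> a [^] m)" using lt_left[of g h "a [^] m"] a g h by simp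
  then show ?thesis
    using lt_trans[of "g \<otimes> h" "g \<otimes> a [^] m" "a [^] (k + 2 * m)"] below_pow_steps[OF a g, of m] a g h
    by simp
qed

text \<open>For positive a this is the least convex subgroup containing a. Bounding g and its
  inverse separately makes closure under inversion immediate; closure under products is where the
  Conradian condition enters, through \<open>below_pow_mult\<close>.\<close>

definition conv_hull where
  "conv_hull a = {g \<in> K. (\<exists>k::nat. lt g (a [^] k)) \<and> (\<exists>k::nat. lt (inv g) (a [^] k))}"

lemma hull_closed: "g \<in> conv_hull a \<Longrightarrow> g \<in> K"
  by (simp add: conv_hull_def)

lemma hullI:
  "g \<in> K \<Longrightarrow> lt g (a [^] (k::nat)) \<Longrightarrow> lt (inv g) (a [^] (m::nat)) \<Longrightarrow> g \<in> conv_hull a"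
  unfolding conv_hull_def by blast

lemma hullE:
  assumes "g \<in> conv_hull a"
  obtains k m where "g \<in> K" "lt g (a [^] (k::nat))" "lt (inv g) (a [^] (m::nat))"
  using assms unfolding conv_hull_def by blast

lemma subgroup_hull:
  assumes a: "a \<in> P"
  shows "subgroup (conv_hull a) G"
proof (rule subgroupI)
  have "lt \<one> (a [^] (1::nat))" "lt (inv \<one>) (a [^] (1::nat))" using a by simp_all
  then have "\<one> \<in> conv_hull a" using hullI closed(4) by blast
  then show "conv_hull a \<noteq> {}" by blast
  show "inv g \<in> conv_hull a" if "g \<in> conv_hull a" for g
    using that by (elim hullE, intro hullI) auto
  show "g \<otimes> h \<in> conv_hull a" if g: "g \<in> conv_hull a" and h: "h \<in> conv_hull a" for g h
  proof -
    note [simp] = hull_closed[OF g] hull_closed[OF h]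
    obtain k k' m m' where kk: "lt g (a [^] (k::nat))" "lt (inv g) (a [^] (k'::nat))"
        "lt h (a [^] (m::nat))" "lt (inv h) (a [^] (m'::nat))"
      using g h unfolding conv_hull_def by blast
    have "lt (g \<otimes> h) (a [^] (k + 2 * m))" using below_pow_mult[OF a _ kk(1) _ kk(3)] g h by simp
    moreover have "lt (inv h \<otimes> inv g) (a [^] (m' + 2 * k'))"
      using below_pow_mult[OF a _ kk(4) _ kk(2)] g h by simp
    then have "lt (inv (g \<otimes> h)) (a [^] (m' + 2 * k'))" using g h by (simp add: inv_mult_group)
    ultimately show ?thesis by (rule hullI[rotated]) simp
  qed
qed (auto dest: hull_closed)

text \<open>If l x were not positive, x would be at most l^-1, which is below a power of a, and so
  the positive element x would lie in the hull.\<close>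

lemma convex_hull:
  assumes a: "a \<in> P"
  shows "cone_convex G K P (conv_hull a)"
proof -
  have a1: "a = a [^] (1::nat)" using a by simp
  have "l \<in> conv_hull a" if l: "l \<in> R" for l
  proof -
    have "lK": "l \<in> K" using l by (simp add: in_residue)
    have "inv l \<in> R" using subgroup.m_inv_closed[OF subgroup_residue l] .
    then have "lt l (a [^] (1::nat))" "lt (inv l) (a [^] (1::nat))"
      using residue_mult_pos(1)[of _ a] l a lK by auto
    then show ?thesis using lK hullI by blast
  qed
  moreover have "l \<otimes> x \<in> P" if l: "l \<in> conv_hull a" and x: "x \<in> P - conv_hull a" for l x
  proof (rule ccontr)
    assume n: "l \<otimes> x \<notin> P"
    note [simp] = hull_closed[OF l]
    obtain k where "lt (inv l) (a [^] (k::nat))" using l by (rule hullE)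
    then have "lt (inv l) x \<or> lt x (a [^] k)"
      using lt_neg_trans[of "inv l" "a [^] k" x] a l x by simp
    then have 1: "lt x (a [^] k)" using n l by simp
    have "lt (inv x) (a [^] (1::nat))" using pos_mult[of x a] x a by simp
    then have "x \<in> conv_hull a" using hullI[OF _ 1] x pos_closed by blast
    then show False using x by blast
  qed
  ultimately show ?thesis
    unfolding cone_convex_def using subgroup_hull[OF a] by (auto dest: hull_closed)
qed

lemma in_hull:
  assumes a: "a \<in> P"
  shows "a \<in> conv_hull a"
proof -
  have "lt a (a [^] (2::nat))" using a by (simp add: numeral_2_eq_2)
  moreover have "lt (inv a) (a [^] (1::nat))" using pos_mult[OF a a] a by simp
  ultimately show ?thesis using hullI pos_closed[OF a] by blast
qed

lemma convexI: "cone_convex G K P M \<Longrightarrow> convex_cone G K P M"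
  by (intro convex_cone.intro convex_cone_axioms.intro cone_axioms)

lemma hull_least:
  assumes M: "cone_convex G K P M" and a: "a \<in> M"
  shows "conv_hull a \<subseteq> M"
proof
  interpret M: convex_cone G K P M by (rule convexI[OF M])
  have no: False if g: "g \<in> P - M" "lt g (a [^] (k::nat))" for g k
  proof -
    have "inv (a [^] k) \<otimes> g \<in> P" using M.convex_mult_pos(1)[of "inv (a [^] k)" g] a g by auto
    then show False using lt_asym[of g "a [^] k"] g a by simp
  qed
  fix g assume g: "g \<in> conv_hull a"
  note [simp] = hull_closed[OF g]
  obtain k m where "lt g (a [^] (k::nat))" "lt (inv g) (a [^] (m::nat))"
    using g unfolding conv_hull_def by blast
  then show "g \<in> M" using no[of g k] no[of "inv g" m] M.convex_cases[of g] hull_closed[OF g] by blast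
qed

text \<open>Otherwise each subgroup would have a positive element outside the other, and each of
  these two elements would be strictly below the other.\<close>

lemma convex_chain:
  assumes M: "cone_convex G K P M" and M': "cone_convex G K P M'"
  shows "M \<subseteq> M' \<or> M' \<subseteq> M"
proof (rule ccontr)
  interpret M: convex_cone G K P M by (rule convexI[OF M])
  interpret M': convex_cone G K P M' by (rule convexI[OF M'])
  assume "\<not> ?thesis"
  then obtain x y where x: "x \<in> M" "x \<notin> M'" and y: "y \<in> M'" "y \<notin> M" by blast
  obtain x' where x': "x' \<in> M" "x' \<in> P - M'"
    using x M'.convex_cases[of x] by (metis M.convex_closed(1,3))
  obtain y' where y': "y' \<in> M'" "y' \<in> P - M"
    using y M.convex_cases[of y] by (metis M'.convex_closed(1,3))
  have "inv x' \<otimes> y' \<in> P" using M.convex_mult_pos(1)[of "inv x'" y'] x' y' by auto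
  moreover have "inv y' \<otimes> x' \<in> P" using M'.convex_mult_pos(1)[of "inv y'" x'] x' y' by auto
  ultimately show False using lt_asym[of x' y'] x' y' by auto
qed

text \<open>For positive a, the largest convex subgroup that omits a. The union is a subgroup
  because convex subgroups form a chain.\<close>

definition conv_core where "conv_core a = \<Union>{M. cone_convex G K P M \<and> a \<notin> M}"

lemma convex_core:
  assumes a: "a \<in> P"
  shows "cone_convex G K P (conv_core a)"
proof -
  have R: "R \<subseteq> conv_core a" using convex_residue a by (auto simp: conv_core_def in_residue)
  have mem: "cone_convex G K P M \<Longrightarrow> a \<notin> M \<Longrightarrow> g \<in> M \<Longrightarrow> g \<in> conv_core a" for M g
    by (auto simp: conv_core_def)
  have "subgroup (conv_core a) G"
  proof (rule subgroupI)
    show "conv_core a \<subseteq> carrier G" by (auto simp: conv_core_def cone_convex_def)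
    show "conv_core a \<noteq> {}" using R subgroup.one_closed[OF subgroup_residue] by blast
    show "inv g \<in> conv_core a" if g: "g \<in> conv_core a" for g
    proof -
      obtain M where M: "cone_convex G K P M" "a \<notin> M" "g \<in> M" using g by (auto simp: conv_core_def)
      then interpret M: convex_cone G K P M by (intro convexI)
      show ?thesis using mem[OF M(1,2)] M(3) by simp
    qed
    show "g \<otimes> h \<in> conv_core a" if g: "g \<in> conv_core a" and h: "h \<in> conv_core a" for g h
    proof -
      obtain M where M: "cone_convex G K P M" "a \<notin> M" "g \<in> M" using g by (auto simp: conv_core_def)
      obtain M' where M': "cone_convex G K P M'" "a \<notin> M'" "h \<in> M'" using h by (auto simp: conv_core_def)
      obtain N where N: "cone_convex G K P N" "a \<notin> N" "g \<in> N" "h \<in> N"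
        using convex_chain[OF M(1) M'(1)] M M' by blast
      then interpret N: convex_cone G K P N by (intro convexI)
      show ?thesis using mem[OF N(1,2)] N(3,4) by simp
    qed
  qed
  moreover have "l \<otimes> x \<in> P" if l: "l \<in> conv_core a" and x: "x \<in> P - conv_core a" for l x
  proof -
    obtain M where M: "cone_convex G K P M" "a \<notin> M" "l \<in> M" using l by (auto simp: conv_core_def)
    then have "x \<in> P - M" using x mem[OF M(1,2)] by blast
    then show ?thesis using M by (simp add: cone_convex_def)
  qed
  moreover have "conv_core a \<subseteq> K" by (auto simp: conv_core_def cone_convex_def)
  ultimately show ?thesis using R by (simp add: cone_convex_def)
qed

lemma not_in_core: "a \<notin> conv_core a"
  by (auto simp: conv_core_def)

lemma core_greatest: "cone_convex G K P M \<Longrightarrow> a \<notin> M \<Longrightarrow> M \<subseteq> conv_core a"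
  by (auto simp: conv_core_def)

lemma core_subset_hull: "a \<in> P \<Longrightarrow> conv_core a \<subseteq> conv_hull a"
  using convex_chain[OF convex_core convex_hull, of a a] in_hull[of a] not_in_core[of a] by blast

text \<open>The Archimedean property of the jump: the hull of g is a convex subgroup not contained
  in the core of a, so it contains a and hence the whole hull of a.\<close>

lemma hull_cofinal:
  assumes a: "a \<in> P" and g: "g \<in> P - conv_core a" and x: "x \<in> conv_hull a"
  shows "\<exists>n::nat. lt x (g [^] n)"
proof -
  have "a \<in> conv_hull g"
    using core_greatest[OF convex_hull[of g], of a] in_hull[of g] g by blast
  then have "x \<in> conv_hull g" using hull_least[OF convex_hull[of g], of a] g x by blast
  then show ?thesis by (simp add: conv_hull_def)
qed

lemma conj_pow:
  assumes "g \<in> K" "h \<in> K"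
  shows "(g \<otimes> (h \<otimes> inv g)) [^] (n::nat) = g \<otimes> (h [^] n \<otimes> inv g)"
  by (induction n) (use assms in \<open>simp_all add: m_assoc\<close>)

text \<open>Let h be in the core and g positive outside it, so that all powers of h are below g. If
  g h g^-1 were positive outside the core, its powers would be cofinal, so g^2 < g h^n g^-1 for some
  n; then g < h^n g^-1 < h^n, a contradiction. Negative conjugates are treated by inverting
  h.\<close>

lemma core_normal:
  assumes a: "a \<in> P"
  shows "conv_core a \<lhd> G\<lparr>carrier := conv_hull a\<rparr>"
proof -
  interpret H: convex_cone G K P "conv_core a" by (rule convexI[OF convex_core[OF a]])
  interpret L: convex_cone G K P "conv_hull a" by (rule convexI[OF convex_hull[OF a]])
  interpret GL: group "G\<lparr>carrier := conv_hull a\<rparr>"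
    by (rule subgroup.subgroup_is_group[OF subgroup_hull[OF a] is_group])
  note HL = core_subset_hull[OF a]
  have small: "lt h g" if "h \<in> conv_core a" "g \<in> P - conv_core a" for h g
    using H.convex_mult_pos(1)[of "inv h" g] that by auto
  have up: "g \<otimes> (h \<otimes> inv g) \<notin> P - conv_core a"
    if h: "h \<in> conv_core a" and g: "g \<in> P - conv_core a" "g \<in> conv_hull a" for h g
  proof
    assume x: "g \<otimes> (h \<otimes> inv g) \<in> P - conv_core a"
    obtain n where "lt (g \<otimes> g) ((g \<otimes> (h \<otimes> inv g)) [^] (n::nat))"
      using hull_cofinal[OF a x, of "g \<otimes> g"] g by auto
    then have "lt (g \<otimes> g) (g \<otimes> (h [^] n \<otimes> inv g))" using conj_pow[of g h n] g h by simp
    then have "lt g (h [^] n \<otimes> inv g)" using lt_left[of g g "h [^] n \<otimes> inv g"] g h by simp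
    moreover have "lt (h [^] n \<otimes> inv g) (h [^] n)" using g h by (simp add: inv_mult_group m_assoc)
    ultimately have "lt g (h [^] n)" using lt_trans[of g "h [^] n \<otimes> inv g" "h [^] n"] g h by simp
    then show False using small[of "h [^] n" g] lt_asym[of g "h [^] n"] g h by simp
  qed
  have down: "inv g \<otimes> (h \<otimes> g) \<notin> P - conv_core a"
    if h: "h \<in> conv_core a" and g: "g \<in> P - conv_core a" "g \<in> conv_hull a" for h g
  proof
    assume x: "inv g \<otimes> (h \<otimes> g) \<in> P - conv_core a"
    \<comment> \<open>In this direction cofinality beyond g^2 gives g^3 < h^n g, while h^n < g and
      \<open>below_pow_step\<close> with k = 1 give h^n g < g^3. The choice of g^2 makes the two
      exponents match.\<close>
    obtain n where "lt (g \<otimes> g) ((inv g \<otimes> (h \<otimes> g)) [^] (n::nat))"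
      using hull_cofinal[OF a x, of "g \<otimes> g"] g by auto
    then have "lt (g \<otimes> g) (inv g \<otimes> (h [^] n \<otimes> g))" using conj_pow[of "inv g" h n] g h by simp
    then have "lt (g \<otimes> (g \<otimes> g)) (g \<otimes> (inv g \<otimes> (h [^] n \<otimes> g)))"
      using lt_left[of g "g \<otimes> g" "inv g \<otimes> (h [^] n \<otimes> g)"] g h by simp
    then have 1: "lt (g \<otimes> (g \<otimes> g)) (h [^] n \<otimes> g)" using g h by simp
    have "lt (h [^] n) (g [^] (1::nat))" using small[of "h [^] n" g] g h by simp
    then have "lt (h [^] n \<otimes> g) (g [^] (1 + 2 :: nat))"
      using below_pow_step[of g "h [^] n" 1] g h by simp
    then have "lt (h [^] n \<otimes> g) (g \<otimes> (g \<otimes> g))" using g h by (simp add: m_assoc numeral_3_eq_3)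
    then show False using 1 lt_asym[of "g \<otimes> (g \<otimes> g)" "h [^] n \<otimes> g"] g h by simp
  qed
  have "g \<otimes> h \<otimes> inv g \<in> conv_core a" if g: "g \<in> conv_hull a" and h: "h \<in> conv_core a" for g h
  proof -
    have c: "h \<in> K" "g \<in> K" using g h by auto
    have i: "inv (g \<otimes> (h \<otimes> inv g)) = g \<otimes> (inv h \<otimes> inv g)"
      using c by (simp add: inv_mult_group m_assoc)
    consider "g \<in> conv_core a" | "g \<in> P - conv_core a" | "inv g \<in> P - conv_core a" using H.convex_cases c by blast
    then have "g \<otimes> (h \<otimes> inv g) \<in> conv_core a"
    proof cases
      case 2
      then show ?thesis
        using up[OF h 2 g] up[of "inv h" g] H.convex_cases[of "g \<otimes> (h \<otimes> inv g)"] g h c i by auto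
    next
      case 3
      have ig: "inv g \<in> conv_hull a" using g by simp
      show ?thesis
        using down[OF h 3 ig] down[OF _ 3 ig, of "inv h"] H.convex_cases[of "g \<otimes> (h \<otimes> inv g)"] h c i
        by auto
    qed (use h in simp)
    then show ?thesis using c by (simp add: m_assoc)
  qed
  moreover have "inv\<^bsub>G\<lparr>carrier := conv_hull a\<rparr>\<^esub> g = inv g" if "g \<in> conv_hull a" for g
    using m_inv_consistent[OF subgroup_hull[OF a] that] .
  ultimately show ?thesis
    unfolding GL.normal_inv_iff
    using subgroup_incl[OF H.convex_subgroup L.convex_subgroup HL] by simp
qed

end

lemma (in cone) convex_restrict:
  assumes "cone_convex G K P L" "cone_convex G K P H" "H \<subseteq> L"
  shows "cone_convex G L (P \<inter> L) H"
proof -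
  interpret L: convex_cone G K P L by (rule convexI[OF assms(1)])
  interpret H: convex_cone G K P H by (rule convexI[OF assms(2)])
  have LK: "L \<subseteq> K" using assms by (simp add: cone_convex_def)
  have "cone_residue G L (P \<inter> L) \<subseteq> H"
    using cone_restrict(2)[OF LK L.convex_subgroup] assms(2) by (auto simp: cone_convex_def)
  moreover have "h \<otimes> x \<in> P \<inter> L" if "h \<in> H" "x \<in> P \<inter> L - H" for h x
    using that assms(3) H.convex_mult_pos(1)[of h x] by auto
  ultimately show ?thesis using H.convex_subgroup assms(3) by (simp add: cone_convex_def)
qed

section \<open>Cones and quotients\<close>

context group
begin

lemma total_cone_subquotient:
  assumes K: "subgroup K G" and P: "conrad_cone G K P" and N: "cone_residue G K P \<lhd> G\<lparr>carrier := K\<rparr>"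
  defines "H \<equiv> cone_residue G K P"
  shows "total_cone (subquotient G K H) ((\<lambda>x. H #> x) ` P)"
proof -
  interpret cone G K P by (rule coneI[OF K P])
  note N = N[folded H_def]
  note Q = carrier_subquotient[OF K N] mult_subquotient[OF K N] inv_subquotient[OF K N]
    coset_eq_subquotient[OF K N] coset_eq_one_subquotient[OF K N]
  \<comment> \<open>The residue multiplies the cone into itself, so each of its cosets lies inside
    the cone or misses it.\<close>
  have mem: "H #> x \<in> (\<lambda>x. H #> x) ` P \<longleftrightarrow> x \<in> P" if x: "x \<in> K" for x
  proof
    assume "H #> x \<in> (\<lambda>x. H #> x) ` P"
    then obtain p where p: "p \<in> P" "H #> x = H #> p" by blast
    then have "x \<otimes> inv p \<in> R" using Q(4)[of x p] x by (simp add: H_def)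
    then have "(x \<otimes> inv p) \<otimes> p \<in> P" using residue_mult_pos(1) p by blast
    then show "x \<in> P" using x p by (simp add: m_assoc)
  qed blast
  have one: "\<one>\<^bsub>subquotient G K H\<^esub> = H #> \<one>"
    using Q(5)[of \<one>] subgroup.one_closed[OF subgroup_residue] by (simp add: H_def)
  show "total_cone (subquotient G K H) ((\<lambda>x. H #> x) ` P)"
    unfolding total_cone_def
  proof (intro conjI ballI impI)
    show "(\<lambda>x. H #> x) ` P \<subseteq> carrier (subquotient G K H)" by (auto simp: Q(1))
    show "\<one>\<^bsub>subquotient G K H\<^esub> \<notin> (\<lambda>x. H #> x) ` P" using one mem[of \<one>] by simp
    show "X \<otimes>\<^bsub>subquotient G K H\<^esub> Y \<in> (\<lambda>x. H #> x) ` P"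
      if "X \<in> (\<lambda>x. H #> x) ` P" "Y \<in> (\<lambda>x. H #> x) ` P" for X Y
      using that Q(2) pos_mult by auto
    fix X assume X: "X \<in> carrier (subquotient G K H)" "X \<noteq> \<one>\<^bsub>subquotient G K H\<^esub>"
    then obtain x where x: "x \<in> K" "X = H #> x" by (auto simp: Q(1))
    then have "x \<notin> R" using X Q(5)[of x] by (simp add: H_def)
    then have "x \<in> P \<or> inv x \<in> P" using x by (simp add: in_residue)
    then show "X \<in> (\<lambda>x. H #> x) ` P \<or> inv\<^bsub>subquotient G K H\<^esub> X \<in> (\<lambda>x. H #> x) ` P"
      using x Q(3)[of x] by auto
  qed
qed

lemma conrad_cone_pullback:
  assumes H: "subgroup H G" and K: "subgroup K G" and ab: "abelian_over G H K"
    and Q: "total_cone (subquotient G K H) Q"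
  defines "P \<equiv> {x \<in> K. H #> x \<in> Q}"
  shows "conrad_cone G K P" "cone_residue G K P = H"
proof -
  have N: "H \<lhd> G\<lparr>carrier := K\<rparr>" and "comm_group (subquotient G K H)"
    using ab abelian_over_iff[OF H K] by blast+
  then interpret Q: comm_group "subquotient G K H" by blast
  note [simp] = subgroup.m_closed[OF K] subgroup.m_inv_closed[OF K] subgroup.mem_carrier[OF K]
    subgroup.one_closed[OF K]
  note S = carrier_subquotient[OF K N] mult_subquotient[OF K N] inv_subquotient[OF K N]
    coset_eq_one_subquotient[OF K N]
  have QC: "Q \<subseteq> carrier (subquotient G K H)" and Qm: "\<And>X Y. X \<in> Q \<Longrightarrow> Y \<in> Q \<Longrightarrow> X \<otimes>\<^bsub>subquotient G K H\<^esub> Y \<in> Q"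
    and Q1: "\<one>\<^bsub>subquotient G K H\<^esub> \<notin> Q"
    and Qt: "\<And>X. X \<in> carrier (subquotient G K H) \<Longrightarrow> X \<noteq> \<one>\<^bsub>subquotient G K H\<^esub> \<Longrightarrow>
        X \<in> Q \<or> inv\<^bsub>subquotient G K H\<^esub> X \<in> Q"
    using Q by (auto simp: total_cone_def)
  have cos: "H #> x \<in> carrier (subquotient G K H)" if "x \<in> K" for x using that by (auto simp: S(1))
  have tri: "x \<in> H \<or> H #> x \<in> Q \<or> H #> inv x \<in> Q" if "x \<in> K" for x
    using Qt[OF cos[OF that]] S(3,4)[OF that] by auto
  have notH: "x \<notin> H" if "x \<in> K" "H #> x \<in> Q" for x using S(4) Q1 that by metis
  have asym: "H #> inv x \<notin> Q" if "x \<in> K" "H #> x \<in> Q" for x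
    using Q.total_cone_inv[OF Q that(2)] S(3) that by simp
  have split: "H #> x \<in> Q \<or> H #> y \<in> Q" if xy: "x \<in> K" "y \<in> K" "H #> (x \<otimes> y) \<in> Q" for x y
  proof (rule ccontr)
    assume n: "\<not> ?thesis"
    let ?X = "H #> x" and ?Y = "H #> y"
    have XY: "?X \<otimes>\<^bsub>subquotient G K H\<^esub> ?Y \<in> Q" using xy S(2) by simp
    have "?X \<noteq> \<one>\<^bsub>subquotient G K H\<^esub>" using XY n cos xy by auto
    moreover have "?Y \<noteq> \<one>\<^bsub>subquotient G K H\<^esub>" using XY n cos xy by auto
    ultimately have "inv\<^bsub>subquotient G K H\<^esub> ?Y \<otimes>\<^bsub>subquotient G K H\<^esub> inv\<^bsub>subquotient G K H\<^esub> ?X \<in> Q"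
      using Qt[OF cos] n xy Qm by blast
    then have "inv\<^bsub>subquotient G K H\<^esub> (?X \<otimes>\<^bsub>subquotient G K H\<^esub> ?Y) \<in> Q"
      using cos xy by (simp add: Q.inv_mult_group)
    then show False using Q.total_cone_inv[OF Q XY] by blast
  qed
  \<comment> \<open>Modulo \<open>H\<close> the element x^-1 y x equals y, so exponent 1 always
    works.\<close>
  have conr: "inv x \<otimes> (y \<otimes> x [^] (1::nat)) \<in> P" if xy: "x \<in> P" "y \<in> P" for x y
  proof -
    have k: "x \<in> K" "y \<in> K" "H #> y \<in> Q" using xy by (auto simp: P_def)
    have "H #> (inv x \<otimes> (y \<otimes> x)) = inv\<^bsub>subquotient G K H\<^esub> (H #> x) \<otimes>\<^bsub>subquotient G K H\<^esub>
        ((H #> y) \<otimes>\<^bsub>subquotient G K H\<^esub> (H #> x))"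
      using k S(2,3) by simp
    also have "\<dots> = H #> y" using k cos by (simp add: Q.m_comm[of "H #> y" "H #> x"])
    finally show ?thesis using k by (simp add: P_def)
  qed
  show "conrad_cone G K P"
    unfolding conrad_cone_def
  proof (intro conjI ballI impI)
    show "P \<subseteq> K" by (auto simp: P_def)
    show "inv x \<notin> P" if "x \<in> P" for x using that asym by (auto simp: P_def)
    show "x \<in> P \<or> y \<in> P" if "x \<in> K" "y \<in> K" "x \<otimes> y \<in> P" for x y
      using that split[of x y] by (auto simp: P_def)
    show "\<exists>n::nat. inv x \<otimes> (y \<otimes> x [^] n) \<in> P" if "x \<in> P" "y \<in> P" for x y
      using conr[OF that] by blast
  qed
  have HK: "H \<subseteq> K" using ab by (simp add: abelian_over_def)
  have "inv x \<in> H" if "x \<in> H" for x using that H by (rule subgroup.m_inv_closed[rotated])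
  then show "cone_residue G K P = H"
    using tri notH HK by (auto simp: cone_residue_def P_def)
qed

end

context cone
begin

lemma jump_abelian:
  assumes a: "a \<in> P"
  shows "abelian_over G (conv_core a) (conv_hull a)"
proof -
  let ?H = "conv_core a" and ?L = "conv_hull a"
  interpret H: convex_cone G K P ?H by (rule convexI[OF convex_core[OF a]])
  interpret L: convex_cone G K P ?L by (rule convexI[OF convex_hull[OF a]])
  note HL = core_subset_hull[OF a]
  have LK: "?L \<subseteq> K" by (auto dest: hull_closed)
  note cr = cone_restrict[OF LK L.convex_subgroup]
  interpret PL: cone G ?L "P \<inter> ?L" by (rule coneI[OF L.convex_subgroup cr(1)])
  interpret HL: convex_cone G ?L "P \<inter> ?L" ?H
    by (rule PL.convexI[OF convex_restrict[OF convex_hull[OF a] convex_core[OF a] HL]])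
  define P' where "P' = P \<inter> ?L - ?H"
  have P': "conrad_cone G ?L P'" "cone_residue G ?L P' = ?H"
    using HL.cone_coarsen by (simp_all add: P'_def)
  have N: "?H \<lhd> G\<lparr>carrier := ?L\<rparr>" by (rule core_normal[OF a])
  note S = carrier_subquotient[OF L.convex_subgroup N] mult_subquotient[OF L.convex_subgroup N]
    inv_subquotient[OF L.convex_subgroup N] pow_subquotient[OF L.convex_subgroup N]
  interpret Q: group "subquotient G ?L ?H" by (rule group_subquotient[OF L.convex_subgroup N])
  let ?T = "(\<lambda>x. ?H #> x) ` P'"
  have T: "total_cone (subquotient G ?L ?H) ?T"
    using total_cone_subquotient[OF L.convex_subgroup P'(1)] N by (simp only: P'(2))
  have arch: "\<exists>n::nat. inv\<^bsub>subquotient G ?L ?H\<^esub> X \<otimes>\<^bsub>subquotient G ?L ?H\<^esub> Y [^]\<^bsub>subquotient G ?L ?H\<^esub> n \<in> ?T"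
    if XT: "X \<in> ?T" and YT: "Y \<in> ?T" for X Y
  proof -
    obtain x where x: "x \<in> P'" "X = ?H #> x" using XT by (rule imageE)
    obtain y where y: "y \<in> P'" "Y = ?H #> y" using YT by (rule imageE)
    have xL: "x \<in> ?L" "y \<in> ?L" "x \<in> P - ?H" "y \<in> P - ?H" using x y by (auto simp: P'_def)
    \<comment> \<open>Exceeding x^2 instead of x keeps the inequality strict in the quotient: if
      x^-1 y^n were in the core, its inverse times x would still be positive, which says y^n <
      x^2.\<close>
    obtain n where n: "lt (x \<otimes> x) (y [^] (n::nat))"
      using hull_cofinal[OF a xL(4), of "x \<otimes> x"] xL by auto
    have "lt x (x \<otimes> x)" using xL by simp
    then have "lt x (y [^] n)" using lt_trans[OF _ n, of x] xL by simp
    moreover have "inv x \<otimes> y [^] n \<notin> ?H"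
    proof
      assume h: "inv x \<otimes> y [^] n \<in> ?H"
      have "inv (inv x \<otimes> y [^] n) \<otimes> x \<in> P" using H.convex_mult_pos(1)[of "inv (inv x \<otimes> y [^] n)" x] h xL by auto
      then have "inv (inv (x \<otimes> x) \<otimes> y [^] n) \<in> P" using xL by (simp add: inv_mult_group m_assoc)
      then show False using pos_inv[OF n] by blast
    qed
    ultimately have "inv x \<otimes> y [^] n \<in> P'" using xL by (simp add: P'_def)
    then have "inv\<^bsub>subquotient G ?L ?H\<^esub> X \<otimes>\<^bsub>subquotient G ?L ?H\<^esub> Y [^]\<^bsub>subquotient G ?L ?H\<^esub> n \<in> ?T"
      using x y xL S by simp
    then show ?thesis by blast
  qed
  have "archimedean_group (subquotient G ?L ?H) ?T"
    by (rule archimedean_group.intro[OF Q.is_group archimedean_group_axioms.intro[OF T arch]])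
  then have "comm_group (subquotient G ?L ?H)"
    by (intro Q.group_comm_groupI) (rule archimedean_group.commute)
  then show ?thesis
    using abelian_over_iff[OF H.convex_subgroup L.convex_subgroup] N by blast
qed

end

section \<open>Rational steps\<close>

definition torsion_free_over :: "('a, 'b) monoid_scheme \<Rightarrow> 'a set \<Rightarrow> 'a set \<Rightarrow> bool" where
  "torsion_free_over G H K \<longleftrightarrow> (\<forall>x\<in>K. \<forall>n::nat. 0 < n \<longrightarrow> x [^]\<^bsub>G\<^esub> n \<in> H \<longrightarrow> x \<in> H)"

text \<open>An elementwise form of the quotient conditions, see \<open>rational_step_iff\<close>.
  Rank one is stated as commensurability, with positive exponents and two alternatives for the sign,
  since cones control positive powers.\<close>

definition rational_step :: "('a, 'b) monoid_scheme \<Rightarrow> 'a set \<Rightarrow> 'a set \<Rightarrow> bool" where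
  "rational_step G H K \<longleftrightarrow>
     subgroup H G \<and> subgroup K G \<and> abelian_over G H K \<and> torsion_free_over G H K \<and> H \<noteq> K \<and>
     (\<forall>x\<in>K - H. \<forall>y\<in>K - H. \<exists>k>0. \<exists>l>0. x [^]\<^bsub>G\<^esub> (k::nat) \<otimes>\<^bsub>G\<^esub> y [^]\<^bsub>G\<^esub> (l::nat) \<in> H \<or>
        x [^]\<^bsub>G\<^esub> k \<otimes>\<^bsub>G\<^esub> inv\<^bsub>G\<^esub> (y [^]\<^bsub>G\<^esub> l) \<in> H)"

lemma int_pow_cases:
  "x [^]\<^bsub>G\<^esub> (c::int) = x [^]\<^bsub>G\<^esub> nat \<bar>c\<bar> \<or> x [^]\<^bsub>G\<^esub> c = inv\<^bsub>G\<^esub> (x [^]\<^bsub>G\<^esub> nat \<bar>c\<bar>)"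
  unfolding int_pow_def2[of G x c] by (cases "c < 0") simp_all

lemma (in group) torsion_free_int_pow:
  assumes "torsion_free G" "x \<in> carrier G" "x [^] (c::int) = \<one>" "c \<noteq> 0"
  shows "x = \<one>"
proof (rule ccontr)
  assume "x \<noteq> \<one>"
  then have n: "x [^] (n::nat) \<noteq> \<one>" if "0 < n" for n
    using assms(1,2) that by (auto simp: torsion_free_def)
  have "x [^] nat \<bar>c\<bar> = \<one>"
    using int_pow_cases[where G=G and x=x and c=c] assms(3)
      inv_eq_1_iff[OF nat_pow_closed[OF assms(2)], of "nat \<bar>c\<bar>"] by metis
  then show False using n[of "nat \<bar>c\<bar>"] assms(4) by simp
qed

context comm_group
begin

lemma finprod_pair:
  "x \<in> carrier G \<Longrightarrow> y \<in> carrier G \<Longrightarrow> x \<noteq> y \<Longrightarrow>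
    (\<Otimes>z\<in>{x, y}. z [^] (c z :: int)) = x [^] c x \<otimes> y [^] c y"
  by simp

text \<open>An integer relation between two nontrivial elements has both exponents nonzero by
  torsion-freeness; absolute values are taken and the signs are absorbed into the two alternatives.
  Conversely, commensurability makes any two distinct elements dependent.\<close>

lemma has_rank_1_iff:
  assumes tf: "torsion_free G"
  shows "has_rank G 1 \<longleftrightarrow> (\<exists>x\<in>carrier G. x \<noteq> \<one>) \<and>
    (\<forall>x\<in>carrier G - {\<one>}. \<forall>y\<in>carrier G - {\<one>}.
       \<exists>k>0. \<exists>l>0. x [^] (k::nat) = inv (y [^] (l::nat)) \<or> x [^] k = y [^] l)"
proof
  assume r: "has_rank G 1"
  then obtain S where S: "int_independent G S" "finite S" "card S = 1"
    and max: "\<And>S. int_independent G S \<Longrightarrow> card S \<le> 1"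
    unfolding has_rank_def by blast
  obtain s where s: "S = {s}" using S card_1_singletonE by blast
  have sc: "s \<in> carrier G" using S s by (auto simp: int_independent_def)
  have ind: "\<And>F c. finite F \<Longrightarrow> F \<subseteq> S \<Longrightarrow> (\<Otimes>x\<in>F. x [^] (c x :: int)) = \<one> \<Longrightarrow> \<forall>x\<in>F. c x = 0"
    using S(1) unfolding int_independent_def by blast
  have "s \<noteq> \<one>"
  proof
    assume "s = \<one>"
    then show False using ind[of "{s}" "\<lambda>_. 1"] s by simp
  qed
  moreover have "\<exists>k>0. \<exists>l>0. x [^] (k::nat) = inv (y [^] (l::nat)) \<or> x [^] k = y [^] l"
    if x: "x \<in> carrier G" "x \<noteq> \<one>" and y: "y \<in> carrier G" "y \<noteq> \<one>" for x y
  proof (cases "x = y")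
    case True
    then have "x [^] (1::nat) = y [^] (1::nat)" by simp
    then show ?thesis by (metis zero_less_one)
  next
    case False
    then have "card {x, y} = 2" by simp
    then have "\<not> int_independent G {x, y}" using max[of "{x, y}"] by auto
    then obtain F c z where F: "F \<subseteq> {x, y}" "(\<Otimes>x\<in>F. x [^] (c x :: int)) = \<one>" "z \<in> F" "c z \<noteq> 0"
      using x y unfolding int_independent_def by auto
    \<comment> \<open>The relation may be supported on a proper subset of {x, y}. Torsion-freeness
      excludes singletons, and z excludes the empty set.\<close>
    have "F \<noteq> {w}" if w: "w \<in> carrier G" "w \<noteq> \<one>" for w
    proof
      assume "F = {w}"
      then have "w [^] c w = \<one>" "c w \<noteq> 0" using F w by auto
      then show False using torsion_free_int_pow[OF tf] w by blast
    qed
    then have "F \<noteq> {x}" "F \<noteq> {y}" using x y by blast+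
    then have Fxy: "F = {x, y}" using F by blast
    then have prod: "x [^] c x \<otimes> y [^] c y = \<one>" using F finprod_pair[OF x(1) y(1) False] by simp
    have cx: "c x \<noteq> 0"
    proof
      assume "c x = 0"
      then have "y [^] c y = \<one>" "c y \<noteq> 0" using prod F Fxy x y by auto
      then show False using torsion_free_int_pow[OF tf] y by blast
    qed
    have cy: "c y \<noteq> 0"
    proof
      assume "c y = 0"
      then have "x [^] c x = \<one>" using prod x y by simp
      then show False using torsion_free_int_pow[OF tf] x cx by blast
    qed
    have eq: "x [^] c x = inv (y [^] c y)"
      using prod x y by (metis inv_equality int_pow_closed)
    let ?k = "nat \<bar>c x\<bar>" and ?l = "nat \<bar>c y\<bar>"
    have px: "x [^] c x = x [^] ?k \<or> x [^] c x = inv (x [^] ?k)"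
      by (rule int_pow_cases)
    have py: "y [^] c y = y [^] ?l \<or> y [^] c y = inv (y [^] ?l)"
      by (rule int_pow_cases)
    have "x [^] ?k = inv (y [^] ?l) \<or> x [^] ?k = y [^] ?l"
      using eq px py x y by (metis inv_inv nat_pow_closed)
    then show ?thesis using cx cy by (metis zero_less_nat_eq zero_less_abs_iff)
  qed
  ultimately show "(\<exists>x\<in>carrier G. x \<noteq> \<one>) \<and>
    (\<forall>x\<in>carrier G - {\<one>}. \<forall>y\<in>carrier G - {\<one>}.
       \<exists>k>0. \<exists>l>0. x [^] (k::nat) = inv (y [^] (l::nat)) \<or> x [^] k = y [^] l)"
    using sc by auto
next
  assume r: "(\<exists>x\<in>carrier G. x \<noteq> \<one>) \<and>
    (\<forall>x\<in>carrier G - {\<one>}. \<forall>y\<in>carrier G - {\<one>}.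
       \<exists>k>0. \<exists>l>0. x [^] (k::nat) = inv (y [^] (l::nat)) \<or> x [^] k = y [^] l)"
  then obtain s where s: "s \<in> carrier G" "s \<noteq> \<one>" by blast
  have "int_independent G {s}"
    unfolding int_independent_def
  proof (intro conjI allI impI ballI)
    fix F c x assume F: "finite F \<and> F \<subseteq> {s} \<and> (\<Otimes>x\<in>F. x [^] (c x :: int)) = \<one>" and "x \<in> F"
    then have "F = {s}" "x = s" by blast+
    then have "s [^] c s = \<one>" using F s by simp
    then show "c x = 0" using torsion_free_int_pow[OF tf s(1)] s \<open>x = s\<close> by blast
  qed (use s in simp)
  moreover have "finite S \<and> card S \<le> 1" if S: "int_independent G S" for S
  proof -
    have Sc: "S \<subseteq> carrier G" using S by (simp add: int_independent_def)
    have ind: "\<And>F c. finite F \<Longrightarrow> F \<subseteq> S \<Longrightarrow> (\<Otimes>x\<in>F. x [^] (c x :: int)) = \<one> \<Longrightarrow> \<forall>x\<in>F. c x = 0"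
      using S unfolding int_independent_def by blast
    have one: "\<one> \<notin> S" using ind[of "{\<one>}" "\<lambda>_. 1"] by auto
    have "x = y" if xy: "x \<in> S" "y \<in> S" for x y
    proof (rule ccontr)
      assume ne: "x \<noteq> y"
      have c: "x \<in> carrier G" "y \<in> carrier G" "x \<noteq> \<one>" "y \<noteq> \<one>" using xy Sc one by auto
      then obtain k l where kl: "0 < k" "0 < l" "x [^] (k::nat) = inv (y [^] (l::nat)) \<or> x [^] k = y [^] l"
        using r by blast
      obtain d :: int where d: "x [^] int k \<otimes> y [^] d = \<one>"
      proof (cases "x [^] k = y [^] l")
        case True
        then have "x [^] int k \<otimes> y [^] (- int l) = \<one>"
          using c by (simp add: int_pow_int int_pow_neg)
        then show ?thesis by (rule that)
      next
        case False
        then have "x [^] int k \<otimes> y [^] int l = \<one>" using kl(3) c by (simp add: int_pow_int)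
        then show ?thesis by (rule that)
      qed
      have "(\<Otimes>z\<in>{x, y}. z [^] ((\<lambda>z. if z = x then int k else d) z)) = \<one>"
        using finprod_pair[OF c(1,2) ne, of "\<lambda>z. if z = x then int k else d"] d ne by simp
      then have "\<forall>z\<in>{x, y}. (\<lambda>z. if z = x then int k else d) z = 0"
        using ind[of "{x, y}" "\<lambda>z. if z = x then int k else d"] xy by blast
      then show False using kl by simp
    qed
    then have "S = {} \<or> (\<exists>s. S = {s})" by blast
    then show ?thesis by auto
  qed
  ultimately show "has_rank G 1" unfolding has_rank_def by (metis card_1_singleton_iff finite.simps is_singletonI is_singleton_altdef)
qed

end

context group
begin

section \<open>Rational steps and the cones they carry\<close>

lemma torsion_free_subquotient:
  assumes K: "subgroup K G" and N: "H \<lhd> G\<lparr>carrier := K\<rparr>"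
  shows "torsion_free (subquotient G K H) \<longleftrightarrow> torsion_free_over G H K"
proof -
  have pc: "x [^] (n::nat) \<in> K" if "x \<in> K" for x n
    using that by (induction n) (auto simp: subgroup.one_closed[OF K] subgroup.m_closed[OF K])
  have "((H #> x) [^]\<^bsub>subquotient G K H\<^esub> (n::nat) = \<one>\<^bsub>subquotient G K H\<^esub>) \<longleftrightarrow> x [^] n \<in> H" if "x \<in> K" for x n
    using that pow_subquotient[OF K N] coset_eq_one_subquotient[OF K N pc] by simp
  then show ?thesis
    unfolding torsion_free_def torsion_free_over_def carrier_subquotient[OF K N]
    using coset_eq_one_subquotient[OF K N] by auto
qed

lemma rational_step_iff:
  assumes H: "subgroup H G" and K: "subgroup K G"
  shows "rational_step G H K \<longleftrightarrow>
    H \<lhd> G\<lparr>carrier := K\<rparr> \<and> comm_group (subquotient G K H) \<and> torsion_free (subquotient G K H) \<and>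
    has_rank (subquotient G K H) 1"
proof (cases "abelian_over G H K \<and> torsion_free_over G H K")
  case True
  then have N: "H \<lhd> G\<lparr>carrier := K\<rparr>" and comm: "comm_group (subquotient G K H)"
    and tf: "torsion_free (subquotient G K H)" and HK: "H \<subseteq> K"
    using abelian_over_iff[OF H K] torsion_free_subquotient[OF K] by (auto simp: abelian_over_def)
  interpret Q: comm_group "subquotient G K H" by (rule comm)
  have pc [simp]: "x [^] (n::nat) \<in> K" if "x \<in> K" for x n
    using that by (induction n) (auto simp: subgroup.one_closed[OF K] subgroup.m_closed[OF K])
  have ic [simp]: "inv x \<in> K" "x \<in> carrier G" if "x \<in> K" for x
    using that subgroup.m_inv_closed[OF K] subgroup.mem_carrier[OF K] by auto
  note S = carrier_subquotient[OF K N] inv_subquotient[OF K N]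
    coset_eq_one_subquotient[OF K N] pow_subquotient[OF K N]
  have e1: "(H #> x) [^]\<^bsub>subquotient G K H\<^esub> (k::nat) = inv\<^bsub>subquotient G K H\<^esub> ((H #> y) [^]\<^bsub>subquotient G K H\<^esub> (l::nat))
      \<longleftrightarrow> x [^] k \<otimes> y [^] l \<in> H" if "x \<in> K" "y \<in> K" for x y k l
    using that S(2,4) coset_eq_subquotient[OF K N, of "x [^] k" "inv (y [^] l)"] by simp
  have e2: "(H #> x) [^]\<^bsub>subquotient G K H\<^esub> (k::nat) = (H #> y) [^]\<^bsub>subquotient G K H\<^esub> (l::nat)
      \<longleftrightarrow> x [^] k \<otimes> inv (y [^] l) \<in> H" if "x \<in> K" "y \<in> K" for x y k l
    using that S(4) coset_eq_subquotient[OF K N, of "x [^] k" "y [^] l"] by simp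
  have ne: "(\<exists>X\<in>carrier (subquotient G K H). X \<noteq> \<one>\<^bsub>subquotient G K H\<^esub>) \<longleftrightarrow> H \<noteq> K"
    using S(3) HK by (auto simp: S(1))
  have car: "carrier (subquotient G K H) - {\<one>\<^bsub>subquotient G K H\<^esub>} = (\<lambda>x. H #> x) ` (K - H)"
    using S(3) by (auto simp: S(1))
  have "has_rank (subquotient G K H) 1 \<longleftrightarrow> H \<noteq> K \<and> (\<forall>x\<in>K - H. \<forall>y\<in>K - H. \<exists>k>0. \<exists>l>0.
      x [^] (k::nat) \<otimes> y [^] (l::nat) \<in> H \<or> x [^] k \<otimes> inv (y [^] l) \<in> H)"
    unfolding Q.has_rank_1_iff[OF tf] ne car by (simp add: e1 e2)
  then show ?thesis using True N comm tf H K by (simp add: rational_step_def)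
next
  case False
  then show ?thesis
    using abelian_over_iff[OF H K] torsion_free_subquotient[OF K] by (auto simp: rational_step_def)
qed

text \<open>The positive powers of the coset of g form a semigroup without the identity, which
  extends to a total cone of the quotient.\<close>

lemma exists_conrad_cone:
  assumes H: "subgroup H G" and K: "subgroup K G" and ab: "abelian_over G H K"
    and tf: "torsion_free_over G H K" and g: "g \<in> K" "g \<notin> H"
  shows "\<exists>P. conrad_cone G K P \<and> cone_residue G K P = H \<and> g \<in> P"
proof -
  have N: "H \<lhd> G\<lparr>carrier := K\<rparr>" and comm: "comm_group (subquotient G K H)"
    and tf: "torsion_free (subquotient G K H)"
    using abelian_over_iff[OF H K] torsion_free_subquotient[OF K] ab tf by auto
  interpret Q: comm_group "subquotient G K H" by (rule comm)
  let ?X = "H #> g"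
  have X: "?X \<in> carrier (subquotient G K H)" "?X \<noteq> \<one>\<^bsub>subquotient G K H\<^esub>"
    using g coset_eq_one_subquotient[OF K N] by (auto simp: carrier_subquotient[OF K N])
  let ?S = "semigroup_span (subquotient G K H) {?X}"
  have "\<one>\<^bsub>subquotient G K H\<^esub> \<notin> ?S"
    using Q.semigroup_span_singleton[OF X(1)] tf X unfolding torsion_free_def by metis
  then obtain T where T: "total_cone (subquotient G K H) T" "?S \<subseteq> T"
    using Q.total_cone_extension[OF tf Q.subsemigroup_span] X by blast
  then have "g \<in> {x \<in> K. H #> x \<in> T}" using g semigroup_span.incl[of ?X "{?X}"] by auto
  then show ?thesis using conrad_cone_pullback[OF H K ab T(1)] by blast
qed

text \<open>The form in which rank one is used from here on: nothing closed under roots fits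
  strictly between \<open>H\<close> and \<open>K\<close>. Some power of any x in \<open>K\<close>
  agrees, modulo \<open>H\<close> and up to inversion, with a power of y, so it lies in
  \<open>L\<close>.\<close>

lemma rational_step_subset:
  assumes st: "rational_step G H K" and L: "subgroup L G" "H \<subseteq> L"
    and iso: "\<And>x n. x \<in> K \<Longrightarrow> 0 < n \<Longrightarrow> x [^] (n::nat) \<in> L \<Longrightarrow> x \<in> L"
    and y: "y \<in> L" "y \<in> K" "y \<notin> H"
  shows "K \<subseteq> L"
proof
  fix x assume x: "x \<in> K"
  have K: "subgroup K G" using st by (simp add: rational_step_def)
  have c: "x \<in> carrier G" "y \<in> carrier G" using x y K by (auto intro: subgroup.mem_carrier)
  have pl: "y [^] (n::nat) \<in> L" for n
    using y by (induction n) (auto simp: subgroup.one_closed[OF L(1)] subgroup.m_closed[OF L(1)])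
  show "x \<in> L"
  proof (cases "x \<in> H")
    case False
    then obtain k l where kl: "0 < k" "0 < l"
      "x [^] (k::nat) \<otimes> y [^] (l::nat) \<in> H \<or> x [^] k \<otimes> inv (y [^] l) \<in> H"
      using st x y unfolding rational_step_def by blast
    have "x [^] k \<in> L" using kl(3)
    proof
      assume "x [^] k \<otimes> y [^] l \<in> H"
      then have "(x [^] k \<otimes> y [^] l) \<otimes> inv (y [^] l) \<in> L"
        using L pl by (meson subgroup.m_closed subgroup.m_inv_closed subsetD)
      then show ?thesis using c by (simp add: m_assoc)
    next
      assume "x [^] k \<otimes> inv (y [^] l) \<in> H"
      then have "(x [^] k \<otimes> inv (y [^] l)) \<otimes> y [^] l \<in> L"
        using L pl by (meson subgroup.m_closed subsetD)
      then show ?thesis using c by (simp add: m_assoc)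
    qed
    then show ?thesis using iso x kl by blast
  qed (use L in blast)
qed

text \<open>The sign of one element decides all others. For x and g both positive, x^k g^l cannot
  fall into the residue, so x^k g^-l does; a cone with g positive and x negative would make the
  inverse of this residue element positive.\<close>

lemma rational_step_cone_eq:
  assumes st: "rational_step G H K"
    and P: "conrad_cone G K P" "cone_residue G K P = H"
    and Q: "conrad_cone G K Q" "cone_residue G K Q = H" and g: "g \<in> P" "g \<in> Q"
  shows "P = Q"
proof -
  have K: "subgroup K G" using st by (simp add: rational_step_def)
  have sub: "P \<subseteq> Q" if P: "conrad_cone G K P" "cone_residue G K P = H"
    and Q: "conrad_cone G K Q" "cone_residue G K Q = H" and g: "g \<in> P" "g \<in> Q" for P Q
  proof
    interpret P: cone G K P by (rule coneI[OF K P(1)])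
    interpret Q: cone G K Q by (rule coneI[OF K Q(1)])
    fix x assume x: "x \<in> P"
    have xg: "x \<in> K - H" "g \<in> K - H" using x g P by (auto simp: cone_residue_def)
    have PH: "P \<inter> H = {}" using P(2) by (auto simp: cone_residue_def)
    have QH: "z \<in> Q \<Longrightarrow> z \<notin> H" for z using Q(2) by (auto simp: cone_residue_def)
    obtain k l where kl: "0 < k" "0 < l"
      "x [^] (k::nat) \<otimes> g [^] (l::nat) \<in> H \<or> x [^] k \<otimes> inv (g [^] l) \<in> H"
      using st xg unfolding rational_step_def by blast
    have "x [^] k \<otimes> g [^] l \<in> P" using P.pos_mult P.pos_pow x g kl by blast
    then have h: "x [^] k \<otimes> inv (g [^] l) \<in> H" using PH kl by blast
    show "x \<in> Q"
    proof (rule ccontr)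
      assume "x \<notin> Q"
      then have "inv x \<in> Q" using xg Q(2) by (auto simp: cone_residue_def)
      then have "g [^] l \<otimes> inv x [^] k \<in> Q" using Q.pos_mult Q.pos_pow g kl by blast
      then have "inv (x [^] k \<otimes> inv (g [^] l)) \<in> Q" using xg by (simp add: inv_mult_group nat_pow_inv)
      moreover have "inv (x [^] k \<otimes> inv (g [^] l)) \<in> H"
        using h subgroup.m_inv_closed Q.subgroup_residue Q(2) by metis
      ultimately show False using QH by blast
    qed
  qed
  show ?thesis using sub[OF P Q g] sub[OF Q P g(2,1)] by blast
qed

text \<open>The two cones are told apart by the sign of a fixed element outside \<open>H\<close>;
  both signs occur by \<open>exists_conrad_cone\<close>.\<close>

lemma card_rational_step_cones:
  assumes st: "rational_step G H K"
  shows "card {P. conrad_cone G K P \<and> cone_residue G K P = H} = 2"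
proof -
  have H: "subgroup H G" and K: "subgroup K G" and ab: "abelian_over G H K"
    and tf: "torsion_free_over G H K" and "H \<noteq> K"
    using st by (auto simp: rational_step_def)
  then obtain g where g: "g \<in> K" "g \<notin> H" by (auto simp: abelian_over_def)
  have gc: "g \<in> carrier G" using g K by (auto intro: subgroup.mem_carrier)
  have ig: "inv g \<in> K" "inv g \<notin> H"
    using g subgroup.m_inv_closed[OF K] subgroup.m_inv_closed[OF H, of "inv g"] gc by auto
  obtain P where P: "conrad_cone G K P" "cone_residue G K P = H" "g \<in> P"
    using exists_conrad_cone[OF H K ab tf g] by blast
  obtain Q where Q: "conrad_cone G K Q" "cone_residue G K Q = H" "inv g \<in> Q"
    using exists_conrad_cone[OF H K ab tf ig] by blast
  have "{P. conrad_cone G K P \<and> cone_residue G K P = H} = {P, Q}"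
  proof
    show "{P. conrad_cone G K P \<and> cone_residue G K P = H} \<subseteq> {P, Q}"
    proof
      fix R assume "R \<in> {P. conrad_cone G K P \<and> cone_residue G K P = H}"
      then have R: "conrad_cone G K R" "cone_residue G K R = H" by auto
      then have "g \<in> R \<or> inv g \<in> R" using g by (auto simp: cone_residue_def)
      then show "R \<in> {P, Q}"
        using rational_step_cone_eq[OF st R P(1,2)] rational_step_cone_eq[OF st R Q(1,2)] P(3) Q(3)
        by blast
    qed
  qed (use P Q in blast)
  moreover have "P \<noteq> Q" using P Q by (auto simp: conrad_cone_def)
  ultimately show ?thesis by simp
qed

end

section \<open>Series without abelian jumps\<close>

text \<open>Series are listed from the top here, which suits induction.\<close>

fun rational_chain :: "('a, 'b) monoid_scheme \<Rightarrow> 'a set list \<Rightarrow> bool" where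
  "rational_chain G [] \<longleftrightarrow> False"
| "rational_chain G [H] \<longleftrightarrow> H = {\<one>\<^bsub>G\<^esub>}"
| "rational_chain G (K # H # Hs) \<longleftrightarrow> rational_step G H K \<and> rational_chain G (H # Hs)"

fun jump_free :: "('a, 'b) monoid_scheme \<Rightarrow> 'a set list \<Rightarrow> bool" where
  "jump_free G (L # K # H # Hs) \<longleftrightarrow> \<not> abelian_over G H L \<and> jump_free G (K # H # Hs)"
| "jump_free G _ \<longleftrightarrow> True"

lemma rational_chain_iff_nth:
  "rational_chain G Hs \<longleftrightarrow> Hs \<noteq> [] \<and> last Hs = {\<one>\<^bsub>G\<^esub>} \<and>
    (\<forall>i. Suc i < length Hs \<longrightarrow> rational_step G (Hs ! Suc i) (Hs ! i))"
proof (induction G Hs rule: rational_chain.induct)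
  case (3 G K H Hs)
  have "(\<forall>i. Suc i < length (K # H # Hs) \<longrightarrow> rational_step G ((K # H # Hs) ! Suc i) ((K # H # Hs) ! i)) \<longleftrightarrow>
      rational_step G H K \<and> (\<forall>i. Suc i < length (H # Hs) \<longrightarrow> rational_step G ((H # Hs) ! Suc i) ((H # Hs) ! i))"
    (is "(\<forall>i. ?P i) \<longleftrightarrow> ?A \<and> (\<forall>i. ?Q i)")
  proof (intro iffI conjI allI)
    show "?P i" if "?A \<and> (\<forall>i. ?Q i)" for i using that by (cases i) auto
    show ?A if "\<forall>i. ?P i" using spec[OF that, of 0] by simp
    show "?Q i" if "\<forall>i. ?P i" for i using spec[OF that, of "Suc i"] by simp
  qed
  then show ?case using 3 by auto
qed auto

lemma jump_free_iff_nth: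
  "jump_free G Hs \<longleftrightarrow> (\<forall>i. i + 2 < length Hs \<longrightarrow> \<not> abelian_over G (Hs ! (i + 2)) (Hs ! i))"
proof (induction G Hs rule: jump_free.induct)
  case (1 G L K H Hs)
  have "(\<forall>i. i + 2 < length (L # K # H # Hs) \<longrightarrow> \<not> abelian_over G ((L # K # H # Hs) ! (i + 2)) ((L # K # H # Hs) ! i)) \<longleftrightarrow>
      \<not> abelian_over G H L \<and>
      (\<forall>i. i + 2 < length (K # H # Hs) \<longrightarrow> \<not> abelian_over G ((K # H # Hs) ! (i + 2)) ((K # H # Hs) ! i))"
    (is "(\<forall>i. ?P i) \<longleftrightarrow> ?A \<and> (\<forall>i. ?Q i)")
  proof (intro iffI conjI allI)
    show "?P i" if "?A \<and> (\<forall>i. ?Q i)" for i using that by (cases i) auto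
    show ?A if "\<forall>i. ?P i" using spec[OF that, of 0] by simp
    show "?Q i" if "\<forall>i. ?P i" for i using spec[OF that, of "Suc i"] by simp
  qed
  then show ?case using 1 by auto
qed auto

context group
begin

lemma rational_chain_subgroup: "rational_chain G Hs \<Longrightarrow> H \<in> set Hs \<Longrightarrow> subgroup H G"
  by (induction Hs rule: induct_list012) (auto simp: rational_step_def triv_subgroup)

text \<open>The induction hypothesis is applied to the restriction of the cone to \<open>H\<close>;
  convexity of \<open>M\<close> there is what forces the core of a to meet \<open>H\<close> exactly
  in \<open>M\<close>. If the cone has no element in \<open>H\<close>, the residue contains
  \<open>H\<close>, and rank one leaves it no room to be larger without being all of
  \<open>K\<close>.\<close>

lemma top_step_convex:
  assumes "rational_chain G (K # H # Hs)" "jump_free G (K # H # Hs)" "conrad_cone G K P" "P \<noteq> {}"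
  shows "cone_convex G K P H"
  using assms
proof (induction Hs arbitrary: K H P)
  case Nil
  then have st: "rational_step G H K" and H: "H = {\<one>}" by auto
  then have K: "subgroup K G" by (simp add: rational_step_def)
  interpret cone G K P by (rule coneI[OF K Nil.prems(3)])
  interpret R: convex_cone G K P R by (rule convexI[OF convex_residue])
  have "\<not> K \<subseteq> R" using Nil.prems(4) pos_closed in_residue by blast
  then have "R \<subseteq> H"
    using rational_step_subset[OF st subgroup_residue] R.convex_root R.convex_closed H by blast
  then have "R = H" using H R.convex_closed(4) by blast
  then show ?case using convex_residue by simp
next
  case (Cons M Hs)
  then have st: "rational_step G H K" and st': "rational_step G M H"
    and nj: "\<not> abelian_over G M K" and chain: "rational_chain G (H # M # Hs)" "jump_free G (H # M # Hs)"
    by auto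
  then have K: "subgroup K G" and H: "subgroup H G" and HK: "H \<subseteq> K" "H \<noteq> K"
    and M: "subgroup M G" and MH: "M \<subseteq> H" "M \<noteq> H"
    by (auto simp: rational_step_def abelian_over_def)
  interpret cone G K P by (rule coneI[OF K Cons.prems(3)])
  interpret R: convex_cone G K P R by (rule convexI[OF convex_residue])
  show ?case
  proof (cases "P \<inter> H = {}")
    case True
    then have HR: "H \<subseteq> R"
      using HK(1) subgroup.m_inv_closed[OF H] unfolding subset_iff in_residue by blast
    have "\<not> K \<subseteq> R" using Cons.prems(4) pos_closed in_residue by blast
    then have "R \<subseteq> H"
      using rational_step_subset[OF st subgroup_residue HR] R.convex_root R.convex_closed by blast
    then show ?thesis using convex_residue HR by simp
  next
    case False
    note PH = cone_restrict(1)[OF HK(1) H]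
    have cM: "cone_convex G H (P \<inter> H) M" by (rule Cons.IH[OF chain PH False])
    interpret PH: cone G H "P \<inter> H" by (rule coneI[OF H PH])
    interpret PM: convex_cone G H "P \<inter> H" M by (rule PH.convexI[OF cM])
    obtain b where "b \<in> H" "b \<notin> M" using MH by blast
    then obtain a where a: "a \<in> P" "a \<in> H" "a \<notin> M" using PM.convex_cases[of b] by blast
    interpret C: convex_cone G K P "conv_core a" by (rule convexI[OF convex_core[OF a(1)]])
    interpret L: convex_cone G K P "conv_hull a" by (rule convexI[OF convex_hull[OF a(1)]])
    \<comment> \<open>All powers of m stay in \<open>M\<close>, hence below a, so the hull of m is a
      convex subgroup omitting a.\<close>
    have pos: "m \<in> conv_core a" if m: "m \<in> M" "m \<in> P" for m
    proof -
      have "a \<notin> conv_hull m"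
      proof
        assume "a \<in> conv_hull m"
        then obtain k where k: "lt a (m [^] (k::nat))" by (rule hullE)
        have "m [^] k \<in> M" using m by simp
        then have "inv (m [^] k) \<otimes> a \<in> P" using PM.convex_mult_pos(1)[of "inv (m [^] k)" a] a by auto
        then show False using lt_asym[OF k] a m by simp
      qed
      then show ?thesis using core_greatest[OF convex_hull[OF m(2)]] in_hull[OF m(2)] by blast
    qed
    have MC: "M \<subseteq> conv_core a"
    proof
      fix m assume m: "m \<in> M"
      then have mK: "m \<in> K" using MH HK by blast
      consider "m \<in> R" | "m \<in> P" | "inv m \<in> P" using mK by (auto simp: in_residue)
      then show "m \<in> conv_core a"
      proof cases
        case 1
        then show ?thesis using convex_core[OF a(1)] by (auto simp: cone_convex_def)
      next
        case 3
        then have "inv m \<in> conv_core a" using pos[of "inv m"] m by simp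
        then have "inv (inv m) \<in> conv_core a" by (rule C.convex_closed(3))
        then show ?thesis using mK by simp
      qed (use pos m in blast)
    qed
    have rootH: "x \<in> conv_core a" if "x \<in> H" "0 < n" "x [^] (n::nat) \<in> conv_core a" for x n
      using C.convex_root that HK by blast
    \<comment> \<open>Convex subgroups are closed under roots. By rank one of \<open>H\<close> over
      \<open>M\<close>, a core meeting \<open>H\<close> in more than \<open>M\<close> would contain
      all of \<open>H\<close>, in particular a.\<close>
    have CH: "conv_core a \<inter> H \<subseteq> M"
    proof (rule ccontr)
      assume "\<not> ?thesis"
      then obtain x where "x \<in> conv_core a" "x \<in> H" "x \<notin> M" by blast
      then have "H \<subseteq> conv_core a"
        using rational_step_subset[OF st' C.convex_subgroup MC, of x] rootH by blast
      then show False using a not_in_core by blast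
    qed
    have rootL: "x \<in> conv_hull a" if "x \<in> K" "0 < n" "x [^] (n::nat) \<in> conv_hull a" for x n
      using L.convex_root that by blast
    have "M \<subseteq> conv_hull a" using MC core_subset_hull[OF a(1)] by blast
    then have HL: "H \<subseteq> conv_hull a"
      using rational_step_subset[OF st' L.convex_subgroup, of a] in_hull[OF a(1)] rootL HK a by blast
    have "conv_hull a \<subseteq> H"
    proof (rule ccontr)
      assume "\<not> ?thesis"
      then obtain y where "y \<in> conv_hull a" "y \<notin> H" by blast
      moreover from this have "y \<in> K" using hull_closed by blast
      ultimately have KL: "K \<subseteq> conv_hull a"
        using rational_step_subset[OF st L.convex_subgroup HL, of y] rootL by blast
      \<comment> \<open>A commutator of \<open>K\<close> lies in the core because the jump is
        abelian, and in \<open>H\<close> because the top step is; the two meet inside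
        \<open>M\<close>.\<close>
      have "inv x \<otimes> (inv y \<otimes> (x \<otimes> y)) \<in> M" if xy: "x \<in> K" "y \<in> K" for x y
      proof -
        have "inv x \<otimes> (inv y \<otimes> (x \<otimes> y)) \<in> conv_core a"
          using jump_abelian[OF a(1)] KL xy unfolding abelian_over_def by blast
        moreover have "inv x \<otimes> (inv y \<otimes> (x \<otimes> y)) \<in> H"
          using st xy unfolding rational_step_def abelian_over_def by blast
        ultimately show ?thesis using CH by blast
      qed
      then have "abelian_over G M K" using MH HK unfolding abelian_over_def by blast
      then show False using nj by blast
    qed
    then show ?thesis using convex_hull[OF a(1)] HL by simp
  qed
qed

text \<open>The competing series \<open>Ks\<close> may have abelian jumps. Its second term is
  realised as the residue of a cone on the common top, and every convex subgroup contains the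
  residue.\<close>

lemma rational_chain_unique:
  assumes "rational_chain G Hs" "jump_free G Hs" "rational_chain G Ks" "hd Ks = hd Hs"
  shows "Ks = Hs"
  using assms
proof (induction Hs arbitrary: Ks rule: induct_list012[case_names Nil Single Cons])
  case (Single H)
  then have top: "hd Ks = {\<one>}" by simp
  consider "Ks = []" | H' where "Ks = [H']" | K H' Ks' where "Ks = K # H' # Ks'"
    by (metis list.exhaust)
  then show ?case
  proof cases
    case 3
    then have "rational_step G H' {\<one>}" using Single top by simp
    then have "H' \<subseteq> {\<one>}" "H' \<noteq> {\<one>}" "\<one> \<in> H'"
      by (auto simp: rational_step_def abelian_over_def subgroup.one_closed)
    then show ?thesis by blast
  qed (use Single in auto)
next
  case (Cons K H Hs)
  have st: "rational_step G H K" and chain: "rational_chain G (H # Hs)" and jf: "jump_free G (H # Hs)"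
    using Cons.prems by (auto elim: jump_free.elims)
  have K: "subgroup K G" and H: "subgroup H G" and HK: "H \<subseteq> K" "H \<noteq> K"
    and tf: "torsion_free_over G H K"
    using st by (auto simp: rational_step_def abelian_over_def)
  consider "Ks = []" | H' where "Ks = [H']" | K' H' Ks' where "Ks = K' # H' # Ks'"
    by (metis list.exhaust)
  then show ?case
  proof cases
    case (2 H')
    then have "K = {\<one>}" using Cons.prems by auto
    then show ?thesis using HK subgroup.one_closed[OF H] by blast
  next
    case (3 K' H' Ks')
    then have Ks: "Ks = K # H' # Ks'" using Cons.prems(4) by simp
    then have st': "rational_step G H' K" and chain': "rational_chain G (H' # Ks')"
      using Cons.prems(3) by auto
    have "{P. conrad_cone G K P \<and> cone_residue G K P = H'} \<noteq> {}"
      using card_rational_step_cones[OF st'] by force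
    then obtain P where P: "conrad_cone G K P" "cone_residue G K P = H'" by blast
    have "H' \<noteq> K" using st' by (simp add: rational_step_def)
    then have "P \<noteq> {}" using P by (auto simp: cone_residue_def)
    then have "cone_convex G K P H"
      using top_step_convex[OF Cons.prems(1,2) P(1)] by blast
    then have sub: "H' \<subseteq> H" using P(2) by (simp add: cone_convex_def)
    \<comment> \<open>Torsion-freeness of \<open>K\<close> over \<open>H\<close> says that
      \<open>H\<close> is closed under roots in \<open>K\<close>, so by rank one of \<open>K\<close>
      over \<open>H'\<close> it cannot lie strictly between them.\<close>
    have "H \<subseteq> H'"
    proof (rule ccontr)
      assume "\<not> ?thesis"
      then obtain y where "y \<in> H" "y \<notin> H'" by blast
      then have "K \<subseteq> H"
        using rational_step_subset[OF st' H sub] tf HK unfolding torsion_free_over_def by blast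
      then show False using HK by blast
    qed
    then have "H' # Ks' = H # Hs" using sub Cons.IH(2)[OF chain jf chain'] by simp
    then show ?thesis using Ks by simp
  qed (use Cons.prems in auto)
qed auto

section \<open>Counting cones along a series\<close>

lemma conrad_cone_empty: "conrad_cone G K {}"
  by (simp add: conrad_cone_def)

lemma conrad_cones_trivial: "{P. conrad_cone G {\<one>} P} = {{}}"
proof -
  have "P = {}" if "conrad_cone G {\<one>} P" for P
  proof -
    interpret cone G "{\<one>}" P by (rule coneI[OF triv_subgroup that])
    show ?thesis using one_not_pos pos_closed by blast
  qed
  then show ?thesis using conrad_cone_empty by blast
qed

text \<open>By \<open>top_step_convex\<close> a nonempty cone splits into its part outside
  \<open>H\<close> and its part inside; \<open>cone_lex\<close> reverses this and preserves the
  residue of the lower part, so orders correspond to orders.\<close>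

lemma
  assumes chain: "rational_chain G (K # H # Hs)" and jf: "jump_free G (K # H # Hs)"
  defines "T \<equiv> {A. conrad_cone G K A \<and> cone_residue G K A = H}"
  shows conrad_cones_top: "{P. conrad_cone G K P} =
      insert {} ((\<lambda>(A, B). A \<union> B) ` (T \<times> {B. conrad_cone G H B}))"
    and order_cones_top: "{P. conrad_cone G K P \<and> cone_residue G K P = {\<one>}} =
      (\<lambda>(A, B). A \<union> B) ` (T \<times> {B. conrad_cone G H B \<and> cone_residue G H B = {\<one>}})"
    and inj_on_cones_top: "inj_on (\<lambda>(A, B). A \<union> B) (T \<times> {B. conrad_cone G H B})"
    and empty_not_cones_top: "{} \<notin> (\<lambda>(A, B). A \<union> B) ` (T \<times> {B. conrad_cone G H B})"
proof -
  have st: "rational_step G H K" using chain by simp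
  then have K: "subgroup K G" and H: "subgroup H G" and HK: "H \<subseteq> K" "H \<noteq> K"
    by (auto simp: rational_step_def abelian_over_def)
  have lex: "conrad_cone G K (A \<union> B)" "cone_residue G K (A \<union> B) = cone_residue G H B"
      "(A \<union> B) \<inter> H = B" "(A \<union> B) - H = A" "A \<noteq> {}"
    if "A \<in> T" "conrad_cone G H B" for A B
  proof -
    have A: "conrad_cone G K A" "cone_residue G K A = H" using that by (auto simp: T_def)
    show "conrad_cone G K (A \<union> B)" "cone_residue G K (A \<union> B) = cone_residue G H B"
      "(A \<union> B) \<inter> H = B" "(A \<union> B) - H = A"
      using cone_lex[OF K H A that(2)] by auto
    show "A \<noteq> {}" using A(2) HK by (auto simp: cone_residue_def)
  qed
  have split: "\<exists>A B. A \<in> T \<and> conrad_cone G H B \<and> P = A \<union> B \<and> cone_residue G H B = cone_residue G K P"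
    if P: "conrad_cone G K P" "P \<noteq> {}" for P
  proof -
    interpret cone G K P by (rule coneI[OF K P(1)])
    interpret H: convex_cone G K P H by (rule convexI[OF top_step_convex[OF chain jf P]])
    have RH: "R \<inter> H = R" using H.L by (auto simp: cone_convex_def)
    have "P - H \<in> T" using H.cone_coarsen by (simp add: T_def)
    moreover have "conrad_cone G H (P \<inter> H)" "cone_residue G H (P \<inter> H) = R"
      using cone_restrict[OF HK(1) H] RH by auto
    ultimately show ?thesis by blast
  qed
  show "{P. conrad_cone G K P} = insert {} ((\<lambda>(A, B). A \<union> B) ` (T \<times> {B. conrad_cone G H B}))"
    using lex(1) split conrad_cone_empty by fastforce
  have "P \<noteq> {}" if "cone_residue G K P = {\<one>}" for P
  proof
    assume "P = {}"
    then have "K = {\<one>}" using that by (auto simp: cone_residue_def)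
    then show False using HK subgroup.one_closed[OF H] by blast
  qed
  then show "{P. conrad_cone G K P \<and> cone_residue G K P = {\<one>}} =
      (\<lambda>(A, B). A \<union> B) ` (T \<times> {B. conrad_cone G H B \<and> cone_residue G H B = {\<one>}})"
    using lex(1,2) split by fastforce
  show "inj_on (\<lambda>(A, B). A \<union> B) (T \<times> {B. conrad_cone G H B})"
  proof (rule inj_onI, clarify)
    fix A B A' B'
    assume m: "A \<in> T" "conrad_cone G H B" "A' \<in> T" "conrad_cone G H B'" and eq: "A \<union> B = A' \<union> B'"
    show "A = A' \<and> B = B'" using lex(3,4)[OF m(1,2)] lex(3,4)[OF m(3,4)] eq by simp
  qed
  show "{} \<notin> (\<lambda>(A, B). A \<union> B) ` (T \<times> {B. conrad_cone G H B})"
    using lex(5) by fastforce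
qed

text \<open>Each step turns c cones into 1 + 2 c and doubles the number of orders, starting from one
  of each on the trivial group. The list has one term more than the length of the series, and adding
  1 to the cardinality avoids truncated subtraction.\<close>

lemma card_conrad_cones:
  assumes "rational_chain G Hs" "jump_free G Hs"
  shows "finite {P. conrad_cone G (hd Hs) P} \<and> card {P. conrad_cone G (hd Hs) P} + 1 = 2 ^ length Hs \<and>
    card {P. conrad_cone G (hd Hs) P \<and> cone_residue G (hd Hs) P = {\<one>}} = 2 ^ (length Hs - 1)"
  using assms
proof (induction Hs rule: induct_list012[case_names Nil Single Cons])
  case (Single H)
  then have H: "H = {\<one>}" by simp
  have "{P. conrad_cone G {\<one>} P \<and> cone_residue G {\<one>} P = {\<one>}} = {{}}"
    using conrad_cones_trivial by (auto simp: cone_residue_def)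
  then show ?case using conrad_cones_trivial H by simp
next
  case (Cons K H Hs)
  have st: "rational_step G H K" and chain: "rational_chain G (H # Hs)" and jf: "jump_free G (H # Hs)"
    using Cons.prems by (auto elim: jump_free.elims)
  let ?T = "{A. conrad_cone G K A \<and> cone_residue G K A = H}"
  let ?B = "{B. conrad_cone G H B}"
  let ?B1 = "{B. conrad_cone G H B \<and> cone_residue G H B = {\<one>}}"
  have IH: "finite ?B" "card ?B + 1 = 2 ^ length (H # Hs)" "card ?B1 = 2 ^ length Hs"
    using Cons.IH(2)[OF chain jf] by auto
  have T: "card ?T = 2" "finite ?T" using card_rational_step_cones[OF st] by (auto intro: card_ge_0_finite)
  note top = conrad_cones_top[OF Cons.prems] order_cones_top[OF Cons.prems] inj_on_cones_top[OF Cons.prems]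
    empty_not_cones_top[OF Cons.prems]
  have fin: "finite {P. conrad_cone G K P}" unfolding top(1) using T(2) IH(1) by simp
  have "card {P. conrad_cone G K P} = Suc (card ?T * card ?B)"
    unfolding top(1) using T(2) IH(1) top(3,4) by (simp add: card_image card_cartesian_product)
  then have c: "card {P. conrad_cone G K P} + 1 = 2 ^ length (K # H # Hs)" using T(1) IH(2) by simp
  have "inj_on (\<lambda>(A, B). A \<union> B) (?T \<times> ?B1)" by (rule inj_on_subset[OF top(3)]) auto
  then have "card {P. conrad_cone G K P \<and> cone_residue G K P = {\<one>}} = card ?T * card ?B1"
    unfolding top(2) by (simp add: card_image card_cartesian_product)
  then show ?case using fin c T(1) IH(3) by simp
qed auto

end

section \<open>Isolated orders\<close>

lemma (in comm_group) powers_comparable: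
  assumes P: "total_cone G P" and f: "f \<in> carrier G"
    and pow: "\<forall>x\<in>P. \<exists>k>0. \<exists>l>0. x [^] (k::nat) = f [^] (l::nat)"
    and x: "x \<in> carrier G" "x \<noteq> \<one>" and y: "y \<in> carrier G" "y \<noteq> \<one>"
  shows "\<exists>k>0. \<exists>l>0. x [^] (k::nat) = inv (y [^] (l::nat)) \<or> x [^] k = y [^] l"
proof -
  have sign: "\<exists>k>0. \<exists>l>0. x [^] (k::nat) = f [^] (l::nat) \<or> x [^] k = inv (f [^] l)"
    if x: "x \<in> carrier G" "x \<noteq> \<one>" for x
  proof -
    have "x \<in> P \<or> inv x \<in> P" using P x by (auto simp: total_cone_def)
    then show ?thesis
    proof
      assume "inv x \<in> P"
      then obtain k l where kl: "0 < k" "0 < l" "inv x [^] (k::nat) = f [^] (l::nat)" using pow by blast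
      have "inv x [^] k = inv (x [^] k)" by (rule nat_pow_inv[OF x(1)])
      then have "x [^] k = inv (f [^] l)" using kl(3) x(1) by (metis inv_inv nat_pow_closed)
      then show ?thesis using kl by blast
    qed (use pow in blast)
  qed
  obtain k l where kl: "0 < k" "0 < l" "x [^] (k::nat) = f [^] (l::nat) \<or> x [^] k = inv (f [^] l)"
    using sign[OF x] by blast
  obtain m n where mn: "0 < m" "0 < n" "y [^] (m::nat) = f [^] (n::nat) \<or> y [^] m = inv (f [^] n)"
    using sign[OF y] by blast
  \<comment> \<open>A common power: x^k is f^l up to inversion and y^m is f^n up to inversion, so
    raise the first to n and the second to l.\<close>
  let ?z = "f [^] (l * n)"
  have inv_pow: "(inv a) [^] (j::nat) = inv (a [^] j)" if "a \<in> carrier G" for a j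
    by (rule nat_pow_inv[OF that])
  have X: "x [^] (k * n) = ?z \<or> x [^] (k * n) = inv ?z"
    using kl(3) x f inv_pow[of "f [^] l" n] by (metis nat_pow_closed nat_pow_pow)
  have Y: "y [^] (m * l) = ?z \<or> y [^] (m * l) = inv ?z"
    using mn(3) y f inv_pow[of "f [^] n" l] by (metis mult.commute nat_pow_closed nat_pow_pow)
  have "x [^] (k * n) = inv (y [^] (m * l)) \<or> x [^] (k * n) = y [^] (m * l)"
    using X Y f by (metis inv_inv nat_pow_closed)
  moreover have "0 < k * n" "0 < m * l" using kl mn by simp_all
  ultimately show ?thesis by blast
qed

text \<open>Cones of the quotient pull back to \<open>K\<close>, so uniqueness descends to the
  quotient, where \<open>isolated_total_cone\<close> provides one element of \<open>F\<close>
  commensurable with everything. Its mere existence is later used to bound the number of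
  jumps.\<close>

lemma (in group) isolated_conrad_cone:
  assumes H: "subgroup H G" and K: "subgroup K G" and ab: "abelian_over G H K"
    and tf: "torsion_free_over G H K"
    and P: "conrad_cone G K P" "cone_residue G K P = H" "P \<noteq> {}" and F: "F \<subseteq> P" "finite F"
    and uniq: "\<And>Q. conrad_cone G K Q \<Longrightarrow> cone_residue G K Q = H \<Longrightarrow> F \<subseteq> Q \<Longrightarrow> Q = P"
  shows "rational_step G H K" "F \<noteq> {}"
proof -
  have N: "H \<lhd> G\<lparr>carrier := K\<rparr>" and comm: "comm_group (subquotient G K H)"
    and tf: "torsion_free (subquotient G K H)"
    using abelian_over_iff[OF H K] torsion_free_subquotient[OF K] ab tf by auto
  interpret Q: comm_group "subquotient G K H" by (rule comm)
  interpret P: cone G K P by (rule coneI[OF K P(1)])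
  let ?c = "\<lambda>x. H #> x"
  have T: "total_cone (subquotient G K H) (?c ` P)"
    using total_cone_subquotient[OF K P(1)] N by (simp only: P(2))
  have T1: "\<one>\<^bsub>subquotient G K H\<^esub> \<notin> ?c ` P" and TC: "?c ` P \<subseteq> carrier (subquotient G K H)"
    using T by (auto simp: total_cone_def)
  have "T' = ?c ` P" if T': "total_cone (subquotient G K H) T'" and FT: "?c ` F \<subseteq> T'" for T'
  proof -
    have "{x \<in> K. ?c x \<in> T'} = P"
      using FT F by (intro uniq conrad_cone_pullback[OF H K ab T']) auto
    moreover have "T' \<subseteq> ?c ` K" using T' by (simp add: total_cone_def carrier_subquotient[OF K N])
    ultimately show ?thesis by auto
  qed
  then obtain f where f: "f \<in> F" and pow: "\<forall>X\<in>?c ` P. \<exists>k>0. \<exists>l>0.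
      X [^]\<^bsub>subquotient G K H\<^esub> (k::nat) = ?c f [^]\<^bsub>subquotient G K H\<^esub> (l::nat)"
    using Q.isolated_total_cone[OF tf T, of "?c ` F"] F P(3) by blast
  then show "F \<noteq> {}" by blast
  have "?c f \<in> carrier (subquotient G K H)" "?c f \<noteq> \<one>\<^bsub>subquotient G K H\<^esub>" using f F TC T1 by blast+
  then have "has_rank (subquotient G K H) 1"
    unfolding Q.has_rank_1_iff[OF tf] using Q.powers_comparable[OF T _ pow] by blast
  then show "rational_step G H K" unfolding rational_step_iff[OF H K] using N comm tf by blast
qed

text \<open>The algebraic content of isolation. Sign conditions on negative elements are expressed
  through their inverses, so \<open>F\<close> can be taken inside the cone.\<close>

locale isolated_order = cone G "carrier G" P for G (structure) and P +
  fixes F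
  assumes residue: "cone_residue G (carrier G) P = {\<one>}" and F: "F \<subseteq> P" "finite F"
    and unique: "\<lbrakk>conrad_cone G (carrier G) Q; cone_residue G (carrier G) Q = {\<one>}; F \<subseteq> Q\<rbrakk> \<Longrightarrow> Q = P"
begin

abbreviation convex where "convex \<equiv> cone_convex G (carrier G) P"

text \<open>Replacing the order on the abelian quotient \<open>L/H\<close> by another one yields an order of \<open>G\<close> again,
  so that the order on \<open>L/H\<close> is isolated as well.\<close>

lemma isolated_step:
  assumes H: "convex H" and L: "convex L" and HL: "H \<subseteq> L" "H \<noteq> L" and ab: "abelian_over G H L"
  shows "rational_step G H L" "F \<inter> L - H \<noteq> {}"
proof -
  interpret H: convex_cone G "carrier G" P H by (rule convexI[OF H])
  interpret L: convex_cone G "carrier G" P L by (rule convexI[OF L])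
  have sub: "H \<subseteq> carrier G" "L \<subseteq> carrier G" by auto
  note cL = cone_restrict[OF sub(2) L.convex_subgroup]
  note cH = cone_restrict[OF sub(1) H.convex_subgroup]
  interpret PL: cone G L "P \<inter> L" by (rule coneI[OF L.convex_subgroup cL(1)])
  interpret HL: convex_cone G L "P \<inter> L" H by (rule PL.convexI[OF convex_restrict[OF L H HL(1)]])
  let ?P = "P \<inter> L - H" and ?F = "F \<inter> (P \<inter> L - H)"
  have tf: "torsion_free_over G H L" unfolding torsion_free_over_def using HL.convex_root by blast
  have ne: "?P \<noteq> {}" using HL HL.convex_cases by blast
  have uniq: "Q = ?P" if Q: "conrad_cone G L Q" "cone_residue G L Q = H" "?F \<subseteq> Q" for Q
  proof -
    note lex1 = cone_lex[OF L.convex_subgroup H.convex_subgroup Q(1,2) cH(1)]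
    note lex2 = cone_lex[OF K L.convex_subgroup L.cone_coarsen lex1(1)]
    \<comment> \<open>A lexicographic order in three layers: the old one above \<open>L\<close>, the
      new one between \<open>H\<close> and \<open>L\<close>, the old one inside
      \<open>H\<close>.\<close>
    let ?Q = "(P - L) \<union> (Q \<union> P \<inter> H)"
    have "cone_residue G (carrier G) ?Q = {\<one>}"
      using lex2(2) lex1(2) cH(2) residue H.convex_closed(4) by auto
    moreover have "F \<subseteq> ?Q" using F(1) Q(3) by blast
    ultimately have "?Q = P" using unique lex2(1) by blast
    then have "P \<inter> L = Q \<union> P \<inter> H" using lex2(4) by simp
    then show ?thesis using lex1(5) by simp
  qed
  have FP: "?F \<subseteq> ?P" "finite ?F" using F(2) by simp_all
  note iso = isolated_conrad_cone[OF H.convex_subgroup L.convex_subgroup ab tf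
      HL.cone_coarsen ne FP uniq]
  show "rational_step G H L" by (rule iso(1))
  show "F \<inter> L - H \<noteq> {}" using iso(2) by blast
qed

lemma isolated_jump:
  assumes a: "a \<in> P"
  shows "rational_step G (conv_core a) (conv_hull a)" "F \<inter> conv_hull a - conv_core a \<noteq> {}"
proof -
  have "conv_core a \<noteq> conv_hull a" using in_hull[OF a] not_in_core[of a] by blast
  note step = isolated_step[OF convex_core[OF a] convex_hull[OF a] core_subset_hull[OF a] this
      jump_abelian[OF a]]
  show "rational_step G (conv_core a) (conv_hull a)" by (rule step(1))
  show "F \<inter> conv_hull a - conv_core a \<noteq> {}" by (rule step(2))
qed

text \<open>The jump of each positive x in \<open>L\<close> contains some f in \<open>F\<close>, and
  this f has x in its hull. So \<open>L\<close> is covered by finitely many hulls, which form a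
  chain, and the largest is \<open>L\<close>. Thus there are only finitely many convex
  subgroups.\<close>

lemma convex_is_hull:
  assumes L: "convex L" "L \<noteq> {\<one>}"
  shows "\<exists>f\<in>F. L = conv_hull f"
proof -
  interpret L: convex_cone G "carrier G" P L by (rule convexI[OF L(1)])
  have hull_in: "\<exists>f\<in>F \<inter> L. x \<in> conv_hull f" if x: "x \<in> L" "x \<in> P" for x
  proof -
    obtain f where f: "f \<in> F" "f \<in> conv_hull x" "f \<notin> conv_core x" using isolated_jump(2)[OF x(2)] by blast
    then have "f \<in> P" using F by blast
    have "x \<in> conv_hull f"
      using core_greatest[OF convex_hull[OF \<open>f \<in> P\<close>], of x] in_hull[OF \<open>f \<in> P\<close>] f by blast
    moreover have "f \<in> L" using hull_least[OF L(1) x(1)] f by blast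
    ultimately show ?thesis using f by blast
  qed
  have abs: "x = \<one> \<or> x \<in> P \<or> inv x \<in> P" if "x \<in> L" for x
    using residue that in_residue[of x] by auto
  obtain p where p: "p \<in> L" "p \<in> P"
    using L(2) abs L.convex_closed(3,4) by blast
  then have ne: "conv_hull ` (F \<inter> L) \<noteq> {}" using hull_in by blast
  have fin: "finite (conv_hull ` (F \<inter> L))" using F by blast
  obtain M where M: "M \<in> conv_hull ` (F \<inter> L)" "\<forall>N\<in>conv_hull ` (F \<inter> L). M \<subseteq> N \<longrightarrow> M = N"
    using finite_has_maximal[OF fin ne] by (rule bexE)
  then obtain f where f: "f \<in> F" "f \<in> L" "M = conv_hull f" by blast
  have fP: "f \<in> P" using f F by blast
  interpret M: convex_cone G "carrier G" P "conv_hull f" by (rule convexI[OF convex_hull[OF fP]])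
  have pos: "x \<in> conv_hull f" if x: "x \<in> L" "x \<in> P" for x
  proof -
    obtain g where g: "g \<in> F" "g \<in> L" "x \<in> conv_hull g" using hull_in[OF x] by blast
    have "conv_hull g \<subseteq> conv_hull f \<or> conv_hull f \<subseteq> conv_hull g"
      using convex_chain convex_hull g F fP by blast
    then have "conv_hull g \<subseteq> conv_hull f" using bspec[OF M(2), of "conv_hull g"] f g by blast
    then show ?thesis using g by blast
  qed
  have "L \<subseteq> conv_hull f"
  proof
    fix x assume x: "x \<in> L"
    then consider "x = \<one>" | "x \<in> P" | "inv x \<in> P" using abs by blast
    then show "x \<in> conv_hull f"
    proof cases
      case 3
      then have "inv x \<in> conv_hull f" using pos x by simp
      then have "inv (inv x) \<in> conv_hull f" by (rule M.convex_closed(3))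
      then show ?thesis using x by simp
    qed (use pos x in auto)
  qed
  then have "L = conv_hull f" using hull_least[OF L(1) f(2)] by blast
  then show ?thesis using f by blast
qed

text \<open>The descent goes from the hull of f to the core of f; the measure drops since f itself
  is lost.\<close>

lemma convex_chain_exists:
  "convex L \<Longrightarrow> \<exists>Hs. rational_chain G Hs \<and> hd Hs = L \<and> (\<forall>H\<in>set Hs. convex H)"
proof (induction "card (F \<inter> L)" arbitrary: L rule: less_induct)
  case less
  show ?case
  proof (cases "L = {\<one>}")
    case True
    then show ?thesis using less.prems by (intro exI[of _ "[L]"]) simp
  next
    case False
    then obtain f where f: "f \<in> F" "L = conv_hull f" using convex_is_hull less.prems by blast
    have fP: "f \<in> P" using f F by blast
    have "F \<inter> conv_core f \<subset> F \<inter> L"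
      using core_subset_hull[OF fP] not_in_core[of f] in_hull[OF fP] f by blast
    then have "card (F \<inter> conv_core f) < card (F \<inter> L)" using F(2) by (intro psubset_card_mono) auto
    then obtain Hs where Hs: "rational_chain G Hs" "hd Hs = conv_core f" "\<forall>H\<in>set Hs. convex H"
      using less.hyps convex_core[OF fP] by blast
    obtain Hs' where "Hs = conv_core f # Hs'" using Hs(1,2) by (cases Hs) auto
    then have "rational_chain G (L # Hs)" using Hs(1) isolated_jump(1)[OF fP] f by simp
    then show ?thesis using Hs(3) less.prems by (intro exI[of _ "L # Hs"]) simp
  qed
qed

text \<open>\<open>isolated_step\<close> covers every abelian quotient of convex subgroups, not only
  that of a single jump. An abelian jump would thus have rank one, with no room for the root-closed
  middle term.\<close>

lemma convex_chain_jump_free: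
  "rational_chain G Hs \<Longrightarrow> \<forall>H\<in>set Hs. convex H \<Longrightarrow> jump_free G Hs"
proof (induction Hs rule: induct_list012[case_names Nil Single Cons])
  case (Cons L K Hs)
  show ?case
  proof (cases Hs)
    case (Cons H Hs')
    have st: "rational_step G K L" "rational_step G H K" and conv: "convex L" "convex K" "convex H"
      using Cons.prems Cons by auto
    interpret KC: convex_cone G "carrier G" P K by (rule convexI[OF conv(2)])
    have sub: "H \<subseteq> K" "H \<noteq> K" "K \<subseteq> L" "K \<noteq> L"
      using st by (auto simp: rational_step_def abelian_over_def)
    then obtain y where y: "y \<in> K" "y \<notin> H" by blast
    have Lc: "L \<subseteq> carrier G" using conv(1) by (simp add: cone_convex_def)
    have "\<not> abelian_over G H L"
    proof
      assume "abelian_over G H L"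
      then have "rational_step G H L" using isolated_step(1)[OF conv(3,1)] sub by blast
      then have "L \<subseteq> K"
        using rational_step_subset[OF _ KC.convex_subgroup sub(1), of L y] KC.convex_root y sub Lc
        by blast
      then show False using sub by blast
    qed
    then show ?thesis using Cons.IH(2) Cons.prems Cons by simp
  qed simp
qed auto

lemma isolated_order_chain: "\<exists>Hs. rational_chain G Hs \<and> jump_free G Hs \<and> hd Hs = carrier G"
proof -
  have "convex (carrier G)" using K by (auto simp: cone_convex_def cone_residue_def)
  then show ?thesis using convex_chain_exists convex_chain_jump_free by blast
qed

end

section \<open>Left-preorders and their cones\<close>

text \<open>Here x precedes y if y is not strictly below x; stated by negation, the residue need not
  be mentioned.\<close>

definition cone_rel :: "('a, 'b) monoid_scheme \<Rightarrow> 'a set \<Rightarrow> 'a rel" where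
  "cone_rel G P = {(x, y) \<in> carrier G \<times> carrier G. inv\<^bsub>G\<^esub> y \<otimes>\<^bsub>G\<^esub> x \<notin> P}"

context group
begin

context
  fixes r
  assumes r: "left_preorder G r"
begin

lemma left_preorder_closed: "(x, y) \<in> r \<Longrightarrow> x \<in> carrier G \<and> y \<in> carrier G"
  using r unfolding left_preorder_def preorder_on_def by blast

lemma left_preorder_trans: "(x, y) \<in> r \<Longrightarrow> (y, z) \<in> r \<Longrightarrow> (x, z) \<in> r"
  using r unfolding left_preorder_def preorder_on_def trans_on_def using left_preorder_closed by blast

lemma left_preorder_mult: "(x, y) \<in> r \<Longrightarrow> a \<in> carrier G \<Longrightarrow> (a \<otimes> x, a \<otimes> y) \<in> r"
  using r left_preorder_closed[of x y] unfolding left_preorder_def by simp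

lemma left_preorder_total: "x \<in> carrier G \<Longrightarrow> y \<in> carrier G \<Longrightarrow> (x, y) \<in> r \<or> (y, x) \<in> r"
  using r unfolding left_preorder_def preorder_on_def refl_on_def total_on_def by metis

lemma positive_cone_iff: "x \<in> positive_cone G r \<longleftrightarrow> x \<in> carrier G \<and> (x, \<one>) \<notin> r"
  using left_preorder_total[of x \<one>] by (auto simp: positive_cone_def strictly_below_def)

lemma left_preorder_iff_cone:
  assumes "x \<in> carrier G" "y \<in> carrier G"
  shows "(x, y) \<in> r \<longleftrightarrow> inv y \<otimes> x \<notin> positive_cone G r"
proof -
  have "(x, y) \<in> r \<longleftrightarrow> (\<one>, inv x \<otimes> y) \<in> r" by (rule left_preorder_iff_one[OF r assms])
  also have "\<dots> \<longleftrightarrow> (inv y \<otimes> x, \<one>) \<in> r"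
    using left_preorder_iff_one[OF r, of "inv y \<otimes> x" \<one>] assms by (simp add: inv_mult_group)
  finally show ?thesis using assms by (simp add: positive_cone_iff)
qed

lemma strictly_below_iff_cone:
  assumes "x \<in> carrier G" "y \<in> carrier G"
  shows "strictly_below r x y \<longleftrightarrow> inv x \<otimes> y \<in> positive_cone G r"
  using left_preorder_total[OF assms] left_preorder_iff_cone assms by (auto simp: strictly_below_def)

lemma cone_rel_positive_cone: "cone_rel G (positive_cone G r) = r"
proof (rule Set.set_eqI)
  fix p :: "'a \<times> 'a"
  obtain x y where p: "p = (x, y)" by fastforce
  show "p \<in> cone_rel G (positive_cone G r) \<longleftrightarrow> p \<in> r"
    using left_preorder_iff_cone[of x y] left_preorder_closed[of x y] by (auto simp: cone_rel_def p)
qed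

lemma positive_cone_nonempty: "positive_cone G r \<noteq> {}"
proof
  assume e: "positive_cone G r = {}"
  have "r = cone_rel G {}" using cone_rel_positive_cone e by simp
  then have "r = carrier G \<times> carrier G" by (auto simp: cone_rel_def)
  then show False using r by (simp add: left_preorder_def)
qed

lemma cone_residue_positive_cone: "cone_residue G (carrier G) (positive_cone G r) = residue G r"
proof -
  have "(inv x, \<one>) \<in> r \<longleftrightarrow> (\<one>, x) \<in> r" if "x \<in> carrier G" for x
    using left_preorder_iff_one[OF r, of "inv x" \<one>] that by simp
  then show ?thesis by (auto simp: cone_residue_def residue_def positive_cone_iff)
qed

lemma conrad_cone_positive_cone:
  assumes "Conradian G r"
  shows "conrad_cone G (carrier G) (positive_cone G r)"
proof -
  let ?P = "positive_cone G r"
  have closed: "x \<in> carrier G" if "x \<in> ?P" for x using that by (simp add: positive_cone_iff)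
  have inv: "inv x \<notin> ?P" if "x \<in> ?P" for x
  proof
    assume "inv x \<in> ?P"
    then have "(\<one>, x) \<notin> r"
      using left_preorder_iff_one[OF r, of "inv x" \<one>] closed[OF that] by (simp add: positive_cone_iff)
    then show False using that left_preorder_total[of x \<one>] by (auto simp: positive_cone_iff)
  qed
  have split: "x \<in> ?P \<or> y \<in> ?P" if "x \<in> carrier G" "y \<in> carrier G" "x \<otimes> y \<in> ?P" for x y
  proof (rule ccontr)
    assume "\<not> ?thesis"
    then have n: "(x, \<one>) \<in> r" "(y, \<one>) \<in> r" using that by (auto simp: positive_cone_iff)
    have "(x \<otimes> y, x \<otimes> \<one>) \<in> r" using left_preorder_mult[OF n(2)] that by simp
    then have "(x \<otimes> y, \<one>) \<in> r" using left_preorder_trans n(1) that by simp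
    then show False using that(3) by (simp add: positive_cone_iff)
  qed
  have conr: "\<exists>n::nat. inv x \<otimes> (y \<otimes> x [^] n) \<in> ?P" if x: "x \<in> ?P" and y: "y \<in> ?P" for x y
  proof -
    have "strictly_below r \<one> x" "strictly_below r \<one> y" using x y by (auto simp: positive_cone_def)
    then obtain n where "strictly_below r x (y \<otimes> x [^] (n::nat))"
      using assms closed[OF x] closed[OF y] unfolding Conradian_def by blast
    then show ?thesis
      using strictly_below_iff_cone[of x "y \<otimes> x [^] n"] closed[OF x] closed[OF y] by auto
  qed
  show ?thesis unfolding conrad_cone_def using closed inv split conr by blast
qed

end

lemma
  assumes P: "conrad_cone G (carrier G) P" and ne: "P \<noteq> {}"
  shows cone_rel_in_CO: "cone_rel G P \<in> CO G"
    and positive_cone_cone_rel: "positive_cone G (cone_rel G P) = P"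
proof -
  interpret cone G "carrier G" P by (rule coneI[OF subgroup_self P])
  have "preorder_on (carrier G) (cone_rel G P)"
  proof -
    have "(x, z) \<in> cone_rel G P" if "(x, y) \<in> cone_rel G P" "(y, z) \<in> cone_rel G P" for x y z
      using that lt_neg_trans[of z x y] by (auto simp: cone_rel_def)
    then have "trans (cone_rel G P)" by (auto intro: transI)
    then show ?thesis
      unfolding preorder_on_def by (auto simp: cone_rel_def refl_on_def)
  qed
  moreover have "total_on (carrier G) (cone_rel G P)"
    unfolding total_on_def cone_rel_def using lt_asym by auto
  moreover have "(a \<otimes> x, a \<otimes> y) \<in> cone_rel G P"
    if "a \<in> carrier G" "x \<in> carrier G" "y \<in> carrier G" "(x, y) \<in> cone_rel G P" for a x y
    using that lt_left[of a y x] by (auto simp: cone_rel_def)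
  moreover have "cone_rel G P \<noteq> carrier G \<times> carrier G"
  proof
    assume e: "cone_rel G P = carrier G \<times> carrier G"
    obtain p where p: "p \<in> P" using ne by blast
    then have "(p, \<one>) \<in> cone_rel G P" using e by simp
    then show False using p by (simp add: cone_rel_def)
  qed
  ultimately have lp: "left_preorder G (cone_rel G P)" by (simp add: left_preorder_def)
  have mem: "x \<in> positive_cone G (cone_rel G P) \<longleftrightarrow> x \<in> P" for x
    unfolding positive_cone_iff[OF lp] using pos_closed[of x] by (auto simp: cone_rel_def)
  then show eq: "positive_cone G (cone_rel G P) = P" by blast
  have "Conradian G (cone_rel G P)"
    unfolding Conradian_def
  proof (intro ballI impI)
    fix x y assume xy: "x \<in> carrier G" "y \<in> carrier G"
      and "strictly_below (cone_rel G P) \<one> x \<and> strictly_below (cone_rel G P) \<one> y"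
    then have "x \<in> P" "y \<in> P" using mem by (auto simp: positive_cone_def)
    then obtain n where "inv x \<otimes> (y \<otimes> x [^] (n::nat)) \<in> P" using conrad[of x y] by blast
    then show "\<exists>n::nat. strictly_below (cone_rel G P) x (y \<otimes> x [^] n)"
      using strictly_below_iff_cone[OF lp] xy eq by (metis m_closed nat_pow_closed)
  qed
  then show "cone_rel G P \<in> CO G" using lp by (simp add: CO_def)
qed

text \<open>The empty cone is removed because it belongs to the full relation, which is not a
  left-preorder.\<close>

lemma bij_betw_CO: "bij_betw (positive_cone G) (CO G) ({P. conrad_cone G (carrier G) P} - {{}})"
proof (rule bij_betw_byWitness[where f' = "cone_rel G"])
  show "\<forall>r\<in>CO G. cone_rel G (positive_cone G r) = r"
    using cone_rel_positive_cone by (auto simp: CO_def)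
  show "\<forall>P\<in>{P. conrad_cone G (carrier G) P} - {{}}. positive_cone G (cone_rel G P) = P"
    using positive_cone_cone_rel by blast
  show "positive_cone G ` CO G \<subseteq> {P. conrad_cone G (carrier G) P} - {{}}"
    using conrad_cone_positive_cone positive_cone_nonempty by (auto simp: CO_def)
  show "cone_rel G ` ({P. conrad_cone G (carrier G) P} - {{}}) \<subseteq> CO G"
    using cone_rel_in_CO by blast
qed

text \<open>On the trivial group the empty cone would have residue \<open>{\<one>}\<close> without
  coming from a left-preorder; nontriviality of the group excludes this.\<close>

lemma positive_cone_CO_rel:
  assumes "carrier G \<noteq> {\<one>}"
  shows "positive_cone G ` CO_rel G {\<one>} =
    {P. conrad_cone G (carrier G) P \<and> cone_residue G (carrier G) P = {\<one>}}"
proof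
  show "positive_cone G ` CO_rel G {\<one>} \<subseteq>
      {P. conrad_cone G (carrier G) P \<and> cone_residue G (carrier G) P = {\<one>}}"
    using conrad_cone_positive_cone cone_residue_positive_cone by (auto simp: CO_rel_def CO_def)
  show "{P. conrad_cone G (carrier G) P \<and> cone_residue G (carrier G) P = {\<one>}} \<subseteq>
      positive_cone G ` CO_rel G {\<one>}"
  proof
    fix P assume "P \<in> {P. conrad_cone G (carrier G) P \<and> cone_residue G (carrier G) P = {\<one>}}"
    then have P: "conrad_cone G (carrier G) P" "cone_residue G (carrier G) P = {\<one>}" by auto
    have ne: "P \<noteq> {}" using P(2) assms by (auto simp: cone_residue_def)
    have co: "cone_rel G P \<in> CO G" by (rule cone_rel_in_CO[OF P(1) ne])
    then have "left_preorder G (cone_rel G P)" by (simp add: CO_def)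
    then have "residue G (cone_rel G P) = {\<one>}"
      using cone_residue_positive_cone P(2) positive_cone_cone_rel[OF P(1) ne] by metis
    then have "cone_rel G P \<in> CO_rel G {\<one>}" using co by (simp add: CO_rel_def)
    then show "P \<in> positive_cone G ` CO_rel G {\<one>}"
      using positive_cone_cone_rel[OF P(1) ne] by force
  qed
qed

section \<open>Isolated points\<close>

lemma sign_map_in: "sign_map G r \<in> carrier G \<rightarrow>\<^sub>E {- 1, 0, 1}"
  by (auto simp: sign_map_def)

text \<open>A basic open set of the product restricts finitely many coordinates, and as the factors
  are discrete the restrictions may be shrunk to prescribed signs.\<close>

lemma isolated_point_iff:
  "isolated_point (sign_topology G S) r \<longleftrightarrow> r \<in> S \<and>
    (\<exists>F. finite F \<and> F \<subseteq> carrier G \<and>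
      (\<forall>s\<in>S. (\<forall>x\<in>F. sign_map G s x = sign_map G r x) \<longrightarrow> s = r))"
proof -
  let ?D = "discrete_topology {- 1, 0, 1 :: int}"
  let ?T = "product_topology (\<lambda>_. ?D) (carrier G)"
  have top: "r \<in> topspace (sign_topology G S) \<longleftrightarrow> r \<in> S"
    using sign_map_in by (simp add: sign_topology_def topspace_pullback_topology)
  have op: "openin (sign_topology G S) {r} \<longleftrightarrow> (\<exists>U. openin ?T U \<and> {r} = sign_map G -` U \<inter> S)"
    by (simp add: sign_topology_def openin_pullback_topology)
  have "(\<exists>U. openin ?T U \<and> {r} = sign_map G -` U \<inter> S) \<longleftrightarrow>
    (\<exists>F. finite F \<and> F \<subseteq> carrier G \<and> (\<forall>s\<in>S. (\<forall>x\<in>F. sign_map G s x = sign_map G r x) \<longrightarrow> s = r))"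
    if rS: "r \<in> S"
  proof
    assume "\<exists>U. openin ?T U \<and> {r} = sign_map G -` U \<inter> S"
    then obtain U where U: "openin ?T U" "{r} = sign_map G -` U \<inter> S" by blast
    then have "sign_map G r \<in> U" by blast
    then obtain V where V: "finite {x \<in> carrier G. V x \<noteq> topspace ?D}"
      "sign_map G r \<in> Pi\<^sub>E (carrier G) V" "Pi\<^sub>E (carrier G) V \<subseteq> U"
      using U(1) unfolding openin_product_topology_alt by blast
    let ?F = "{x \<in> carrier G. V x \<noteq> topspace ?D}"
    have "s = r" if s: "s \<in> S" "\<forall>x\<in>?F. sign_map G s x = sign_map G r x" for s
    proof -
      have "sign_map G s x \<in> V x" if x: "x \<in> carrier G" for x
      proof (cases "x \<in> ?F")
        case True
        show ?thesis unfolding bspec[OF s(2) True] by (rule PiE_mem[OF V(2) x])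
      next
        case False
        then have "V x = {- 1, 0, 1}" using x by simp
        then show ?thesis using PiE_mem[OF sign_map_in x, of s] by simp
      qed
      then have "sign_map G s \<in> Pi\<^sub>E (carrier G) V" by (auto simp: sign_map_def)
      then show ?thesis using V(3) U(2) s(1) by blast
    qed
    then show "\<exists>F. finite F \<and> F \<subseteq> carrier G \<and> (\<forall>s\<in>S. (\<forall>x\<in>F. sign_map G s x = sign_map G r x) \<longrightarrow> s = r)"
      using V(1) by (intro exI[of _ ?F]) blast
  next
    assume "\<exists>F. finite F \<and> F \<subseteq> carrier G \<and> (\<forall>s\<in>S. (\<forall>x\<in>F. sign_map G s x = sign_map G r x) \<longrightarrow> s = r)"
    then obtain F where F: "finite F" "F \<subseteq> carrier G"
      "\<forall>s\<in>S. (\<forall>x\<in>F. sign_map G s x = sign_map G r x) \<longrightarrow> s = r" by (elim exE conjE)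
    define V where "V x = (if x \<in> F then {sign_map G r x} else {- 1, 0, 1})" for x
    have Vsub: "V x \<subseteq> {- 1, 0, 1}" if "x \<in> carrier G" for x
      using sign_map_in[of r] that by (auto simp: V_def dest: PiE_mem)
    have "openin ?T (Pi\<^sub>E (carrier G) V)"
    proof -
      have "finite {x \<in> carrier G. V x \<noteq> topspace ?D}"
        by (rule finite_subset[OF _ F(1)]) (auto simp: V_def)
      then show ?thesis unfolding openin_PiE_gen using Vsub by auto
    qed
    moreover have "{r} = sign_map G -` Pi\<^sub>E (carrier G) V \<inter> S"
    proof
      have "sign_map G r \<in> Pi\<^sub>E (carrier G) V"
        using sign_map_in[of r] by (auto simp: V_def PiE_iff)
      then show "{r} \<subseteq> sign_map G -` Pi\<^sub>E (carrier G) V \<inter> S" using rS by blast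
      show "sign_map G -` Pi\<^sub>E (carrier G) V \<inter> S \<subseteq> {r}"
      proof
        fix s assume s: "s \<in> sign_map G -` Pi\<^sub>E (carrier G) V \<inter> S"
        have "sign_map G s x = sign_map G r x" if "x \<in> F" for x
        proof -
          have "sign_map G s x \<in> V x" using s that F(2) by (auto dest: PiE_mem)
          then show ?thesis using that by (simp add: V_def)
        qed
        then show "s \<in> {r}" using bspec[OF F(3), of s] s by simp
      qed
    qed
    ultimately show "\<exists>U. openin ?T U \<and> {r} = sign_map G -` U \<inter> S" by blast
  qed
  then show ?thesis unfolding isolated_point_def top op by blast
qed

lemma isolated_point_subset:
  assumes "isolated_point (sign_topology G S) r" "S' \<subseteq> S" "r \<in> S'"
  shows "isolated_point (sign_topology G S') r"
proof -
  obtain F where F: "finite F" "F \<subseteq> carrier G"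
    "\<forall>s\<in>S. (\<forall>x\<in>F. sign_map G s x = sign_map G r x) \<longrightarrow> s = r"
    using assms(1) unfolding isolated_point_iff by (elim conjE exE)
  have "\<forall>s\<in>S'. (\<forall>x\<in>F. sign_map G s x = sign_map G r x) \<longrightarrow> s = r"
    using F(3) assms(2) by (meson subsetD)
  then show ?thesis unfolding isolated_point_iff using F(1,2) assms(3) by (intro conjI exI)
qed

text \<open>One coordinate separating r from each of the finitely many other points suffices, as
  sign maps are injective.\<close>

lemma finite_imp_isolated_point:
  assumes S: "finite S" "S \<subseteq> {r. left_preorder G r}" and r: "r \<in> S"
  shows "isolated_point (sign_topology G S) r"
proof -
  have "\<exists>x\<in>carrier G. sign_map G s x \<noteq> sign_map G r x" if s: "s \<in> S" "s \<noteq> r" for s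
  proof -
    have "sign_map G s \<noteq> sign_map G r" using inj_on_sign_map s r S(2) by (meson inj_onD subsetD)
    then show ?thesis using sign_map_in[of s] sign_map_in[of r] by (metis PiE_ext)
  qed
  then obtain w where w: "\<And>s. s \<in> S \<Longrightarrow> s \<noteq> r \<Longrightarrow> w s \<in> carrier G \<and> sign_map G s (w s) \<noteq> sign_map G r (w s)"
    by metis
  have "finite (w ` (S - {r}))" "w ` (S - {r}) \<subseteq> carrier G" using S w by auto
  moreover have "s = r" if "s \<in> S" "\<forall>x\<in>w ` (S - {r}). sign_map G s x = sign_map G r x" for s
    using that w[of s] by blast
  ultimately show ?thesis
    unfolding isolated_point_iff using r by (intro conjI exI[of _ "w ` (S - {r})"]) auto
qed

lemma isolated_order_if_isolated_point:
  assumes "carrier G \<noteq> {\<one>}" and r: "isolated_point (sign_topology G (CO_rel G {\<one>})) r"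
  shows "\<exists>F. isolated_order G (positive_cone G r) F"
proof -
  let ?P = "positive_cone G r"
  obtain F where F: "finite F" "F \<subseteq> carrier G" "r \<in> CO_rel G {\<one>}"
    "\<forall>s\<in>CO_rel G {\<one>}. (\<forall>x\<in>F. sign_map G s x = sign_map G r x) \<longrightarrow> s = r"
    using r unfolding isolated_point_iff by (elim exE conjE)
  have lp: "left_preorder G r" and P: "conrad_cone G (carrier G) ?P"
    and res: "cone_residue G (carrier G) ?P = {\<one>}"
    using F(3) conrad_cone_positive_cone cone_residue_positive_cone by (auto simp: CO_rel_def CO_def)
  interpret P: cone G "carrier G" ?P by (rule coneI[OF subgroup_self P])
  \<comment> \<open>Each nontrivial x in \<open>F\<close> is replaced by whichever of x and its
    inverse is positive; the sign of \<open>\<one>\<close> is 0 for every cone.\<close>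
  let ?F = "(F \<union> m_inv G ` F) \<inter> ?P"
  have uniq: "Q = ?P" if Q: "conrad_cone G (carrier G) Q" "cone_residue G (carrier G) Q = {\<one>}" "?F \<subseteq> Q" for Q
  proof -
    interpret Q: cone G "carrier G" Q by (rule coneI[OF subgroup_self Q(1)])
    have "Q \<in> positive_cone G ` CO_rel G {\<one>}"
      unfolding positive_cone_CO_rel[OF assms(1)] using Q(1,2) by simp
    then obtain s where s: "Q = positive_cone G s" "s \<in> CO_rel G {\<one>}" by (rule imageE)
    have "sign_map G s x = sign_map G r x" if x: "x \<in> F" for x
    proof -
      have xc: "x \<in> carrier G" using x F(2) by blast
      consider "x \<in> ?P" | "inv x \<in> ?P" | "x = \<one>"
        using P.in_residue[of x] xc unfolding res by blast
      then show ?thesis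
      proof cases
        case 1
        then have "x \<in> Q" using Q(3) x by blast
        then show ?thesis using 1 xc s(1) by (simp add: sign_map_def)
      next
        case 2
        then have "inv x \<in> Q" using Q(3) x by blast
        moreover have "x \<notin> ?P" using P.pos_inv[of x] 2 by blast
        moreover have "x \<notin> Q" using Q.pos_inv[of x] \<open>inv x \<in> Q\<close> by blast
        ultimately show ?thesis using 2 xc s(1) by (simp add: sign_map_def)
      next
        case 3
        then show ?thesis using s(1) P.one_not_pos Q.one_not_pos by (simp add: sign_map_def)
      qed
    qed
    then have "s = r" using bspec[OF F(4) s(2)] by simp
    then show ?thesis using s(1) by simp
  qed
  have "isolated_order_axioms G ?P ?F"
    by (rule isolated_order_axioms.intro[OF res _ _ uniq]) (use F(1) in auto)
  then show ?thesis using isolated_order.intro[OF P.cone_axioms] by blast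
qed

section \<open>Rational series\<close>

lemma rational_series_iff: "rational_series G Hs \<longleftrightarrow> rational_chain G (rev Hs) \<and> last Hs = carrier G"
proof -
  \<comment> \<open>Reversal exchanges the step starting at index i with the one starting at length
    - 2 - i.\<close>
  have steps: "(\<forall>i. Suc i < length Hs \<longrightarrow> rational_step G (rev Hs ! Suc i) (rev Hs ! i)) \<longleftrightarrow>
      (\<forall>i. Suc i < length Hs \<longrightarrow> rational_step G (Hs ! i) (Hs ! Suc i))" (is "?A \<longleftrightarrow> ?B")
  proof
    assume a: ?A
    show ?B
    proof (intro allI impI)
      fix i assume i: "Suc i < length Hs"
      then show "rational_step G (Hs ! i) (Hs ! Suc i)"
        using a[rule_format, of "length Hs - Suc (Suc i)"] by (simp add: rev_nth Suc_diff_Suc)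
    qed
  next
    assume b: ?B
    show ?A
    proof (intro allI impI)
      fix i assume i: "Suc i < length Hs"
      then show "rational_step G (rev Hs ! Suc i) (rev Hs ! i)"
        using b[rule_format, of "length Hs - Suc (Suc i)"] by (simp add: rev_nth Suc_diff_Suc)
    qed
  qed
  show ?thesis
  proof
    assume rs: "rational_series G Hs"
    have "rational_step G (Hs ! i) (Hs ! Suc i)" if "Suc i < length Hs" for i
      using rs that rational_step_iff[of "Hs ! i" "Hs ! Suc i"] by (simp add: rational_series_def)
    then show "rational_chain G (rev Hs) \<and> last Hs = carrier G"
      using rs steps unfolding rational_chain_iff_nth by (simp add: rational_series_def last_rev)
  next
    assume c: "rational_chain G (rev Hs) \<and> last Hs = carrier G"
    then have sub: "\<forall>H\<in>set Hs. subgroup H G" using rational_chain_subgroup[of "rev Hs"] by simp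
    have st: "rational_step G (Hs ! i) (Hs ! Suc i)" if "Suc i < length Hs" for i
      using c steps that unfolding rational_chain_iff_nth by simp
    have "Hs ! i \<lhd> G\<lparr>carrier := Hs ! Suc i\<rparr> \<and> comm_group (subquotient G (Hs ! Suc i) (Hs ! i)) \<and>
        torsion_free (subquotient G (Hs ! Suc i) (Hs ! i)) \<and> has_rank (subquotient G (Hs ! Suc i) (Hs ! i)) 1"
      if "Suc i < length Hs" for i
      using st[OF that] sub that rational_step_iff[of "Hs ! i" "Hs ! Suc i"] by simp
    then show "rational_series G Hs"
      using c sub unfolding rational_chain_iff_nth rational_series_def by (simp add: last_rev)
  qed
qed

lemma no_abelian_jumps_iff:
  assumes "rational_series G Hs"
  shows "no_abelian_jumps G Hs \<longleftrightarrow> jump_free G (rev Hs)"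
proof -
  have sub: "subgroup (Hs ! i) G" if "i < length Hs" for i
    using assms that by (simp add: rational_series_def)
  have jump: "abelian_jump G Hs i \<longleftrightarrow> i + 2 < length Hs \<and> abelian_over G (Hs ! i) (Hs ! (i + 2))" for i
    using abelian_over_iff[OF sub sub, of i "i + 2"] by (auto simp: abelian_jump_def)
  show ?thesis
    unfolding no_abelian_jumps_def jump jump_free_iff_nth
  proof (intro iffI allI impI)
    fix i assume a: "\<forall>i. \<not> (i + 2 < length Hs \<and> abelian_over G (Hs ! i) (Hs ! (i + 2)))"
      and "i + 2 < length (rev Hs)"
    then have i: "i + 2 < length Hs" by simp
    have "rev Hs ! (i + 2) = Hs ! (length Hs - Suc (i + 2))" "rev Hs ! i = Hs ! (length Hs - Suc (i + 2) + 2)"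
      using i by (auto simp: rev_nth intro!: arg_cong[of _ _ "nth Hs"])
    then show "\<not> abelian_over G (rev Hs ! (i + 2)) (rev Hs ! i)"
      using a[rule_format, of "length Hs - Suc (i + 2)"] i by auto
  next
    fix i assume a: "\<forall>i. i + 2 < length (rev Hs) \<longrightarrow> \<not> abelian_over G (rev Hs ! (i + 2)) (rev Hs ! i)"
    show "\<not> (i + 2 < length Hs \<and> abelian_over G (Hs ! i) (Hs ! (i + 2)))"
    proof
      assume "i + 2 < length Hs \<and> abelian_over G (Hs ! i) (Hs ! (i + 2))"
      then have i: "i + 2 < length Hs" and ab: "abelian_over G (Hs ! i) (Hs ! (i + 2))" by auto
      define j where "j = length Hs - Suc (i + 2)"
      have j: "j + 2 < length Hs" using i unfolding j_def by arith
      have "rev Hs ! (j + 2) = Hs ! i" "rev Hs ! j = Hs ! (i + 2)"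
        using i j by (auto simp: rev_nth j_def intro!: arg_cong[of _ _ "nth Hs"])
      then show False using a[rule_format, of j] ab j by simp
    qed
  qed
qed

lemma rational_series_unique:
  assumes "rational_series G Hs" "no_abelian_jumps G Hs" "rational_series G Ks"
  shows "Ks = Hs"
proof -
  have "Hs \<noteq> []" "Ks \<noteq> []" using assms by (auto simp: rational_series_def)
  then have "rev Ks = rev Hs"
    using assms no_abelian_jumps_iff[OF assms(1)] unfolding rational_series_iff
    by (intro rational_chain_unique) (auto simp: hd_rev)
  then show ?thesis by simp
qed

lemma card_CO:
  assumes Hs: "rational_series G Hs" "no_abelian_jumps G Hs" and nt: "carrier G \<noteq> {\<one>}"
  shows "finite (CO G)" "card (CO G) = 2 ^ (series_length Hs + 1) - 2"
    "card (CO_rel G {\<one>}) = 2 ^ series_length Hs"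
proof -
  have chain: "rational_chain G (rev Hs)" "jump_free G (rev Hs)" and top: "last Hs = carrier G" "Hs \<noteq> []"
    using Hs no_abelian_jumps_iff[OF Hs(1)] rational_series_iff[of Hs] by (auto simp: rational_series_def)
  have hd: "hd (rev Hs) = carrier G" using top by (simp add: hd_rev)
  note cards = card_conrad_cones[OF chain, unfolded hd]
  let ?C = "{P. conrad_cone G (carrier G) P}"
  have len: "series_length Hs + 1 = length Hs" using top by (cases Hs) (auto simp: series_length_def)
  show "finite (CO G)" using bij_betw_finite[OF bij_betw_CO] cards by simp
  have "card (CO G) = card (?C - {{}})" by (rule bij_betw_same_card[OF bij_betw_CO])
  \<comment> \<open>The trivial preorder is discarded here: 2^(n+1) - 1 cones become 2^(n+1) - 2
    preorders.\<close>
  also have "\<dots> = card ?C - 1" using conrad_cone_empty by (simp add: card_Diff_singleton)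
  finally have "card (CO G) = card ?C - 1" .
  moreover have "card ?C + 1 = 2 ^ (series_length Hs + 1)" unfolding len using cards by simp
  ultimately show "card (CO G) = 2 ^ (series_length Hs + 1) - 2" by linarith
  have "inj_on (positive_cone G) (CO_rel G {\<one>})"
    by (rule inj_on_subset[OF bij_betw_imp_inj_on[OF bij_betw_CO]]) (auto simp: CO_rel_def)
  then have "card (CO_rel G {\<one>}) = card (positive_cone G ` CO_rel G {\<one>})" by (simp add: card_image)
  also have "\<dots> = 2 ^ series_length Hs"
    using cards by (simp add: positive_cone_CO_rel[OF nt] series_length_def)
  finally show "card (CO_rel G {\<one>}) = 2 ^ series_length Hs" .
qed

end

theorem corollary6p16:
  fixes G :: "('a, 'b) monoid_scheme" (structure)
  assumes "group G"
    and "\<exists>r. left_order G r \<and> Conradian G r"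
  shows
    "((\<exists>r\<in>CO_rel G {\<one>}. isolated_point (sign_topology G (CO_rel G {\<one>})) r) \<longleftrightarrow>
      (\<forall>r\<in>CO_rel G {\<one>}. isolated_point (sign_topology G (CO_rel G {\<one>})) r)) \<and>
     ((\<forall>r\<in>CO_rel G {\<one>}. isolated_point (sign_topology G (CO_rel G {\<one>})) r) \<longleftrightarrow>
      (\<forall>r\<in>CO G. isolated_point (sign_topology G (CO G)) r)) \<and>
     ((\<forall>r\<in>CO G. isolated_point (sign_topology G (CO G)) r) \<longleftrightarrow>
      (\<exists>Hs. rational_series G Hs \<and> no_abelian_jumps G Hs)) \<and>
     ((\<exists>Hs. rational_series G Hs \<and> no_abelian_jumps G Hs) \<longleftrightarrow>
      (\<exists>Hs. rational_series G Hs \<and> no_abelian_jumps G Hs \<and>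
            (\<forall>Ks. rational_series G Ks \<longrightarrow> Ks = Hs))) \<and>
     ((\<exists>Hs. rational_series G Hs \<and> no_abelian_jumps G Hs \<and>
            (\<forall>Ks. rational_series G Ks \<longrightarrow> Ks = Hs)) \<longleftrightarrow>
      finite (CO_rel G {\<one>})) \<and>
     (finite (CO_rel G {\<one>}) \<longleftrightarrow> finite (CO G)) \<and>
     (finite (CO G) \<longrightarrow>
      (\<forall>Hs. rational_series G Hs \<and> no_abelian_jumps G Hs \<longrightarrow>
            card (CO G) = 2 ^ (series_length Hs + 1) - 2 \<and>
            card (CO_rel G {\<one>}) = 2 ^ series_length Hs))"
    (is "(?a \<longleftrightarrow> ?b) \<and> (?b \<longleftrightarrow> ?c) \<and> (?c \<longleftrightarrow> ?d) \<and> (?d \<longleftrightarrow> ?e) \<and> (?e \<longleftrightarrow> ?f) \<and> (?f \<longleftrightarrow> ?g) \<and> ?counts")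
proof -
  interpret group G by (rule assms(1))
  obtain r0 where r0: "left_order G r0" "Conradian G r0" using assms(2) by blast
  then have mem: "r0 \<in> CO_rel G {\<one>}"
    using left_order_iff_residue by (simp add: CO_rel_def CO_def)
  \<comment> \<open>A left-order is not the full relation, so its cone is nonempty.\<close>
  have nt: "carrier G \<noteq> {\<one>}"
  proof
    assume triv: "carrier G = {\<one>}"
    have lp: "left_preorder G r0" using r0 by (simp add: left_order_def)
    have "(\<one>, \<one>) \<in> r0" using left_preorder_total[OF lp, of \<one> \<one>] by simp
    then have "positive_cone G r0 = {}" using triv by (auto simp: positive_cone_iff[OF lp])
    then show False using positive_cone_nonempty[OF lp] by blast
  qed
  have sub: "CO_rel G {\<one>} \<subseteq> CO G" and lp: "CO G \<subseteq> {r. left_preorder G r}"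
    by (auto simp: CO_rel_def CO_def)
  \<comment> \<open>The implications close the cycle from (a) through (d), (g), (c), (b) back to
    (a); (e) is tied to (d), and (f) is inserted between (g) and (b).\<close>
  have ad: ?d if a: ?a
  proof -
    obtain r where "isolated_point (sign_topology G (CO_rel G {\<one>})) r" using a by blast
    then obtain F where "isolated_order G (positive_cone G r) F"
      using isolated_order_if_isolated_point[OF nt] by blast
    then obtain Hs where Hs: "rational_chain G Hs" "jump_free G Hs" "hd Hs = carrier G"
      using isolated_order.isolated_order_chain by blast
    then have "Hs \<noteq> []" by auto
    then have "rational_series G (rev Hs)" using Hs by (simp add: rational_series_iff last_rev)
    then show ?thesis using no_abelian_jumps_iff Hs(2) by (metis rev_rev_ident)
  qed
  have dg: ?g if ?d using that card_CO(1)[OF _ _ nt] by blast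
  have gc: ?c if ?g using finite_imp_isolated_point[OF that lp] by blast
  have cb: ?b if ?c using that isolated_point_subset[OF _ sub] sub by blast
  \<comment> \<open>The given order \<open>r0\<close> keeps (b) from holding vacuously.\<close>
  have ba: ?a if ?b using that mem by blast
  have de: ?e if ?d using that rational_series_unique by blast
  have ed: ?d if ?e using that by blast
  have gf: ?f if ?g using finite_subset[OF sub that] .
  have fb: ?b if ?f using finite_imp_isolated_point[OF that] sub lp by blast
  have ?counts using card_CO(2,3)[OF _ _ nt] by blast
  then show ?thesis using ad dg gc cb ba de ed gf fb by (intro conjI) satx+
qed

end
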